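(* Let $q\in\mathbb{C}$ be a primitive cube root of unity ($r=3$) and let $\mathrm{Max}=\delta\mathrm{d}:\Omega^1\to\Omega^1$ be the Maxwell operator on the reduced quantum group $\mathcal{A}=\mathbb{C}_q[SL_2]$. Put $e_z=qe_a-q^{-1}e_d$. The subspace of the image of $\mathrm{Max}$ consisting of elements of $e_z\mathcal{A}\oplus e_b\mathcal{A}\oplus e_c\mathcal{A}$ is 40-dimensional. The subspaces of the image of $\mathrm{Max}$ contained in $e_z\mathcal{A}$, $e_b\mathcal{A}$ and $e_c\mathcal{A}$ have respective bases $$\{e_z\},\quad\{e_bf: f=1,c^2,d^2,dc,dc^2,d^2c\},\quad\{e_cf: f=1,a^2,b^2,ab,ab^2,a^2b\}.$$ In particular the 1-forms $A_i$ with curvatures $F_i=\mathrm{d}A_i$ given by $$A_1=\tfrac{q^2}{6}e_z,\qquad F_1=\tfrac{q^2\mu}{6}e_{bc},$$ $$A_2=\tfrac{q^2}{6}e_b,\qquad F_2=-\tfrac{\mu}{6}(q^2e_{ab}+e_{bd}),$$ $$A_3=-\tfrac16e_b\,db^2,\qquad F_3=-\tfrac{\mu}{6}\left(e_{bc}\,d^2b+(q^2e_{ab}+e_{bd})\,db^2\right)$$ satisfy $\delta F_1=e_z$, $\delta F_2=e_b$, $\delta F_3=e_c$. (Here $db^2$ denotes the product $d\cdot b^2$ in $\mathcal{A}$.)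
   Context: Here $q^3=1$, $q\ne1$, $\mu=1-q^{-2}$. $\mathcal{A}$ is the unital $\mathbb{C}$-algebra generated by $a,b,c,d$ with relations $ba=qab$, $ca=qac$, $db=qbd$, $dc=qcd$, $cb=bc$, $da-ad=q\mu bc$, $ad-q^{-1}bc=1$, $a^3=d^3=1$, $b^3=c^3=0$. It has dimension 27 with basis $\{a^mb^nc^k\}_{0\le m,n,k\le2}$. $\Lambda$ is the graded algebra generated by degree-1 elements $e_a,e_b,e_c,e_d$ with relations: $e_b,e_c,e_d$ pairwise anticommute and square to zero; $e_a\wedge e_a=\mu e_b\wedge e_c$; $e_a\wedge e_d+e_d\wedge e_a+\mu e_b\wedge e_c=0$; $e_a\wedge e_b+q^2e_b\wedge e_a-\mu e_b\wedge e_d=0$; $e_c\wedge e_a+q^2e_a\wedge e_c+\mu e_c\wedge e_d=0$. Write $e_{ij\cdots}=e_i\wedge e_j\wedge\cdots$; bases in degrees $2,3,4$ are $\{e_{ab},e_{ac},e_{ad},e_{bc},e_{bd},e_{cd}\}$, $\{e_{abc},e_{abd},e_{acd},e_{bcd}\}$, $\{e_{abcd}\}$. $\Omega=\Lambda\otimes\mathcal{A}$ is the free right $\mathcal{A}$-module on $\Lambda$, with algebra structure given by those of $\Lambda$, $\mathcal{A}$ and the following cross relations, where $(u,v)$ is either $(a,c)$ or $(b,d)$: $ve_b=e_bv$, $ue_c=e_cu$, $ue_d=q^{-1}e_du$, $ve_d=qe_dv$, $ue_b=e_bu+q\mu e_dv$, $ve_c=e_cv+q\mu e_du$, $ve_a=q^{-1}e_av+\mu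 e_bu$, $ue_a=qe_au+\mu e_cv+q\mu^2e_du$. The exterior derivative is $\mathrm{d}\omega=-(\theta\wedge\omega-(-1)^{|\omega|}\omega\wedge\theta)$, $\theta=e_a+e_d$. The Hodge operator $\star:\Omega^i\to\Omega^{4-i}$ is the right $\mathcal{A}$-linear map with $\star1=e_{abcd}$, $\star e_{abcd}=1$, $\star e_a=-e_{abc}-\mu e_{bcd}$, $\star e_b=-e_{abd}$, $\star e_c=q^2e_{acd}$, $\star e_d=e_{bcd}$, $\star e_{ab}=-e_{ab}+2\mu e_{bd}$, $\star e_{ac}=e_{ac}$, $\star e_{ad}=\frac{1}{1+q^2}(2e_{bc}-q^2\mu e_{ad})$, $\star e_{bc}=\frac{q^2}{1+q^2}(2e_{ad}+\mu e_{bc})$, $\star e_{bd}=e_{bd}$, $\star e_{cd}=-e_{cd}$, $\star e_{abc}=-e_a-\mu e_d$, $\star e_{abd}=-e_b$, $\star e_{acd}=q^{-2}e_c$, $\star e_{bcd}=e_d$. Set $\delta=\star\circ\mathrm{d}\circ\star$. *)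

theory Defs
  imports
    Complex_Main
    "HOL-Library.Poly_Mapping"
    "HOL-Library.FuncSet"
    "HOL-Algebra.QuotRing"
    "HOL-Algebra.Embedded_Algebras"
    "HOL-Algebra.Algebraic_Closure_Type"
begin

section \<open>The free unital complex algebra on \<open>a, b, c, d, e\<^sub>a, e\<^sub>b, e\<^sub>c, e\<^sub>d\<close>\<close>

datatype gen = Fun_a | Fun_b | Fun_c | Fun_d | Form_a | Form_b | Form_c | Form_d

text \<open>Words form the free monoid, written additively because the product on
  \<open>_ \<Rightarrow>\<^sub>0 _\<close> is convolution over an additive monoid.\<close>

datatype word = Word (letters: "gen list")

instantiation word :: monoid_add
begin

definition zero_word :: word where "0 = Word []"

definition plus_word :: "word \<Rightarrow> word \<Rightarrow> word" where
  "v + w = Word (letters v @ letters w)"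

instance by standard (simp_all add: zero_word_def plus_word_def)

end

type_synonym falg = "word \<Rightarrow>\<^sub>0 complex"

abbreviation generator :: "gen \<Rightarrow> falg" where
  "generator g \<equiv> Poly_Mapping.single (Word [g]) 1"

definition scale :: "complex \<Rightarrow> falg \<Rightarrow> falg" (infixr \<open>\<cdot>\<close> 75) where
  "z \<cdot> x = Poly_Mapping.single 0 z * x"

abbreviation gen_a (\<open>\<^bold>a\<close>) where "\<^bold>a \<equiv> generator Fun_a"
abbreviation gen_b (\<open>\<^bold>b\<close>) where "\<^bold>b \<equiv> generator Fun_b"
abbreviation gen_c (\<open>\<^bold>c\<close>) where "\<^bold>c \<equiv> generator Fun_c"
abbreviation gen_d (\<open>\<^bold>d\<close>) where "\<^bold>d \<equiv> generator Fun_d"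
abbreviation e\<^sub>a where "e\<^sub>a \<equiv> generator Form_a"
abbreviation e\<^sub>b where "e\<^sub>b \<equiv> generator Form_b"
abbreviation e\<^sub>c where "e\<^sub>c \<equiv> generator Form_c"
abbreviation e\<^sub>d where "e\<^sub>d \<equiv> generator Form_d"

section \<open>The differential graded algebra \<open>\<Omega>\<close> of the reduced quantum group\<close>

definition \<mu> :: "complex \<Rightarrow> complex" where
  "\<mu> q = 1 - 1 / q\<^sup>2"

text \<open>Relations are given as pairs (left-hand side, right-hand side).\<close>

definition A_rels :: "complex \<Rightarrow> (falg \<times> falg) set" where
  "A_rels q =
    {(\<^bold>b * \<^bold>a, q \<cdot> \<^bold>a * \<^bold>b), (\<^bold>c * \<^bold>a, q \<cdot> \<^bold>a * \<^bold>c),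
     (\<^bold>d * \<^bold>b, q \<cdot> \<^bold>b * \<^bold>d), (\<^bold>d * \<^bold>c, q \<cdot> \<^bold>c * \<^bold>d),
     (\<^bold>c * \<^bold>b, \<^bold>b * \<^bold>c),
     (\<^bold>d * \<^bold>a - \<^bold>a * \<^bold>d, (q * \<mu> q) \<cdot> \<^bold>b * \<^bold>c),
     (\<^bold>a * \<^bold>d - inverse q \<cdot> \<^bold>b * \<^bold>c, 1),
     (\<^bold>a ^ 3, 1), (\<^bold>d ^ 3, 1), (\<^bold>b ^ 3, 0), (\<^bold>c ^ 3, 0)}"

definition Lambda_rels :: "complex \<Rightarrow> (falg \<times> falg) set" where
  "Lambda_rels q =
    {(e\<^sub>b * e\<^sub>c + e\<^sub>c * e\<^sub>b, 0), (e\<^sub>b * e\<^sub>d + e\<^sub>d * e\<^sub>b, 0), (e\<^sub>c * e\<^sub>d + e\<^sub>d * e\<^sub>c, 0),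
     (e\<^sub>b * e\<^sub>b, 0), (e\<^sub>c * e\<^sub>c, 0), (e\<^sub>d * e\<^sub>d, 0),
     (e\<^sub>a * e\<^sub>a, \<mu> q \<cdot> e\<^sub>b * e\<^sub>c),
     (e\<^sub>a * e\<^sub>d + e\<^sub>d * e\<^sub>a + \<mu> q \<cdot> e\<^sub>b * e\<^sub>c, 0),
     (e\<^sub>a * e\<^sub>b + q\<^sup>2 \<cdot> e\<^sub>b * e\<^sub>a - \<mu> q \<cdot> e\<^sub>b * e\<^sub>d, 0),
     (e\<^sub>c * e\<^sub>a + q\<^sup>2 \<cdot> e\<^sub>a * e\<^sub>c + \<mu> q \<cdot> e\<^sub>c * e\<^sub>d, 0)}"

definition cross_rels :: "complex \<Rightarrow> (falg \<times> falg) set" where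
  "cross_rels q =
    (\<Union>(u, v) \<in> {(\<^bold>a, \<^bold>c), (\<^bold>b, \<^bold>d)}.
      {(v * e\<^sub>b, e\<^sub>b * v), (u * e\<^sub>c, e\<^sub>c * u),
       (u * e\<^sub>d, inverse q \<cdot> e\<^sub>d * u), (v * e\<^sub>d, q \<cdot> e\<^sub>d * v),
       (u * e\<^sub>b, e\<^sub>b * u + (q * \<mu> q) \<cdot> e\<^sub>d * v),
       (v * e\<^sub>c, e\<^sub>c * v + (q * \<mu> q) \<cdot> e\<^sub>d * u),
       (v * e\<^sub>a, inverse q \<cdot> e\<^sub>a * v + \<mu> q \<cdot> e\<^sub>b * u),
       (u * e\<^sub>a, q \<cdot> e\<^sub>a * u + \<mu> q \<cdot> e\<^sub>c * v + (q * (\<mu> q)\<^sup>2) \<cdot> e\<^sub>d * u)})"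

definition rel_ideal :: "complex \<Rightarrow> falg set" where
  "rel_ideal q =
    Idl\<^bsub>ring_of_type_algebra\<^esub>
      ((\<lambda>(l, r). l - r) ` (A_rels q \<union> Lambda_rels q \<union> cross_rels q))"

text \<open>\<open>\<Omega>\<close> is presented by the relations of \<open>\<A>\<close>, those of \<open>\<Lambda>\<close> and the cross relations.
  The cross relations move every element of \<open>\<A>\<close> to the right of the forms, and the
  presented algebra is the free right \<open>\<A>\<close>-module \<open>\<Lambda> \<otimes> \<A>\<close>. The multiplication in
  \<open>\<Omega>\<close> comprises the wedge product.\<close>

definition \<Omega> :: "complex \<Rightarrow> falg set ring" where
  "\<Omega> q = ring_of_type_algebra Quot rel_ideal q"

definition cl :: "complex \<Rightarrow> falg \<Rightarrow> falg set" where
  "cl q x = rel_ideal q +>\<^bsub>ring_of_type_algebra\<^esub> x"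

lemma ring_\<Omega>: "ring (\<Omega> q)"
proof -
  have "\<exists>y. x + y = 0" for x :: falg
    using add.right_inverse by blast
  then interpret F: ring "ring_of_type_algebra :: falg ring"
    unfolding ring_of_type_algebra_def using add.right_inverse
    by unfold_locales (auto simp: algebra_simps Units_def)
  have "ideal (rel_ideal q) (ring_of_type_algebra :: falg ring)"
    unfolding rel_ideal_def by (rule F.genideal_ideal) (simp add: ring_of_type_algebra_def)
  then show ?thesis
    unfolding \<Omega>_def by (rule ideal.quotient_is_ring)
qed

text \<open>The field of scalars inside \<open>\<Omega>\<close>, over which spans and dimensions are taken.\<close>

definition scalars :: "complex \<Rightarrow> falg set set" where
  "scalars q = range (\<lambda>z. cl q (z \<cdot> 1))"

definition form_degree :: "word \<Rightarrow> nat" where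
  "form_degree w =
    length (filter (\<lambda>g. g \<in> {Form_a, Form_b, Form_c, Form_d}) (letters w))"

definition Omega_deg :: "complex \<Rightarrow> nat \<Rightarrow> falg set set" where
  "Omega_deg q i = cl q ` {x. \<forall>w \<in> Poly_Mapping.keys x. form_degree w = i}"

text \<open>\<open>\<A> = \<Omega>\<^sup>0\<close>, the classes of polynomials in \<open>a, b, c, d\<close> alone.\<close>

definition \<A> :: "complex \<Rightarrow> falg set set" where
  "\<A> q = Omega_deg q 0"

definition times_\<A> :: "complex \<Rightarrow> falg \<Rightarrow> falg set set" where
  "times_\<A> q e = {cl q e \<otimes>\<^bsub>\<Omega> q\<^esub> f | f. f \<in> \<A> q}"

text \<open>The exterior derivative on \<open>\<Omega>\<^sup>i\<close>; the degree is passed explicitly.\<close>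

definition ext_d :: "complex \<Rightarrow> nat \<Rightarrow> falg set \<Rightarrow> falg set" where
  "ext_d q i \<omega> =
    (let \<theta> = cl q (e\<^sub>a + e\<^sub>d) in
      \<ominus>\<^bsub>\<Omega> q\<^esub> (\<theta> \<otimes>\<^bsub>\<Omega> q\<^esub> \<omega> \<ominus>\<^bsub>\<Omega> q\<^esub> cl q ((- 1) ^ i) \<otimes>\<^bsub>\<Omega> q\<^esub> (\<omega> \<otimes>\<^bsub>\<Omega> q\<^esub> \<theta>)))"

text \<open>Pairs of a basis element of \<open>\<Lambda>\<close> and its image under the Hodge operator.\<close>

definition hodge_table :: "complex \<Rightarrow> (falg \<times> falg) set" where
  "hodge_table q =
    {(1, e\<^sub>a * e\<^sub>b * e\<^sub>c * e\<^sub>d),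
     (e\<^sub>a * e\<^sub>b * e\<^sub>c * e\<^sub>d, 1),
     (e\<^sub>a, - (e\<^sub>a * e\<^sub>b * e\<^sub>c) - \<mu> q \<cdot> e\<^sub>b * e\<^sub>c * e\<^sub>d),
     (e\<^sub>b, - (e\<^sub>a * e\<^sub>b * e\<^sub>d)),
     (e\<^sub>c, q\<^sup>2 \<cdot> e\<^sub>a * e\<^sub>c * e\<^sub>d),
     (e\<^sub>d, e\<^sub>b * e\<^sub>c * e\<^sub>d),
     (e\<^sub>a * e\<^sub>b, - (e\<^sub>a * e\<^sub>b) + (2 * \<mu> q) \<cdot> e\<^sub>b * e\<^sub>d),
     (e\<^sub>a * e\<^sub>c, e\<^sub>a * e\<^sub>c),
     (e\<^sub>a * e\<^sub>d, (1 / (1 + q\<^sup>2)) \<cdot> (2 \<cdot> e\<^sub>b * e\<^sub>c - (q\<^sup>2 * \<mu> q) \<cdot> e\<^sub>a * e\<^sub>d)),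
     (e\<^sub>b * e\<^sub>c, (q\<^sup>2 / (1 + q\<^sup>2)) \<cdot> (2 \<cdot> e\<^sub>a * e\<^sub>d + \<mu> q \<cdot> e\<^sub>b * e\<^sub>c)),
     (e\<^sub>b * e\<^sub>d, e\<^sub>b * e\<^sub>d),
     (e\<^sub>c * e\<^sub>d, - (e\<^sub>c * e\<^sub>d)),
     (e\<^sub>a * e\<^sub>b * e\<^sub>c, - e\<^sub>a - \<mu> q \<cdot> e\<^sub>d),
     (e\<^sub>a * e\<^sub>b * e\<^sub>d, - e\<^sub>b),
     (e\<^sub>a * e\<^sub>c * e\<^sub>d, (1 / q\<^sup>2) \<cdot> e\<^sub>c),
     (e\<^sub>b * e\<^sub>c * e\<^sub>d, e\<^sub>d)}"

definition is_hodge :: "complex \<Rightarrow> (falg set \<Rightarrow> falg set) \<Rightarrow> bool" where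
  "is_hodge q s \<longleftrightarrow>
     s \<in> carrier (\<Omega> q) \<rightarrow>\<^sub>E carrier (\<Omega> q) \<and>
     (\<forall>\<omega> \<in> carrier (\<Omega> q). \<forall>\<eta> \<in> carrier (\<Omega> q). s (\<omega> \<oplus>\<^bsub>\<Omega> q\<^esub> \<eta>) = s \<omega> \<oplus>\<^bsub>\<Omega> q\<^esub> s \<eta>) \<and>
     (\<forall>\<omega> \<in> carrier (\<Omega> q). \<forall>f \<in> \<A> q. s (\<omega> \<otimes>\<^bsub>\<Omega> q\<^esub> f) = s \<omega> \<otimes>\<^bsub>\<Omega> q\<^esub> f) \<and>
     (\<forall>(x, y) \<in> hodge_table q. s (cl q x) = cl q y)"

text \<open>The right \<open>\<A>\<close>-linear map with the prescribed values; it exists and is unique for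
  primitive cube roots of unity \<open>q\<close>, since the left entries of the table form a basis of
  the free right \<open>\<A>\<close>-module \<open>\<Omega>\<close>.\<close>

definition hodge :: "complex \<Rightarrow> falg set \<Rightarrow> falg set" where
  "hodge q = (THE s. is_hodge q s)"

definition codiff :: "complex \<Rightarrow> nat \<Rightarrow> falg set \<Rightarrow> falg set" where
  "codiff q i \<omega> = hodge q (ext_d q (4 - i) (hodge q \<omega>))"

text \<open>\<open>\<delta>\<close> is applied to a 2-form here.\<close>

definition Maxwell :: "complex \<Rightarrow> falg set \<Rightarrow> falg set" where
  "Maxwell q A = codiff q 2 (ext_d q 1 A)"

definition e\<^sub>z :: "complex \<Rightarrow> falg" where
  "e\<^sub>z q = q \<cdot> e\<^sub>a - inverse q \<cdot> e\<^sub>d"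

definition is_basis :: "complex \<Rightarrow> falg set list \<Rightarrow> falg set set \<Rightarrow> bool" where
  "is_basis q us W \<longleftrightarrow>
     ring.independent (\<Omega> q) (scalars q) us \<and> ring.Span (\<Omega> q) (scalars q) us = W"

end

theory Submission
  imports Defs "HOL-Library.Function_Algebras"
begin

text \<open>All structure constants lie in \<open>\<int>[q]\<close> with \<open>q\<^sup>2 = - 1 - q\<close>. Rewriting with the relations
  brings every element into the form \<open>\<Sum> e\<^sub>S f\<^sub>S\<close> with \<open>f\<^sub>S\<close> a combination of the monomials
  \<open>a\<^sup>m b\<^sup>n c\<^sup>k\<close>; conversely the eight generators act on the 432-dimensional space of such formal
  normal forms and this action satisfies the relations, so that the action on the vacuum vector
  inverts the normal form. Hence \<open>\<Omega>\<close> is free over \<open>\<A>\<close> and the Hodge operator exists.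
  Moving \<open>\<theta>\<close> past \<open>\<A>\<close> yields operators \<open>D\<^sub>a, D\<^sub>b, D\<^sub>c, D\<^sub>d\<close> that generate a copy of the reduced
  enveloping algebra of \<open>sl\<^sub>2\<close>, and the Maxwell operator becomes a 4 by 4 matrix of quadratic
  polynomials in them. Its image is cut out by linear equations that express 54 of the 108
  coordinates of a 1-form through the others, and sparse preimages show that no further
  equations hold on the forms over \<open>e\<^sub>z, e\<^sub>b, e\<^sub>c\<close>.\<close>

section \<open>Computing with residue classes\<close>

text \<open>Since \<open>hodge\<close> is a \<open>THE\<close>, nothing about delta can be computed
  before freeness is known: existence of the operator needs the forms e_S to be independent over A,
  uniqueness needs them to span. Rewriting alone yields only the spanning; it cannot exclude that
  the relations force further ones. Independence comes from a representation, and the tables that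
  describe the rewriting double as its matrices, so one set of constants serves both halves. After
  that every claim is an identity between complex functions on 16 * 27 indices. The elimination
  behind the image is not replayed: its outcome is a linear projection with 40 pivots, and it
  suffices to check that the image satisfies the equations and that each solution over e_z, e_b, e_c
  has a preimage.\<close>

abbreviation FA :: "falg ring" where "FA \<equiv> ring_of_type_algebra"

lemma ring_FA: "ring FA"
proof -
  have "\<exists>y. x + y = 0" for x :: falg
    using add.right_inverse by blast
  then show ?thesis
    unfolding ring_of_type_algebra_def using add.right_inverse
    by unfold_locales (auto simp: algebra_simps Units_def)
qed

lemma FA_simps [simp]:
  "carrier FA = UNIV" "x \<otimes>\<^bsub>FA\<^esub> y = x * y" "x \<oplus>\<^bsub>FA\<^esub> y = x + y" "\<one>\<^bsub>FA\<^esub> = 1" "\<zero>\<^bsub>FA\<^esub> = 0"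
  by (simp_all add: ring_of_type_algebra_def)

lemma FA_uminus [simp]: "\<ominus>\<^bsub>FA\<^esub> x = - x"
proof -
  interpret ring FA by (rule ring_FA)
  have "x + \<ominus>\<^bsub>FA\<^esub> x = 0" using r_neg[of x] by simp
  then show ?thesis by (simp add: eq_neg_iff_add_eq_0 add.commute)
qed

lemma ideal_rel_ideal: "ideal (rel_ideal q) FA"
proof -
  interpret ring FA by (rule ring_FA)
  show ?thesis unfolding rel_ideal_def by (rule genideal_ideal) simp
qed

lemma rel_ideal_least:
  assumes "ideal I FA" and "\<And>l r. (l, r) \<in> A_rels q \<union> Lambda_rels q \<union> cross_rels q \<Longrightarrow> l - r \<in> I"
  shows "rel_ideal q \<subseteq> I"
proof -
  interpret ring FA by (rule ring_FA)
  show ?thesis unfolding rel_ideal_def by (rule genideal_minimal[OF assms(1)]) (use assms(2) in auto)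
qed

lemma rel_ideal_rel:
  assumes "(l, r) \<in> A_rels q \<union> Lambda_rels q \<union> cross_rels q"
  shows "l - r \<in> rel_ideal q"
proof -
  interpret ring FA by (rule ring_FA)
  have "(\<lambda>(l, r). l - r) ` (A_rels q \<union> Lambda_rels q \<union> cross_rels q) \<subseteq> rel_ideal q"
    unfolding rel_ideal_def by (rule genideal_self) simp
  with assms show ?thesis by auto
qed

lemma rel_ideal_0 [simp]: "0 \<in> rel_ideal q"
  and rel_ideal_add: "x \<in> rel_ideal q \<Longrightarrow> y \<in> rel_ideal q \<Longrightarrow> x + y \<in> rel_ideal q"
  and rel_ideal_uminus: "x \<in> rel_ideal q \<Longrightarrow> - x \<in> rel_ideal q"
  and rel_ideal_mult_left: "x \<in> rel_ideal q \<Longrightarrow> z * x \<in> rel_ideal q"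
  and rel_ideal_mult_right: "x \<in> rel_ideal q \<Longrightarrow> x * z \<in> rel_ideal q"
proof -
  interpret ideal "rel_ideal q" FA by (rule ideal_rel_ideal)
  show "0 \<in> rel_ideal q"
    using additive_subgroup.zero_closed[OF additive_subgroup_axioms] by simp
  show "x \<in> rel_ideal q \<Longrightarrow> y \<in> rel_ideal q \<Longrightarrow> x + y \<in> rel_ideal q" using additive_subgroup.a_closed[OF additive_subgroup_axioms] by simp
  show "x \<in> rel_ideal q \<Longrightarrow> - x \<in> rel_ideal q" using additive_subgroup.a_inv_closed[OF additive_subgroup_axioms] by simp
  show "x \<in> rel_ideal q \<Longrightarrow> z * x \<in> rel_ideal q" using I_l_closed[of x z] by simp
  show "x \<in> rel_ideal q \<Longrightarrow> x * z \<in> rel_ideal q" using I_r_closed[of x z] by simp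
qed

lemma rel_ideal_diff: "x \<in> rel_ideal q \<Longrightarrow> y \<in> rel_ideal q \<Longrightarrow> x - y \<in> rel_ideal q"
  using rel_ideal_add[of x q "- y"] rel_ideal_uminus by auto

lemma rel_ideal_mult_cong:
  assumes "x - x' \<in> rel_ideal q" "y - y' \<in> rel_ideal q"
  shows "x * y - x' * y' \<in> rel_ideal q"
proof -
  have "x * y - x' * y' = (x - x') * y + x' * (y - y')" by (simp add: algebra_simps)
  then show ?thesis using assms by (simp add: rel_ideal_add rel_ideal_mult_left rel_ideal_mult_right)
qed

lemma cl_eq_iff: "cl q x = cl q y \<longleftrightarrow> x - y \<in> rel_ideal q"
proof -
  interpret ideal "rel_ideal q" FA by (rule ideal_rel_ideal)
  show ?thesis using quotient_eq_iff_same_a_r_cos[OF ideal_rel_ideal, of x y]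
    by (simp add: cl_def a_minus_def)
qed

lemma carrier_\<Omega>: "carrier (\<Omega> q) = range (cl q)"
  unfolding \<Omega>_def cl_def FactRing_def A_RCOSETS_def' by auto

lemma cl_carrier [simp]: "cl q x \<in> carrier (\<Omega> q)"
  by (simp add: carrier_\<Omega>)

lemma cl_mult: "cl q x \<otimes>\<^bsub>\<Omega> q\<^esub> cl q y = cl q (x * y)"
proof -
  interpret ideal "rel_ideal q" FA by (rule ideal_rel_ideal)
  show ?thesis using rcoset_mult_add[of x y] by (simp add: \<Omega>_def cl_def FactRing_def)
qed

lemma cl_add: "cl q x \<oplus>\<^bsub>\<Omega> q\<^esub> cl q y = cl q (x + y)"
proof -
  interpret ideal "rel_ideal q" FA by (rule ideal_rel_ideal)
  show ?thesis using a_rcos_sum[of x y] by (simp add: \<Omega>_def cl_def FactRing_def)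
qed

lemma cl_zero: "\<zero>\<^bsub>\<Omega> q\<^esub> = cl q 0"
proof -
  interpret ring "\<Omega> q" by (rule ring_\<Omega>)
  have "cl q 0 \<oplus>\<^bsub>\<Omega> q\<^esub> cl q 0 = cl q 0" by (simp add: cl_add)
  then show ?thesis using add.r_cancel_one'[of "cl q 0" "cl q 0"] by simp
qed

lemma cl_uminus: "\<ominus>\<^bsub>\<Omega> q\<^esub> cl q x = cl q (- x)"
proof -
  interpret ring "\<Omega> q" by (rule ring_\<Omega>)
  have "cl q (- x) \<oplus>\<^bsub>\<Omega> q\<^esub> cl q x = \<zero>\<^bsub>\<Omega> q\<^esub>" by (simp add: cl_add cl_zero)
  then show ?thesis using minus_equality[of "cl q (- x)" "cl q x"] by simp
qed

lemma cl_diff: "cl q x \<ominus>\<^bsub>\<Omega> q\<^esub> cl q y = cl q (x - y)"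
  by (simp add: a_minus_def cl_uminus cl_add)

section \<open>Scalars\<close>

abbreviation Const :: "complex \<Rightarrow> falg" where "Const z \<equiv> Poly_Mapping.single 0 z"

lemma falg_induct [case_names single add]:
  fixes x :: falg
  assumes "\<And>w z. P (Poly_Mapping.single w z)" and "\<And>x y. P x \<Longrightarrow> P y \<Longrightarrow> P (x + y)"
  shows "P x"
proof (induction x rule: update_induct)
  case const
  show ?case using assms(1)[of 0 0] by simp
next
  case (update f k z)
  then have "Poly_Mapping.update k z f = f + Poly_Mapping.single k z"
    by (intro poly_mapping_eqI) (auto simp: lookup_update lookup_add lookup_single in_keys_iff when_def)
  then show ?case using update assms by metis
qed

text \<open>Elements are built from 1 by left multiplication with generators, which is the form in
  which an action given letter by letter can be compared with multiplication.\<close>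

lemma falg_word_induct [case_names one gen scale add]:
  fixes x :: falg
  assumes one: "P 1" and gen: "\<And>g x. P x \<Longrightarrow> P (generator g * x)"
    and scale: "\<And>z x. P x \<Longrightarrow> P (z \<cdot> x)" and add: "\<And>x y. P x \<Longrightarrow> P y \<Longrightarrow> P (x + y)"
  shows "P x"
proof (induction x rule: falg_induct)
  case (single w z)
  have "P (Poly_Mapping.single (Word gs) 1)" for gs
  proof (induction gs)
    case Nil
    show ?case using one by (simp flip: zero_word_def)
  next
    case (Cons g gs)
    then have "P (generator g * Poly_Mapping.single (Word gs) 1)" by (rule gen)
    then show ?case by (simp add: mult_single plus_word_def)
  qed
  then have "P (z \<cdot> Poly_Mapping.single w 1)" by (cases w) (simp add: scale)
  then show ?case by (simp add: scale_def mult_single)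
qed (rule add)

lemma Const_commute: "x * Const z = Const z * x"
  by (induction x rule: falg_induct) (simp_all add: mult_single mult.commute distrib_left distrib_right)

lemma Const_simps:
  "Const (y + z) = Const y + Const z" "Const (y * z) = Const y * Const z"
  "Const (- z) = - Const z" "Const 1 = 1" "Const 0 = 0" "Const (y - z) = Const y - Const z"
  by (simp_all add: single_add mult_single single_uminus single_diff)

lemma scale_simps:
  "z \<cdot> (x + y) = z \<cdot> x + z \<cdot> y" "z \<cdot> (- x) = - (z \<cdot> x)" "z \<cdot> (x - y) = z \<cdot> x - z \<cdot> y"
  "z \<cdot> 0 = 0" "w \<cdot> (z \<cdot> x) = (w * z) \<cdot> x" "1 \<cdot> x = x" "0 \<cdot> x = 0"
  "z \<cdot> x * y = z \<cdot> (x * y)"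
  by (simp_all add: scale_def mult_single distrib_left right_diff_distrib flip: mult.assoc)

lemma mult_scale: "x * z \<cdot> y = z \<cdot> (x * y)"
  unfolding scale_def mult.assoc[symmetric] Const_commute ..

locale cube_root =
  fixes q :: complex
  assumes cube: "q ^ 3 = 1" and nontriv: "q \<noteq> 1"
begin

lemma q_nonzero [simp]: "q \<noteq> 0"
  using cube by auto

text \<open>Used from left to right, together with its nested form below, this reduces every
  polynomial in q to a + b q, so that comparing structure constants amounts to comparing
  integers.\<close>

lemma q_sum: "q * q = - 1 - q"
proof -
  have "(q - 1) * (q * q + q + 1) = q ^ 3 - 1" by (simp add: algebra_simps power3_eq_cube)
  then have "q * q + q + 1 = 0" using cube nontriv by simp
  then show ?thesis by (simp add: algebra_simps eq_neg_iff_add_eq_0)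
qed

lemma q_sum_left: "q * (q * z) = - z - q * z"
  by (simp add: q_sum left_diff_distrib flip: mult.assoc)

lemma q_square: "q\<^sup>2 = - 1 - q"
  by (simp add: power2_eq_square q_sum)

lemma inverse_q: "inverse q = - 1 - q"
proof -
  have "q * (- 1 - q) = 1" by (simp add: right_diff_distrib q_sum)
  then show ?thesis by (rule inverse_unique)
qed

lemma \<mu>_q: "\<mu> q = 1 - q"
proof -
  have "q\<^sup>2 * q = 1" using cube by (simp add: power2_eq_square power3_eq_cube)
  then have "1 / q\<^sup>2 = q" by (metis inverse_unique inverse_eq_divide)
  then show ?thesis by (simp add: \<mu>_def)
qed

end

section \<open>The normal form of elements of the presented algebra\<close>

datatype lam = L0 | La | Lb | Lc | Ld | Lab | Lac | Lad | Lbc | Lbd | Lcd | Labc | Labd | Lacd | Lbcd | Labcd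

text \<open>Left multiplication by the generators in the basis \<open>e\<^sub>S\<close>, with \<open>\<mu> = 1 - q\<close> and all powers of
  \<open>q\<close> reduced. The coefficients live in an arbitrary module with scalar multiplication
  \<open>sm\<close>, since the tables serve both for the presented algebra and for its model.\<close>

primrec form_a :: "complex \<Rightarrow> (complex \<Rightarrow> 'm \<Rightarrow> 'm) \<Rightarrow> (lam \<Rightarrow> 'm) \<Rightarrow> lam \<Rightarrow> 'm :: ab_group_add" where
  "form_a q sm v L0 = 0" |
  "form_a q sm v La = v L0" |
  "form_a q sm v Lb = 0" |
  "form_a q sm v Lc = 0" |
  "form_a q sm v Ld = 0" |
  "form_a q sm v Lab = v Lb" |
  "form_a q sm v Lac = v Lc" |
  "form_a q sm v Lad = v Ld" |
  "form_a q sm v Lbc = sm (1 - q) (v La)" |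
  "form_a q sm v Lbd = 0" |
  "form_a q sm v Lcd = 0" |
  "form_a q sm v Labc = v Lbc" |
  "form_a q sm v Labd = v Lbd" |
  "form_a q sm v Lacd = v Lcd" |
  "form_a q sm v Lbcd = sm (1 - q) (v Lad)" |
  "form_a q sm v Labcd = v Lbcd"

primrec form_b :: "complex \<Rightarrow> (complex \<Rightarrow> 'm \<Rightarrow> 'm) \<Rightarrow> (lam \<Rightarrow> 'm) \<Rightarrow> lam \<Rightarrow> 'm :: ab_group_add" where
  "form_b q sm v L0 = 0" |
  "form_b q sm v La = 0" |
  "form_b q sm v Lb = v L0" |
  "form_b q sm v Lc = 0" |
  "form_b q sm v Ld = 0" |
  "form_b q sm v Lab = sm (- q) (v La)" |
  "form_b q sm v Lac = 0" |
  "form_b q sm v Lad = 0" |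
  "form_b q sm v Lbc = v Lc" |
  "form_b q sm v Lbd = sm (1 + 2 * q) (v La) + v Ld" |
  "form_b q sm v Lcd = 0" |
  "form_b q sm v Labc = sm (- q) (v Lac)" |
  "form_b q sm v Labd = sm (- q) (v Lad)" |
  "form_b q sm v Lacd = 0" |
  "form_b q sm v Lbcd = sm (- 1 - 2 * q) (v Lac) + v Lcd" |
  "form_b q sm v Labcd = sm (- q) (v Lacd)"

primrec form_c :: "complex \<Rightarrow> (complex \<Rightarrow> 'm \<Rightarrow> 'm) \<Rightarrow> (lam \<Rightarrow> 'm) \<Rightarrow> lam \<Rightarrow> 'm :: ab_group_add" where
  "form_c q sm v L0 = 0" |
  "form_c q sm v La = 0" |
  "form_c q sm v Lb = 0" |
  "form_c q sm v Lc = v L0" |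
  "form_c q sm v Ld = 0" |
  "form_c q sm v Lab = 0" |
  "form_c q sm v Lac = sm (1 + q) (v La)" |
  "form_c q sm v Lad = 0" |
  "form_c q sm v Lbc = - (v Lb)" |
  "form_c q sm v Lbd = 0" |
  "form_c q sm v Lcd = sm (- 1 + q) (v La) + v Ld" |
  "form_c q sm v Labc = sm (- 1 - q) (v Lab)" |
  "form_c q sm v Labd = 0" |
  "form_c q sm v Lacd = sm (1 + q) (v Lad)" |
  "form_c q sm v Lbcd = sm (- 1 + q) (v Lab) - (v Lbd)" |
  "form_c q sm v Labcd = sm (- 1 - q) (v Labd)"

primrec form_d :: "complex \<Rightarrow> (complex \<Rightarrow> 'm \<Rightarrow> 'm) \<Rightarrow> (lam \<Rightarrow> 'm) \<Rightarrow> lam \<Rightarrow> 'm :: ab_group_add" where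
  "form_d q sm v L0 = 0" |
  "form_d q sm v La = 0" |
  "form_d q sm v Lb = 0" |
  "form_d q sm v Lc = 0" |
  "form_d q sm v Ld = v L0" |
  "form_d q sm v Lab = 0" |
  "form_d q sm v Lac = 0" |
  "form_d q sm v Lad = - (v La)" |
  "form_d q sm v Lbc = sm (- 1 + q) (v La)" |
  "form_d q sm v Lbd = - (v Lb)" |
  "form_d q sm v Lcd = - (v Lc)" |
  "form_d q sm v Labc = 0" |
  "form_d q sm v Labd = v Lab" |
  "form_d q sm v Lacd = v Lac" |
  "form_d q sm v Lbcd = sm (- 1 + q) (v Lad) + v Lbc" |
  "form_d q sm v Labcd = - (v Labc)"

text \<open>Left multiplication by \<open>u\<close> and by \<open>v\<close> for one of the pairs \<open>(u, v)\<close> of the cross relations;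
  \<open>f\<close> and \<open>g\<close> are the multiplications by \<open>u\<close> and \<open>v\<close> on the coefficients.\<close>

primrec row_u :: "complex \<Rightarrow> (complex \<Rightarrow> 'm \<Rightarrow> 'm) \<Rightarrow> ('m \<Rightarrow> 'm) \<Rightarrow> ('m \<Rightarrow> 'm) \<Rightarrow> (lam \<Rightarrow> 'm) \<Rightarrow> lam \<Rightarrow> 'm :: ab_group_add" where
  "row_u q sm f g v L0 = f (v L0)" |
  "row_u q sm f g v La = sm q (f (v La))" |
  "row_u q sm f g v Lb = f (v Lb)" |
  "row_u q sm f g v Lc = sm (1 - q) (g (v La)) + f (v Lc)" |
  "row_u q sm f g v Ld = sm (3 + 3 * q) (f (v La)) + sm (1 + 2 * q) (g (v Lb)) + sm (- 1 - q) (f (v Ld))" |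
  "row_u q sm f g v Lab = sm q (f (v Lab))" |
  "row_u q sm f g v Lac = sm q (f (v Lac))" |
  "row_u q sm f g v Lad = sm (- 2 - q) (g (v Lab)) + f (v Lad)" |
  "row_u q sm f g v Lbc = sm (- 1 + q) (g (v Lab)) + f (v Lbc)" |
  "row_u q sm f g v Lbd = sm (- 3 - 3 * q) (f (v Lab)) + sm (- 1 - q) (f (v Lbd))" |
  "row_u q sm f g v Lcd = sm (1 + 2 * q) (g (v Lad)) + sm (- 1 - 2 * q) (g (v Lbc)) + sm (- 1 - q) (f (v Lcd))" |
  "row_u q sm f g v Labc = sm q (f (v Labc))" |
  "row_u q sm f g v Labd = f (v Labd)" |
  "row_u q sm f g v Lacd = sm (2 + q) (g (v Labc)) + f (v Lacd)" |
  "row_u q sm f g v Lbcd = sm (- 1 - 2 * q) (g (v Labd)) + sm (- 1 - q) (f (v Lbcd))" |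
  "row_u q sm f g v Labcd = f (v Labcd)"

primrec row_v :: "complex \<Rightarrow> (complex \<Rightarrow> 'm \<Rightarrow> 'm) \<Rightarrow> ('m \<Rightarrow> 'm) \<Rightarrow> ('m \<Rightarrow> 'm) \<Rightarrow> (lam \<Rightarrow> 'm) \<Rightarrow> lam \<Rightarrow> 'm :: ab_group_add" where
  "row_v q sm f g v L0 = g (v L0)" |
  "row_v q sm f g v La = sm (- 1 - q) (g (v La))" |
  "row_v q sm f g v Lb = sm (1 - q) (f (v La)) + g (v Lb)" |
  "row_v q sm f g v Lc = g (v Lc)" |
  "row_v q sm f g v Ld = sm (1 + 2 * q) (f (v Lc)) + sm q (g (v Ld))" |
  "row_v q sm f g v Lab = sm (- 1 - q) (g (v Lab))" |
  "row_v q sm f g v Lac = sm (- 1 - q) (g (v Lac))" |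
  "row_v q sm f g v Lad = sm (1 - q) (f (v Lac)) + g (v Lad)" |
  "row_v q sm f g v Lbc = sm (1 - q) (f (v Lac)) + g (v Lbc)" |
  "row_v q sm f g v Lbd = sm (3 + 3 * q) (g (v Lab)) + sm (- 2 - q) (f (v Lad)) + sm (1 + 2 * q) (f (v Lbc)) + sm q (g (v Lbd))" |
  "row_v q sm f g v Lcd = sm q (g (v Lcd))" |
  "row_v q sm f g v Labc = sm (- 1 - q) (g (v Labc))" |
  "row_v q sm f g v Labd = sm (1 - q) (f (v Labc)) + g (v Labd)" |
  "row_v q sm f g v Lacd = g (v Lacd)" |
  "row_v q sm f g v Lbcd = sm (- 3 - 3 * q) (g (v Labc)) + sm (- 2 - q) (f (v Lacd)) + sm q (g (v Lbcd))" |
  "row_v q sm f g v Labcd = g (v Labcd)"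


primrec lam_mon :: "lam \<Rightarrow> falg" where
  "lam_mon L0 = 1" |
  "lam_mon La = e\<^sub>a" |
  "lam_mon Lb = e\<^sub>b" |
  "lam_mon Lc = e\<^sub>c" |
  "lam_mon Ld = e\<^sub>d" |
  "lam_mon Lab = e\<^sub>a * e\<^sub>b" |
  "lam_mon Lac = e\<^sub>a * e\<^sub>c" |
  "lam_mon Lad = e\<^sub>a * e\<^sub>d" |
  "lam_mon Lbc = e\<^sub>b * e\<^sub>c" |
  "lam_mon Lbd = e\<^sub>b * e\<^sub>d" |
  "lam_mon Lcd = e\<^sub>c * e\<^sub>d" |
  "lam_mon Labc = e\<^sub>a * e\<^sub>b * e\<^sub>c" |
  "lam_mon Labd = e\<^sub>a * e\<^sub>b * e\<^sub>d" |
  "lam_mon Lacd = e\<^sub>a * e\<^sub>c * e\<^sub>d" |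
  "lam_mon Lbcd = e\<^sub>b * e\<^sub>c * e\<^sub>d" |
  "lam_mon Labcd = e\<^sub>a * e\<^sub>b * e\<^sub>c * e\<^sub>d"

definition lams :: "lam list" where
  "lams = [L0, La, Lb, Lc, Ld, Lab, Lac, Lad, Lbc, Lbd, Lcd, Labc, Labd, Lacd, Lbcd, Labcd]"

definition lam_sum :: "(lam \<Rightarrow> falg) \<Rightarrow> falg" where
  "lam_sum x = (\<Sum>S\<leftarrow>lams. lam_mon S * x S)"

text \<open>To let the simplifier rewrite modulo the ideal, the quotients for all primitive cube
  roots \<open>q\<close> at once are made a type: types may not depend on \<open>q\<close>.\<close>

definition fam_rel :: "(complex \<Rightarrow> falg) \<Rightarrow> (complex \<Rightarrow> falg) \<Rightarrow> bool" where
  "fam_rel x y \<longleftrightarrow> (\<forall>q. cube_root q \<longrightarrow> x q - y q \<in> rel_ideal q)"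

quotient_type fam = "complex \<Rightarrow> falg" / fam_rel
proof (rule equivpI)
  show "reflp fam_rel" by (simp add: reflp_def fam_rel_def)
  show "symp fam_rel"
    unfolding symp_def fam_rel_def by (metis minus_diff_eq rel_ideal_uminus)
  show "transp fam_rel"
  proof (rule transpI)
    fix x y z assume "fam_rel x y" "fam_rel y z"
    then have "(x q - y q) + (y q - z q) \<in> rel_ideal q" if "cube_root q" for q
      using that by (intro rel_ideal_add) (auto simp: fam_rel_def)
    then show "fam_rel x z" by (simp add: fam_rel_def)
  qed
qed

instantiation fam :: ring
begin

lift_definition zero_fam :: fam is "\<lambda>_. 0" .
lift_definition plus_fam :: "fam \<Rightarrow> fam \<Rightarrow> fam" is "\<lambda>x y q. x q + y q"
  unfolding fam_rel_def by (metis add_diff_add rel_ideal_add)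
lift_definition uminus_fam :: "fam \<Rightarrow> fam" is "\<lambda>x q. - x q"
  unfolding fam_rel_def by (metis minus_diff_minus rel_ideal_uminus)
lift_definition minus_fam :: "fam \<Rightarrow> fam \<Rightarrow> fam" is "\<lambda>x y q. x q - y q"
  unfolding fam_rel_def
proof (intro allI impI)
  fix x x' y y' :: "complex \<Rightarrow> falg" and q
  assume "\<forall>q. cube_root q \<longrightarrow> x q - x' q \<in> rel_ideal q"
    "\<forall>q. cube_root q \<longrightarrow> y q - y' q \<in> rel_ideal q" "cube_root q"
  then have "(x q - x' q) - (y q - y' q) \<in> rel_ideal q" by (blast intro: rel_ideal_diff)
  then show "x q - y q - (x' q - y' q) \<in> rel_ideal q" by (simp add: algebra_simps)
qed
lift_definition times_fam :: "fam \<Rightarrow> fam \<Rightarrow> fam" is "\<lambda>x y q. x q * y q"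
  unfolding fam_rel_def by (blast intro: rel_ideal_mult_cong)

instance
  by standard (transfer; simp add: fam_rel_def algebra_simps)+

end

text \<open>The unit is added through \<open>monoid_mult\<close> and not through
  \<open>ring_1\<close>: the latter demands that 0 differs from 1, which would already say that the
  presentation does not collapse for some q.\<close>

instantiation fam :: monoid_mult
begin

lift_definition one_fam :: fam is "\<lambda>_. 1" .

instance
  by standard (transfer; simp add: fam_rel_def)+

end

lift_definition gn :: "gen \<Rightarrow> fam" is "\<lambda>g q. generator g" .
lift_definition sc :: "(complex \<Rightarrow> complex) \<Rightarrow> fam" is "\<lambda>z q. Const (z q)" .

lemma abs_fam_hom:
  "abs_fam (\<lambda>q. x q + y q) = abs_fam x + abs_fam y"
  "abs_fam (\<lambda>q. x q - y q) = abs_fam x - abs_fam y"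
  "abs_fam (\<lambda>q. - x q) = - abs_fam x"
  "abs_fam (\<lambda>q. x q * y q) = abs_fam x * abs_fam y"
  "abs_fam (\<lambda>q. 0) = 0" "abs_fam (\<lambda>q. 1) = 1"
  "abs_fam (\<lambda>q. generator g) = gn g" "abs_fam (\<lambda>q. Const (z q)) = sc z"
  by (simp_all add: plus_fam.abs_eq minus_fam.abs_eq uminus_fam.abs_eq times_fam.abs_eq
      zero_fam.abs_eq one_fam.abs_eq gn.abs_eq sc.abs_eq)

lemma abs_fam_eqI:
  assumes "\<And>q. cube_root q \<Longrightarrow> x q - y q \<in> rel_ideal q"
  shows "abs_fam x = abs_fam y"
  using assms by (simp add: fam.abs_eq_iff fam_rel_def)

text \<open>The way back from families: an equation found by rewriting is specialised to the fixed
  root \<open>q\<close>.\<close>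

lemma (in cube_root) cl_eqI:
  assumes "abs_fam x = abs_fam y"
  shows "cl q (x q) = cl q (y q)"
  using assms cube_root_axioms by (simp add: fam.abs_eq_iff fam_rel_def cl_eq_iff)

lemma sc_eqI: "(\<And>q. cube_root q \<Longrightarrow> y q = z q) \<Longrightarrow> sc y = sc z"
  unfolding abs_fam_hom(8)[symmetric] by (rule abs_fam_eqI) simp

definition Q :: fam where "Q = sc (\<lambda>q. q)"

text \<open>Constants become polynomials in the central element \<open>Q\<close>. Numerals are
  spelled as sums of ones, so that distributivity turns coefficients into repeated summands and
  comparison into cancellation.\<close>

lemma sc_hom:
  "sc (\<lambda>q. y q + z q) = sc y + sc z" "sc (\<lambda>q. y q - z q) = sc y - sc z"
  "sc (\<lambda>q. - z q) = - sc z" "sc (\<lambda>q. y q * z q) = sc y * sc z" "sc (\<lambda>q. 1) = 1" "sc (\<lambda>q. 0) = 0"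
  "sc (\<lambda>q. q) = Q" "sc (\<lambda>q. 2) = 1 + 1" "sc (\<lambda>q. 3) = 1 + 1 + 1"
  "sc (\<lambda>q. inverse q) = - 1 - Q" "sc (\<lambda>q. \<mu> q) = 1 - Q" "sc (\<lambda>q. q\<^sup>2) = - 1 - Q"
  "sc (\<lambda>q. (\<mu> q)\<^sup>2) = - Q - Q - Q"
proof -
  show add: "sc (\<lambda>q. y q + z q) = sc y + sc z" for y z
    by (simp add: Const_simps abs_fam_hom flip: abs_fam_hom(8))
  show diff: "sc (\<lambda>q. y q - z q) = sc y - sc z" for y z
    by (simp add: Const_simps abs_fam_hom flip: abs_fam_hom(8))
  show neg: "sc (\<lambda>q. - z q) = - sc z" for z
    by (simp add: Const_simps abs_fam_hom flip: abs_fam_hom(8))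
  show "sc (\<lambda>q. y q * z q) = sc y * sc z" for y z
    by (simp add: Const_simps abs_fam_hom flip: abs_fam_hom(8))
  show one: "sc (\<lambda>q. 1) = 1" and "sc (\<lambda>q. 0) = 0" and Q: "sc (\<lambda>q. q) = Q"
    by (simp_all add: Const_simps abs_fam_hom Q_def flip: abs_fam_hom(8))
  show "sc (\<lambda>q. 2) = 1 + 1" using add[of "\<lambda>q. 1" "\<lambda>q. 1"] one by simp
  show "sc (\<lambda>q. 3) = 1 + 1 + 1"
    using add[of "\<lambda>q. 2" "\<lambda>q. 1"] add[of "\<lambda>q. 1" "\<lambda>q. 1"] one by simp
  have mQ: "sc (\<lambda>q. - 1 - q) = - 1 - Q" 
    using diff[of "\<lambda>q. - 1" "\<lambda>q. q"] neg[of "\<lambda>q. 1"] one Q by simp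
  show "sc (\<lambda>q. inverse q) = - 1 - Q"
    unfolding mQ[symmetric] by (rule sc_eqI) (rule cube_root.inverse_q)
  show "sc (\<lambda>q. q\<^sup>2) = - 1 - Q"
    unfolding mQ[symmetric] by (rule sc_eqI) (rule cube_root.q_square)
  have "sc (\<lambda>q. \<mu> q) = sc (\<lambda>q. 1 - q)" by (rule sc_eqI) (rule cube_root.\<mu>_q)
  then show "sc (\<lambda>q. \<mu> q) = 1 - Q" using diff[of "\<lambda>q. 1" "\<lambda>q. q"] one Q by simp
  have "sc (\<lambda>q. (\<mu> q)\<^sup>2) = sc (\<lambda>q. - q - q - q)"
    by (rule sc_eqI) (simp add: cube_root.\<mu>_q power2_eq_square algebra_simps cube_root.q_sum)
  then show "sc (\<lambda>q. (\<mu> q)\<^sup>2) = - Q - Q - Q"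
    using diff[of "\<lambda>q. - q - q" "\<lambda>q. q"] diff[of "\<lambda>q. - q" "\<lambda>q. q"] neg[of "\<lambda>q. q"] Q by simp
qed

lemma sc_commute: "x * sc z = sc z * x"
  by (transfer) (simp add: fam_rel_def Const_commute)

text \<open>\<open>Q\<close> is central and is pushed to the front of each product; the guard keeps
  \<open>Q * Q\<close> for \<open>Q_square\<close>.\<close>

lemma Q_commute: "NO_MATCH Q x \<Longrightarrow> x * Q = Q * x" "NO_MATCH Q x \<Longrightarrow> x * (Q * y) = Q * (x * y)"
  by (simp_all only: Q_def sc_commute[of x] flip: mult.assoc)

lemma Q_square: "Q * Q = - 1 - Q"
proof -
  have "Q * Q = sc (\<lambda>q. q * q)" by (simp add: sc_hom)
  also have "\<dots> = sc (\<lambda>q. q\<^sup>2)" by (simp add: power2_eq_square)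
  finally show ?thesis by (simp add: sc_hom)
qed

lemma Q_square_left: "Q * (Q * x) = - x - Q * x"
  by (simp add: Q_square left_diff_distrib flip: mult.assoc)

section \<open>The three groups of relations as rewrite rules\<close>

lemma fam_relI:
  assumes "\<And>q. (l q, r q) \<in> A_rels q \<union> Lambda_rels q \<union> cross_rels q"
  shows "abs_fam l = abs_fam r"
  by (rule abs_fam_eqI) (rule rel_ideal_rel[OF assms])

lemmas fam_distribs = distrib_left distrib_right left_diff_distrib right_diff_distrib mult.assoc

lemmas Q_rules = Q_commute Q_square Q_square_left

text \<open>Oriented towards the monomials a^m b^n c^k; the last rule eliminates d.\<close>

lemma fam_A_rels:
  "gn Fun_b * gn Fun_a = Q * (gn Fun_a * gn Fun_b)"
  "gn Fun_c * gn Fun_a = Q * (gn Fun_a * gn Fun_c)"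
  "gn Fun_c * gn Fun_b = gn Fun_b * gn Fun_c"
  "gn Fun_a * (gn Fun_a * gn Fun_a) = 1"
  "gn Fun_b * (gn Fun_b * gn Fun_b) = 0"
  "gn Fun_c * (gn Fun_c * gn Fun_c) = 0"
  "gn Fun_d = gn Fun_a * gn Fun_a - gn Fun_a * (gn Fun_a * (gn Fun_b * gn Fun_c))
     - Q * (gn Fun_a * (gn Fun_a * (gn Fun_b * gn Fun_c)))"
proof -
  have rel: "abs_fam l = abs_fam r" if "\<And>q. (l q, r q) \<in> A_rels q" for l r
    using that by (intro fam_relI) blast
  note simps = abs_fam_hom scale_def sc_hom mult.assoc power3_eq_cube
  show "gn Fun_b * gn Fun_a = Q * (gn Fun_a * gn Fun_b)"
    using rel[of "\<lambda>q. \<^bold>b * \<^bold>a" "\<lambda>q. q \<cdot> \<^bold>a * \<^bold>b"] by (simp add: A_rels_def simps)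
  show "gn Fun_c * gn Fun_a = Q * (gn Fun_a * gn Fun_c)"
    using rel[of "\<lambda>q. \<^bold>c * \<^bold>a" "\<lambda>q. q \<cdot> \<^bold>a * \<^bold>c"] by (simp add: A_rels_def simps)
  show "gn Fun_c * gn Fun_b = gn Fun_b * gn Fun_c"
    using rel[of "\<lambda>q. \<^bold>c * \<^bold>b" "\<lambda>q. \<^bold>b * \<^bold>c"] by (simp add: A_rels_def simps)
  show a3: "gn Fun_a * (gn Fun_a * gn Fun_a) = 1"
    using rel[of "\<lambda>q. \<^bold>a ^ 3" "\<lambda>q. 1"] by (simp add: A_rels_def simps)
  show "gn Fun_b * (gn Fun_b * gn Fun_b) = 0"
    using rel[of "\<lambda>q. \<^bold>b ^ 3" "\<lambda>q. 0"] by (simp add: A_rels_def simps)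
  show "gn Fun_c * (gn Fun_c * gn Fun_c) = 0"
    using rel[of "\<lambda>q. \<^bold>c ^ 3" "\<lambda>q. 0"] by (simp add: A_rels_def simps)
  have "gn Fun_a * gn Fun_d - (- 1 - Q) * (gn Fun_b * gn Fun_c) = 1"
    using rel[of "\<lambda>q. \<^bold>a * \<^bold>d - inverse q \<cdot> \<^bold>b * \<^bold>c" "\<lambda>q. 1"] by (simp add: A_rels_def simps)
  then have ad: "gn Fun_a * gn Fun_d = 1 + (- 1 - Q) * (gn Fun_b * gn Fun_c)"
    by (simp add: algebra_simps)
  \<comment> \<open>Because a^3 = 1, the inverse of a is a^2, which isolates d in a d = 1 + q^-1
    bc.\<close>
  have "gn Fun_d = gn Fun_a * (gn Fun_a * gn Fun_a) * gn Fun_d" by (simp add: a3)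
  also have "\<dots> = gn Fun_a * (gn Fun_a * (1 + (- 1 - Q) * (gn Fun_b * gn Fun_c)))"
    by (simp add: ad mult.assoc)
  finally show "gn Fun_d = gn Fun_a * gn Fun_a - gn Fun_a * (gn Fun_a * (gn Fun_b * gn Fun_c))
     - Q * (gn Fun_a * (gn Fun_a * (gn Fun_b * gn Fun_c)))"
    by (simp add: fam_distribs Q_rules)
qed

text \<open>Oriented so that one-forms are sorted in the order a, b, c, d, which leaves the 16
  monomials \<open>lam_mon\<close>.\<close>

lemma fam_Lambda_rels:
  "gn Form_c * gn Form_b = - (gn Form_b * gn Form_c)"
  "gn Form_d * gn Form_b = - (gn Form_b * gn Form_d)"
  "gn Form_d * gn Form_c = - (gn Form_c * gn Form_d)"
  "gn Form_b * gn Form_b = 0" "gn Form_c * gn Form_c = 0" "gn Form_d * gn Form_d = 0"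
  "gn Form_a * gn Form_a = gn Form_b * gn Form_c - Q * (gn Form_b * gn Form_c)"
  "gn Form_d * gn Form_a = - (gn Form_a * gn Form_d) - gn Form_b * gn Form_c
     + Q * (gn Form_b * gn Form_c)"
  "gn Form_b * gn Form_a = - (Q * (gn Form_a * gn Form_b)) + gn Form_b * gn Form_d
     + (Q * (gn Form_b * gn Form_d) + Q * (gn Form_b * gn Form_d))"
  "gn Form_c * gn Form_a = gn Form_a * gn Form_c + Q * (gn Form_a * gn Form_c)
     - gn Form_c * gn Form_d + Q * (gn Form_c * gn Form_d)"
proof -
  have rel: "abs_fam l = abs_fam r" if "\<And>q. (l q, r q) \<in> Lambda_rels q" for l r
    using that by (intro fam_relI) blast
  note simps = abs_fam_hom scale_def sc_hom mult.assoc fam_distribs Q_rules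
  show "gn Form_c * gn Form_b = - (gn Form_b * gn Form_c)"
    using rel[of "\<lambda>q. e\<^sub>b * e\<^sub>c + e\<^sub>c * e\<^sub>b" "\<lambda>q. 0"]
    by (simp add: Lambda_rels_def simps eq_neg_iff_add_eq_0 add.commute)
  show "gn Form_d * gn Form_b = - (gn Form_b * gn Form_d)"
    using rel[of "\<lambda>q. e\<^sub>b * e\<^sub>d + e\<^sub>d * e\<^sub>b" "\<lambda>q. 0"]
    by (simp add: Lambda_rels_def simps eq_neg_iff_add_eq_0 add.commute)
  show "gn Form_d * gn Form_c = - (gn Form_c * gn Form_d)"
    using rel[of "\<lambda>q. e\<^sub>c * e\<^sub>d + e\<^sub>d * e\<^sub>c" "\<lambda>q. 0"]
    by (simp add: Lambda_rels_def simps eq_neg_iff_add_eq_0 add.commute)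
  show "gn Form_b * gn Form_b = 0"
    using rel[of "\<lambda>q. e\<^sub>b * e\<^sub>b" "\<lambda>q. 0"] by (simp add: Lambda_rels_def simps)
  show "gn Form_c * gn Form_c = 0"
    using rel[of "\<lambda>q. e\<^sub>c * e\<^sub>c" "\<lambda>q. 0"] by (simp add: Lambda_rels_def simps)
  show "gn Form_d * gn Form_d = 0"
    using rel[of "\<lambda>q. e\<^sub>d * e\<^sub>d" "\<lambda>q. 0"] by (simp add: Lambda_rels_def simps)
  show "gn Form_a * gn Form_a = gn Form_b * gn Form_c - Q * (gn Form_b * gn Form_c)"
    using rel[of "\<lambda>q. e\<^sub>a * e\<^sub>a" "\<lambda>q. \<mu> q \<cdot> e\<^sub>b * e\<^sub>c"] by (simp add: Lambda_rels_def simps)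
  have "gn Form_a * gn Form_d + gn Form_d * gn Form_a
      + (gn Form_b * gn Form_c - Q * (gn Form_b * gn Form_c)) = 0"
    using rel[of "\<lambda>q. e\<^sub>a * e\<^sub>d + e\<^sub>d * e\<^sub>a + \<mu> q \<cdot> e\<^sub>b * e\<^sub>c" "\<lambda>q. 0"]
    by (simp add: Lambda_rels_def simps)
  then show "gn Form_d * gn Form_a = - (gn Form_a * gn Form_d) - gn Form_b * gn Form_c
     + Q * (gn Form_b * gn Form_c)"
    by (simp add: eq_neg_iff_add_eq_0 algebra_simps)
  have "gn Form_a * gn Form_b + (- 1 - Q) * (gn Form_b * gn Form_a)
      - (1 - Q) * (gn Form_b * gn Form_d) = 0"
    using rel[of "\<lambda>q. e\<^sub>a * e\<^sub>b + q\<^sup>2 \<cdot> e\<^sub>b * e\<^sub>a - \<mu> q \<cdot> e\<^sub>b * e\<^sub>d" "\<lambda>q. 0"]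
    by (simp add: Lambda_rels_def simps)
  \<comment> \<open>The coefficient of e_b e_a is q^2, so multiplication by q makes it 1.\<close>
  then have "Q * (gn Form_a * gn Form_b + (- 1 - Q) * (gn Form_b * gn Form_a)
      - (1 - Q) * (gn Form_b * gn Form_d)) = Q * 0"
    by (rule arg_cong)
  then show "gn Form_b * gn Form_a = - (Q * (gn Form_a * gn Form_b)) + gn Form_b * gn Form_d
     + (Q * (gn Form_b * gn Form_d) + Q * (gn Form_b * gn Form_d))"
    by (simp add: simps algebra_simps eq_neg_iff_add_eq_0)
  have "gn Form_c * gn Form_a + (- 1 - Q) * (gn Form_a * gn Form_c)
      + (1 - Q) * (gn Form_c * gn Form_d) = 0"
    using rel[of "\<lambda>q. e\<^sub>c * e\<^sub>a + q\<^sup>2 \<cdot> e\<^sub>a * e\<^sub>c + \<mu> q \<cdot> e\<^sub>c * e\<^sub>d" "\<lambda>q. 0"]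
    by (simp add: Lambda_rels_def simps)
  then show "gn Form_c * gn Form_a = gn Form_a * gn Form_c + Q * (gn Form_a * gn Form_c)
     - gn Form_c * gn Form_d + Q * (gn Form_c * gn Form_d)"
    by (simp add: fam_distribs algebra_simps eq_neg_iff_add_eq_0)
qed

lemma fam_cross_rels:
  assumes "(u, v) \<in> {(Fun_a, Fun_c), (Fun_b, Fun_d)}"
  shows "gn v * gn Form_b = gn Form_b * gn v"
    "gn u * gn Form_c = gn Form_c * gn u"
    "gn u * gn Form_d = - (gn Form_d * gn u) - Q * (gn Form_d * gn u)"
    "gn v * gn Form_d = Q * (gn Form_d * gn v)"
    "gn u * gn Form_b = gn Form_b * gn u + (1 + Q + Q) * (gn Form_d * gn v)"
    "gn v * gn Form_c = gn Form_c * gn v + (1 + Q + Q) * (gn Form_d * gn u)"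
    "gn v * gn Form_a = - (gn Form_a * gn v) - Q * (gn Form_a * gn v)
       + (1 - Q) * (gn Form_b * gn u)"
    "gn u * gn Form_a = Q * (gn Form_a * gn u) + (1 - Q) * (gn Form_c * gn v)
       + (1 + 1 + 1 + Q + Q + Q) * (gn Form_d * gn u)"
proof -
  have rel: "abs_fam l = abs_fam r" if "\<And>q. (l q, r q) \<in> cross_rels q" for l r
    using that by (intro fam_relI) blast
  let ?u = "generator u" and ?v = "generator v"
  note simps = abs_fam_hom scale_def sc_hom mult.assoc fam_distribs Q_rules
  show "gn v * gn Form_b = gn Form_b * gn v"
    using rel[of "\<lambda>q. ?v * e\<^sub>b" "\<lambda>q. e\<^sub>b * ?v"] assms by (auto simp: cross_rels_def simps)
  show "gn u * gn Form_c = gn Form_c * gn u"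
    using rel[of "\<lambda>q. ?u * e\<^sub>c" "\<lambda>q. e\<^sub>c * ?u"] assms by (auto simp: cross_rels_def simps)
  show "gn u * gn Form_d = - (gn Form_d * gn u) - Q * (gn Form_d * gn u)"
    using rel[of "\<lambda>q. ?u * e\<^sub>d" "\<lambda>q. inverse q \<cdot> e\<^sub>d * ?u"] assms by (auto simp: cross_rels_def simps)
  show "gn v * gn Form_d = Q * (gn Form_d * gn v)"
    using rel[of "\<lambda>q. ?v * e\<^sub>d" "\<lambda>q. q \<cdot> e\<^sub>d * ?v"] assms by (auto simp: cross_rels_def simps)
  show "gn u * gn Form_b = gn Form_b * gn u + (1 + Q + Q) * (gn Form_d * gn v)"
    using rel[of "\<lambda>q. ?u * e\<^sub>b" "\<lambda>q. e\<^sub>b * ?u + (q * \<mu> q) \<cdot> e\<^sub>d * ?v"] assms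
    by (auto simp: cross_rels_def simps)
  show "gn v * gn Form_c = gn Form_c * gn v + (1 + Q + Q) * (gn Form_d * gn u)"
    using rel[of "\<lambda>q. ?v * e\<^sub>c" "\<lambda>q. e\<^sub>c * ?v + (q * \<mu> q) \<cdot> e\<^sub>d * ?u"] assms
    by (auto simp: cross_rels_def simps)
  show "gn v * gn Form_a = - (gn Form_a * gn v) - Q * (gn Form_a * gn v)
       + (1 - Q) * (gn Form_b * gn u)"
    using rel[of "\<lambda>q. ?v * e\<^sub>a" "\<lambda>q. inverse q \<cdot> e\<^sub>a * ?v + \<mu> q \<cdot> e\<^sub>b * ?u"] assms
    by (auto simp: cross_rels_def simps)
  show "gn u * gn Form_a = Q * (gn Form_a * gn u) + (1 - Q) * (gn Form_c * gn v)
       + (1 + 1 + 1 + Q + Q + Q) * (gn Form_d * gn u)"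
    using rel[of "\<lambda>q. ?u * e\<^sub>a" "\<lambda>q. q \<cdot> e\<^sub>a * ?u + \<mu> q \<cdot> e\<^sub>c * ?v + (q * (\<mu> q)\<^sup>2) \<cdot> e\<^sub>d * ?u"] assms
    by (auto simp: cross_rels_def simps)
qed

text \<open>Products are kept nested to the right, so a rule for a pair must also apply when the
  pair is followed by further factors.\<close>

lemma fam_rule_left: "x * y = r \<Longrightarrow> x * (y * z) = r * z" for x :: fam
  by (simp flip: mult.assoc)

lemmas A_rules = fam_A_rels fam_A_rels(1-3)[THEN fam_rule_left]
lemmas Lambda_rules = fam_Lambda_rels fam_Lambda_rels[THEN fam_rule_left]
lemmas ac_rules = fam_cross_rels[of Fun_a Fun_c, simplified]
lemmas bd_rules = fam_cross_rels[of Fun_b Fun_d, simplified]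
lemmas cross_rules = ac_rules bd_rules ac_rules[THEN fam_rule_left] bd_rules[THEN fam_rule_left]

section \<open>Left multiplication on normal forms\<close>

context cube_root
begin

text \<open>The coefficients \<open>x S\<close> are arbitrary and stay opaque: only the factors to
  their left are sorted, and this determines every entry of the tables.\<close>

lemma mult_lam_sum_form:
  "cl q (e\<^sub>a * lam_sum x) = cl q (lam_sum (form_a q scale x))"
  "cl q (e\<^sub>b * lam_sum x) = cl q (lam_sum (form_b q scale x))"
  "cl q (e\<^sub>c * lam_sum x) = cl q (lam_sum (form_c q scale x))"
  "cl q (e\<^sub>d * lam_sum x) = cl q (lam_sum (form_d q scale x))"
  by (rule cl_eqI; simp add: lam_sum_def lams_def scale_def abs_fam_hom sc_hom fam_distribs
      Lambda_rules Q_rules)+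

lemma mult_lam_sum_fun:
  "cl q (\<^bold>a * lam_sum x) = cl q (lam_sum (row_u q scale ((*) \<^bold>a) ((*) \<^bold>c) x))"
  "cl q (\<^bold>b * lam_sum x) = cl q (lam_sum (row_u q scale ((*) \<^bold>b) ((*) \<^bold>d) x))"
  "cl q (\<^bold>c * lam_sum x) = cl q (lam_sum (row_v q scale ((*) \<^bold>a) ((*) \<^bold>c) x))"
  "cl q (\<^bold>d * lam_sum x) = cl q (lam_sum (row_v q scale ((*) \<^bold>b) ((*) \<^bold>d) x))"
  by (rule cl_eqI; simp add: lam_sum_def lams_def scale_def abs_fam_hom sc_hom fam_distribs
      Lambda_rules cross_rules Q_rules)+

end

section \<open>A model of the algebra\<close>

text \<open>Exponents modulo 3 as a three-element type: cyclic shifts need no arithmetic, and an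
  identity between coefficient functions splits into 27 closed cases.\<close>

datatype tri = T0 | T1 | T2

type_synonym idx = "tri \<times> tri \<times> tri"
type_synonym alg = "idx \<Rightarrow> complex"
type_synonym vec = "lam \<Rightarrow> alg"

primrec tri_nat :: "tri \<Rightarrow> nat" where
  "tri_nat T0 = 0" | "tri_nat T1 = 1" | "tri_nat T2 = 2"

definition tris :: "tri list" where "tris = [T0, T1, T2]"

definition idxs :: "idx list" where "idxs = List.product tris (List.product tris tris)"

definition alg_mon :: "idx \<Rightarrow> falg" where
  "alg_mon = (\<lambda>(m, n, k). \<^bold>a ^ tri_nat m * (\<^bold>b ^ tri_nat n * \<^bold>c ^ tri_nat k))"

definition alg_sum :: "alg \<Rightarrow> falg" where
  "alg_sum f = (\<Sum>i\<leftarrow>idxs. f i \<cdot> alg_mon i)"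

definition smul :: "complex \<Rightarrow> ('i \<Rightarrow> complex) \<Rightarrow> 'i \<Rightarrow> complex" where
  "smul z f = (\<lambda>i. z * f i)"

primrec pred3 :: "tri \<Rightarrow> tri" where
  "pred3 T0 = T2" | "pred3 T1 = T0" | "pred3 T2 = T1"

definition left_a :: "alg \<Rightarrow> alg" where
  "left_a f = (\<lambda>(m, n, k). f (pred3 m, n, k))"

primrec qpow :: "complex \<Rightarrow> tri \<Rightarrow> complex" where
  "qpow q T0 = 1" | "qpow q T1 = q" | "qpow q T2 = - 1 - q"

text \<open>Moving b past a^m costs q^m. The shift \<open>pred3\<close> is cyclic, which is right
  for a because a^3 = 1; for b the case \<open>T0\<close> cuts it off because b^3 = 0.\<close>

definition left_b :: "complex \<Rightarrow> alg \<Rightarrow> alg" where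
  "left_b q f = (\<lambda>(m, n, k). if n = T0 then 0 else qpow q m * f (m, pred3 n, k))"

definition left_c :: "complex \<Rightarrow> alg \<Rightarrow> alg" where
  "left_c q f = (\<lambda>(m, n, k). if k = T0 then 0 else qpow q m * f (m, n, pred3 k))"

text \<open>From \<open>a\<^sup>3 = 1\<close> and \<open>a d = 1 + q\<^sup>-\<^sup>1 b c\<close> one gets \<open>d = a\<^sup>2 (1 + q\<^sup>-\<^sup>1 b c)\<close>.\<close>

definition left_d :: "complex \<Rightarrow> alg \<Rightarrow> alg" where
  "left_d q f = left_a (left_a (f + smul (- 1 - q) (left_b q (left_c q f))))"

context cube_root
begin

lemma cl_cong:
  "cl q x = cl q x' \<Longrightarrow> cl q y = cl q y' \<Longrightarrow> cl q (x + y) = cl q (x' + y')"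
  "cl q x = cl q x' \<Longrightarrow> cl q y = cl q y' \<Longrightarrow> cl q (x - y) = cl q (x' - y')"
  "cl q x = cl q x' \<Longrightarrow> cl q y = cl q y' \<Longrightarrow> cl q (x * y) = cl q (x' * y')"
  "cl q x = cl q x' \<Longrightarrow> cl q (- x) = cl q (- x')"
  "cl q x = cl q x' \<Longrightarrow> cl q (z \<cdot> x) = cl q (z \<cdot> x')"
  by (simp_all flip: cl_add cl_diff cl_mult cl_uminus add: scale_def)

lemma sc_commute_gn: "gn g * sc z = sc z * gn g" "gn g * (sc z * x) = sc z * (gn g * x)"
  by (simp_all only: sc_commute[of "gn g"] flip: mult.assoc)

lemma fam_cube_left: "x * (x * x) = r \<Longrightarrow> x * (x * (x * z)) = r * z" for x :: fam
  by (simp flip: mult.assoc)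

lemma mult_alg_sum_abc:
  "cl q (\<^bold>a * alg_sum f) = cl q (alg_sum (left_a f))"
  "cl q (\<^bold>b * alg_sum f) = cl q (alg_sum (left_b q f))"
  "cl q (\<^bold>c * alg_sum f) = cl q (alg_sum (left_c q f))"
  by (rule cl_eqI; simp add: alg_sum_def idxs_def tris_def alg_mon_def scale_def numeral_2_eq_2
      left_a_def left_b_def left_c_def
      abs_fam_hom sc_hom fam_distribs A_rules
      fam_A_rels(4-6)[THEN fam_cube_left] Q_rules sc_commute_gn add_ac)+

lemma mult_d: "cl q (\<^bold>d * x) = cl q (\<^bold>a * (\<^bold>a * (x + (- 1 - q) \<cdot> (\<^bold>b * (\<^bold>c * x)))))"
  by (rule cl_eqI) (simp add: scale_def abs_fam_hom sc_hom fam_distribs fam_A_rels(7) Q_rules)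

lemma alg_sum_linear:
  "alg_sum (f + g) = alg_sum f + alg_sum g" "alg_sum (f - g) = alg_sum f - alg_sum g"
  "alg_sum (- f) = - alg_sum f" "alg_sum (smul z f) = z \<cdot> alg_sum f" "alg_sum 0 = 0"
  by (simp_all add: alg_sum_def idxs_def tris_def smul_def scale_def Const_simps algebra_simps)

lemma mult_alg_sum_d: "cl q (\<^bold>d * alg_sum f) = cl q (alg_sum (left_d q f))"
proof -
  note mult = mult_alg_sum_abc
  have "cl q (\<^bold>b * (\<^bold>c * alg_sum f)) = cl q (alg_sum (left_b q (left_c q f)))"
    using cl_cong(3)[OF refl mult(3)] mult(2) by (rule trans)
  then have "cl q (alg_sum f + (- 1 - q) \<cdot> (\<^bold>b * (\<^bold>c * alg_sum f)))
      = cl q (alg_sum (f + smul (- 1 - q) (left_b q (left_c q f))))" (is "cl q ?x = cl q (alg_sum ?g)")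
    unfolding alg_sum_linear by (intro cl_cong refl)
  then have "cl q (\<^bold>a * ?x) = cl q (alg_sum (left_a ?g))"
    using mult(1) by (metis cl_mult)
  then have "cl q (\<^bold>a * (\<^bold>a * ?x)) = cl q (alg_sum (left_d q f))"
    unfolding left_d_def using mult(1) by (metis cl_mult)
  then show ?thesis unfolding mult_d .
qed

end

section \<open>The representation of the free algebra on coefficient vectors\<close>

definition vsmul :: "complex \<Rightarrow> vec \<Rightarrow> vec" where
  "vsmul z v = (\<lambda>S. smul z (v S))"

primrec gen_op :: "complex \<Rightarrow> gen \<Rightarrow> vec \<Rightarrow> vec" where
  "gen_op q Fun_a = row_u q smul left_a (left_c q)" |
  "gen_op q Fun_b = row_u q smul (left_b q) (left_d q)" |
  "gen_op q Fun_c = row_v q smul left_a (left_c q)" |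
  "gen_op q Fun_d = row_v q smul (left_b q) (left_d q)" |
  "gen_op q Form_a = form_a q smul" |
  "gen_op q Form_b = form_b q smul" |
  "gen_op q Form_c = form_c q smul" |
  "gen_op q Form_d = form_d q smul"

definition act :: "complex \<Rightarrow> falg \<Rightarrow> vec \<Rightarrow> vec" where
  "act q x v = (\<Sum>w \<in> Poly_Mapping.keys x. vsmul (Poly_Mapping.lookup x w) (foldr (gen_op q) (letters w) v))"

lemma smul_linear:
  "smul z (f + g) = smul z f + smul z g" "smul z (f - g) = smul z f - smul z g"
  "smul z (- f) = - smul z f" "smul z 0 = 0" "smul 1 f = f" "smul 0 f = 0"
  "smul y (smul z f) = smul (y * z) f"
  by (simp_all add: smul_def fun_eq_iff algebra_simps)

lemma left_linear:
  "left_a (f + g) = left_a f + left_a g" "left_a (f - g) = left_a f - left_a g"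
  "left_a (- f) = - left_a f" "left_a (smul z f) = smul z (left_a f)" "left_a 0 = 0"
  "left_b q (f + g) = left_b q f + left_b q g" "left_b q (f - g) = left_b q f - left_b q g"
  "left_b q (- f) = - left_b q f" "left_b q (smul z f) = smul z (left_b q f)" "left_b q 0 = 0"
  "left_c q (f + g) = left_c q f + left_c q g" "left_c q (f - g) = left_c q f - left_c q g"
  "left_c q (- f) = - left_c q f" "left_c q (smul z f) = smul z (left_c q f)" "left_c q 0 = 0"
  by (simp_all add: left_a_def left_b_def left_c_def smul_def fun_eq_iff algebra_simps)

lemma left_d_linear:
  "left_d q (f + g) = left_d q f + left_d q g" "left_d q (f - g) = left_d q f - left_d q g"
  "left_d q (- f) = - left_d q f" "left_d q (smul z f) = smul z (left_d q f)" "left_d q 0 = 0"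
  by (simp_all add: left_d_def left_linear smul_linear mult.commute)

lemmas op_linear = smul_linear left_linear left_d_linear

definition linear_op :: "(vec \<Rightarrow> vec) \<Rightarrow> bool" where
  "linear_op F \<longleftrightarrow> (\<forall>u v. F (u + v) = F u + F v) \<and> (\<forall>z v. F (vsmul z v) = vsmul z (F v))"

lemma linear_opD:
  assumes "linear_op F"
  shows "F (u + v) = F u + F v" "F (vsmul z v) = vsmul z (F v)" "F 0 = 0" "F (- v) = - F v"
    "F (u - v) = F u - F v"
proof -
  show add: "F (u + v) = F u + F v" and "F (vsmul z v) = vsmul z (F v)" for u v z
    using assms by (auto simp: linear_op_def)
  show zero: "F 0 = 0" using add[of 0 0] by simp
  show neg: "F (- v) = - F v" for v
    using add[of "- v" v] zero by (simp add: eq_neg_iff_add_eq_0)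
  show "F (u - v) = F u - F v" using add[of u "- v"] neg by simp
qed

lemma vsmul_simps:
  "vsmul z (u + v) = vsmul z u + vsmul z v" "vsmul (y + z) v = vsmul y v + vsmul z v"
  "vsmul y (vsmul z v) = vsmul (y * z) v" "vsmul 1 v = v" "vsmul 0 v = 0" "vsmul z 0 = 0"
  "vsmul z (- v) = - vsmul z v"
  by (auto simp: vsmul_def smul_def fun_eq_iff algebra_simps)

lemma linear_op_gen_op: "linear_op (gen_op q g)"
proof -
  have "gen_op q g (u + v) S = (gen_op q g u + gen_op q g v) S
      \<and> gen_op q g (vsmul z v) S = vsmul z (gen_op q g v) S" for u v z S
    by (cases g; cases S) (simp_all add: op_linear vsmul_def mult.commute)
  then show ?thesis by (auto simp: linear_op_def fun_eq_iff)
qed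

lemma linear_op_foldr: "linear_op (foldr (gen_op q) gs)"
  by (induction gs) (simp_all add: linear_op_def linear_opD[OF linear_op_gen_op])

lemma act_single: "act q (Poly_Mapping.single w z) v = vsmul z (foldr (gen_op q) (letters w) v)"
  by (simp add: act_def vsmul_simps)

lemma act_add: "act q (x + y) v = act q x v + act q y v"
proof -
  let ?K = "Poly_Mapping.keys x \<union> Poly_Mapping.keys y"
  let ?F = "\<lambda>x. (\<Sum>w \<in> ?K. vsmul (Poly_Mapping.lookup x w) (foldr (gen_op q) (letters w) v))"
  have *: "act q z v = ?F z" if "Poly_Mapping.keys z \<subseteq> ?K" for z
    unfolding act_def using that
    by (intro sum.mono_neutral_left) (auto simp: in_keys_iff vsmul_simps)
  have "Poly_Mapping.keys (x + y) \<subseteq> ?K" by (rule Poly_Mapping.keys_add)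
  then show ?thesis by (simp add: * lookup_add vsmul_simps sum.distrib)
qed

lemma linear_op_act: "linear_op (act q x)"
proof (induction x rule: falg_induct)
  case (single w z)
  show ?case
    by (simp add: linear_op_def act_single linear_opD[OF linear_op_foldr] vsmul_simps mult.commute)
next
  case (add x y)
  then show ?case
    unfolding linear_op_def act_add by (metis (no_types) add.assoc add.commute vsmul_simps(1))
qed

lemmas act_linear = linear_opD[OF linear_op_act]

lemma act_mult: "act q (x * y) v = act q x (act q y v)"
proof (induction x rule: falg_induct)
  case (single w z)
  show ?case
  proof (induction y rule: falg_induct)
    case (single w' z')
    show ?case
      by (simp add: mult_single act_single plus_word_def vsmul_simps linear_opD[OF linear_op_foldr])
  qed (simp only: distrib_left act_add act_linear)
qed (simp only: distrib_right act_add)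

lemma act_simps:
  "act q 0 v = 0" "act q 1 v = v" "act q (generator g) v = gen_op q g v"
  "act q (z \<cdot> x) v = vsmul z (act q x v)" "act q (- x) v = - act q x v"
  "act q (x - y) v = act q x v - act q y v"
proof -
  show zero: "act q 0 v = 0" by (simp add: act_def)
  have letters_0: "letters 0 = []" by (simp add: zero_word_def)
  show "act q 1 v = v" using act_single[of q 0 1 v]
    by (simp add: vsmul_simps letters_0)
  show "act q (generator g) v = gen_op q g v" by (simp add: act_single vsmul_simps)
  show "act q (z \<cdot> x) v = vsmul z (act q x v)"
    by (simp add: scale_def act_mult act_single letters_0)
  show neg: "act q (- x) v = - act q x v" for x
    using act_add[of q "- x" x v] zero by (simp add: eq_neg_iff_add_eq_0)
  show "act q (x - y) v = act q x v - act q y v" using act_add[of q x "- y" v] neg by simp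
qed

lemma tri_all: "(\<forall>t. P t) \<longleftrightarrow> P T0 \<and> P T1 \<and> P T2"
  by (metis tri.exhaust)

context cube_root
begin

lemmas q_reduce = algebra_simps q_sum q_sum_left

text \<open>The relations of A for the operators of the model. Under these rules both sides of each
  relation in \<open>act_A_rels\<close> reach a common form, and only scalars remain to be
  compared.\<close>

lemma left_rules:
  "left_b q (left_a f) = smul q (left_a (left_b q f))"
  "left_c q (left_a f) = smul q (left_a (left_c q f))"
  "left_c q (left_b q f) = left_b q (left_c q f)"
  "left_b q (left_d q f) = smul (- 1 - q) (left_d q (left_b q f))"
  "left_c q (left_d q f) = smul (- 1 - q) (left_d q (left_c q f))"
  "left_a (left_d q f) = f + smul (- 1 - q) (left_b q (left_c q f))"
  "left_d q (left_a f) = f + smul q (left_b q (left_c q f))"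
  "left_a (left_a (left_a f)) = f"
  "left_b q (left_b q (left_b q f)) = 0"
  "left_c q (left_c q (left_c q f)) = 0"
  "left_d q (left_d q (left_d q f)) = f"
  by (simp_all add: fun_eq_iff tri_all left_a_def left_b_def left_c_def left_d_def smul_def q_reduce)

lemma act_Lambda_rels: "\<forall>p\<in>Lambda_rels q. act q (fst p) v S i = act q (snd p) v S i"
  unfolding Lambda_rels_def
  by (cases S; simp add: act_mult act_add act_simps \<mu>_q q_square vsmul_def smul_def q_reduce)

lemma act_cross_rels: "\<forall>p\<in>cross_rels q. act q (fst p) v S i = act q (snd p) v S i"
  unfolding cross_rels_def
  by (cases S; simp add: act_mult act_add act_simps \<mu>_q inverse_q power2_eq_square op_linear vsmul_def;
     simp add: smul_def q_reduce)

lemma act_A_rels: "\<forall>p\<in>A_rels q. act q (fst p) v S i = act q (snd p) v S i"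
  unfolding A_rels_def
  by (cases S; simp add: act_mult act_add act_simps \<mu>_q inverse_q power3_eq_cube op_linear left_rules vsmul_def;
     simp add: smul_def q_reduce)

end

text \<open>The annihilator of the representation is a two-sided ideal that contains all relations,
  hence also the ideal generated by them.\<close>

lemma (in cube_root) act_ideal:
  assumes "x \<in> rel_ideal q"
  shows "act q x v = 0"
proof -
  let ?I = "{x. \<forall>v. act q x v = 0}"
  have "ideal ?I FA"
  proof (rule idealI[OF ring_FA])
    interpret ring FA by (rule ring_FA)
    show "subgroup ?I (add_monoid FA)"
    proof (rule add.subgroupI)
      show "?I \<noteq> {}" using act_simps(1) by blast
    qed (auto simp: act_add act_simps simp flip: a_inv_def)
  qed (auto simp: act_mult act_linear)
  moreover have "l - r \<in> ?I" if "(l, r) \<in> A_rels q \<union> Lambda_rels q \<union> cross_rels q" for l r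
  proof -
    have "act q l v S i = act q r v S i" for v S i
    proof -
      have "\<forall>p \<in> A_rels q \<union> Lambda_rels q \<union> cross_rels q. act q (fst p) v S i = act q (snd p) v S i"
        unfolding ball_Un by (intro conjI act_A_rels act_Lambda_rels act_cross_rels)
      from bspec[OF this that] show ?thesis by (simp only: fst_conv snd_conv)
    qed
    then have "act q l v = act q r v" for v by (simp add: fun_eq_iff)
    then show ?thesis by (simp add: act_simps)
  qed
  ultimately have "rel_ideal q \<subseteq> ?I" by (rule rel_ideal_least)
  then show ?thesis using assms by auto
qed

section \<open>Coordinates on the quotient and freeness\<close>

definition unit0 :: alg where
  "unit0 = (\<lambda>i. if i = (T0, T0, T0) then 1 else 0)"

definition emb :: "lam \<Rightarrow> alg \<Rightarrow> vec" where
  "emb S f = (\<lambda>T. if T = S then f else 0)"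

definition coord :: "complex \<Rightarrow> falg \<Rightarrow> vec" where
  "coord q x = act q x (emb L0 unit0)"

definition syn :: "vec \<Rightarrow> falg" where
  "syn v = lam_sum (\<lambda>S. alg_sum (v S))"

definition el :: "complex \<Rightarrow> vec \<Rightarrow> falg set" where
  "el q v = cl q (syn v)"

lemma lam_sum_linear:
  "lam_sum (\<lambda>S. x S + y S) = lam_sum x + lam_sum y" "lam_sum (\<lambda>S. z \<cdot> x S) = z \<cdot> lam_sum x"
  by (simp_all add: lam_sum_def lams_def scale_simps mult_scale algebra_simps)

context cube_root
begin

lemma syn_linear: "syn (u + v) = syn u + syn v" "syn (vsmul z v) = z \<cdot> syn v"
  by (simp_all add: syn_def alg_sum_linear vsmul_def lam_sum_linear)

lemma cl_lam_sum_cong: "(\<And>S. cl q (x S) = cl q (y S)) \<Longrightarrow> cl q (lam_sum x) = cl q (lam_sum y)"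
  unfolding lam_sum_def lams_def list.map sum_list.Cons sum_list.Nil by (intro cl_cong refl) auto

lemma mult_syn_form:
  "cl q (e\<^sub>a * syn v) = el q (form_a q smul v)"
  "cl q (e\<^sub>b * syn v) = el q (form_b q smul v)"
  "cl q (e\<^sub>c * syn v) = el q (form_c q smul v)"
  "cl q (e\<^sub>d * syn v) = el q (form_d q smul v)"
proof -
  let ?x = "\<lambda>S. alg_sum (v S)"
  have "form_a q scale ?x S = alg_sum (form_a q smul v S)"
    and "form_b q scale ?x S = alg_sum (form_b q smul v S)"
    and "form_c q scale ?x S = alg_sum (form_c q smul v S)"
    and "form_d q scale ?x S = alg_sum (form_d q smul v S)" for S
    by (cases S; simp add: alg_sum_linear)+
  then show "cl q (e\<^sub>a * syn v) = el q (form_a q smul v)"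
    and "cl q (e\<^sub>b * syn v) = el q (form_b q smul v)"
    and "cl q (e\<^sub>c * syn v) = el q (form_c q smul v)"
    and "cl q (e\<^sub>d * syn v) = el q (form_d q smul v)"
    unfolding syn_def el_def mult_lam_sum_form by (auto intro!: cl_lam_sum_cong)
qed

lemma cl_row:
  assumes "\<And>f. cl q (F (alg_sum f)) = cl q (alg_sum (F' f))"
    and "\<And>f. cl q (G (alg_sum f)) = cl q (alg_sum (G' f))"
  shows "cl q (row_u q scale F G (\<lambda>S. alg_sum (v S)) S) = cl q (alg_sum (row_u q smul F' G' v S))"
    and "cl q (row_v q scale F G (\<lambda>S. alg_sum (v S)) S) = cl q (alg_sum (row_v q smul F' G' v S))"
  by (cases S; simp only: row_u.simps row_v.simps alg_sum_linear; (intro cl_cong assms)?)+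

lemma mult_syn_fun:
  "cl q (\<^bold>a * syn v) = el q (row_u q smul left_a (left_c q) v)"
  "cl q (\<^bold>b * syn v) = el q (row_u q smul (left_b q) (left_d q) v)"
  "cl q (\<^bold>c * syn v) = el q (row_v q smul left_a (left_c q) v)"
  "cl q (\<^bold>d * syn v) = el q (row_v q smul (left_b q) (left_d q) v)"
  unfolding syn_def el_def mult_lam_sum_fun
  by (intro cl_lam_sum_cong cl_row mult_alg_sum_abc mult_alg_sum_d)+

text \<open>The half that rests on rewriting: \<open>syn\<close> carries the operators of the model
  to multiplication in the quotient.\<close>

lemma mult_syn: "cl q (generator g * syn v) = el q (gen_op q g v)"
  by (cases g) (simp_all add: mult_syn_form mult_syn_fun)

lemma syn_emb_unit0: "syn (emb L0 unit0) = 1"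
  by (simp add: syn_def lam_sum_def lams_def emb_def alg_sum_def idxs_def tris_def unit0_def
      scale_simps alg_mon_def)

text \<open>The normal forms contain 1 and, by \<open>mult_syn\<close>, are closed under left
  multiplication with generators, so they exhaust the quotient.\<close>

lemma el_coord: "el q (coord q x) = cl q x"
proof (induction x rule: falg_word_induct)
  case one
  show ?case by (simp add: el_def coord_def act_simps syn_emb_unit0)
next
  case (gen g x)
  have "el q (coord q (generator g * x)) = cl q (generator g * syn (coord q x))"
    by (simp add: mult_syn coord_def act_mult act_simps)
  also have "\<dots> = cl q (generator g * x)"
    using gen by (intro cl_cong refl) (simp add: el_def)
  finally show ?case .
next
  case (scale z x)
  have "el q (coord q (z \<cdot> x)) = cl q (z \<cdot> syn (coord q x))"
    by (simp add: el_def coord_def act_simps syn_linear)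
  also have "\<dots> = cl q (z \<cdot> x)"
    using scale by (intro cl_cong) (simp add: el_def)
  finally show ?case .
next
  case (add x y)
  have "el q (coord q (x + y)) = cl q (syn (coord q x) + syn (coord q y))"
    by (simp only: el_def coord_def act_add syn_linear)
  also have "\<dots> = cl q (x + y)"
    using add by (intro cl_cong) (simp_all add: el_def)
  finally show ?case .
qed

definition mon_op :: "idx \<Rightarrow> alg \<Rightarrow> alg" where
  "mon_op = (\<lambda>(m, n, k) f. (left_a ^^ tri_nat m) ((left_b q ^^ tri_nat n) ((left_c q ^^ tri_nat k) f)))"

text \<open>Applied to the unit in the order c, b, a, the operators never cross a power of a, so the
  monomials give the unit vectors without powers of q.\<close>

lemma mon_op_sum: "(\<Sum>i\<leftarrow>idxs. smul (f i) (mon_op i unit0)) = f"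
  by (simp add: fun_eq_iff tri_all idxs_def tris_def mon_op_def unit0_def smul_def
      left_a_def left_b_def left_c_def numeral_2_eq_2)

text \<open>Stated for any intertwiner \<open>E\<close> because it serves twice: for
  \<open>emb L0\<close>, where it leads to independence, and for \<open>theta\<close>, where it
  moves theta past A.\<close>

lemma act_alg_sum:
  assumes add: "\<And>f g. E (f + g) = E f + E g" and scale: "\<And>z f. E (smul z f) = vsmul z (E f)"
    and a: "\<And>f. gen_op q Fun_a (E f) = E (left_a f)"
    and b: "\<And>f. gen_op q Fun_b (E f) = E (left_b q f)"
    and c: "\<And>f. gen_op q Fun_c (E f) = E (left_c q f)"
  shows "act q (alg_sum f) (E unit0) = E f"
proof -
  have pow: "act q (\<^bold>a ^ n) (E f) = E ((left_a ^^ n) f)"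
    "act q (\<^bold>b ^ n) (E f) = E ((left_b q ^^ n) f)" 
    "act q (\<^bold>c ^ n) (E f) = E ((left_c q ^^ n) f)" for n f
    using a b c by (induction n) (simp_all add: act_simps act_mult del: gen_op.simps)
  have mon: "act q (alg_mon i) (E f) = E (mon_op i f)" for i f
    by (cases i) (simp add: alg_mon_def mon_op_def act_mult pow)
  have zero: "E 0 = 0" using add[of 0 0] by simp
  have "act q (\<Sum>i\<leftarrow>is. f i \<cdot> alg_mon i) (E unit0) = E (\<Sum>i\<leftarrow>is. smul (f i) (mon_op i unit0))" for "is"
    by (induction "is") (simp_all only: list.map sum_list.Nil sum_list.Cons act_simps act_add add scale mon zero)
  then show ?thesis unfolding alg_sum_def by (simp only: mon_op_sum)
qed

lemma act_alg_sum_emb: "act q (alg_sum f) (emb L0 unit0) = emb L0 f"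
proof (rule act_alg_sum)
  show "emb L0 (f + g) = emb L0 f + emb L0 g" "emb L0 (smul z f) = vsmul z (emb L0 f)" for f g z
    by (auto simp: emb_def vsmul_def smul_linear fun_eq_iff)
  have "gen_op q Fun_a (emb L0 f) S = emb L0 (left_a f) S
      \<and> gen_op q Fun_b (emb L0 f) S = emb L0 (left_b q f) S
      \<and> gen_op q Fun_c (emb L0 f) S = emb L0 (left_c q f) S" for f S
    by (cases S) (simp_all add: emb_def op_linear)
  then show "gen_op q Fun_a (emb L0 f) = emb L0 (left_a f)"
    "gen_op q Fun_b (emb L0 f) = emb L0 (left_b q f)"
    "gen_op q Fun_c (emb L0 f) = emb L0 (left_c q f)" for f
    by (auto simp: fun_eq_iff)
qed

lemma act_lam_mon: "act q (lam_mon S) (emb L0 f) = emb S f"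
proof -
  have "act q (lam_mon S) (emb L0 f) T = emb S f T" for T
    by (cases S; cases T; simp add: act_simps act_mult emb_def op_linear)
  then show ?thesis by auto
qed

lemma act_lam_sum: "act q (lam_sum x) v = (\<Sum>S\<leftarrow>lams. act q (lam_mon S) (act q (x S) v))"
proof -
  have "act q (\<Sum>S\<leftarrow>Ss. lam_mon S * x S) v = (\<Sum>S\<leftarrow>Ss. act q (lam_mon S) (act q (x S) v))" for Ss
    by (induction Ss) (simp_all only: list.map sum_list.Nil sum_list.Cons act_simps act_add act_mult)
  then show ?thesis by (simp only: lam_sum_def)
qed

text \<open>The half that rewriting cannot give: the coefficients of a normal form are recovered
  from its action on the vacuum, so distinct normal forms stay distinct in the quotient.\<close>

lemma coord_syn: "coord q (syn v) = v"
proof -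
  have "coord q (syn v) S = v S" for S
    unfolding coord_def syn_def act_lam_sum act_alg_sum_emb act_lam_mon
    by (cases S) (simp_all add: lams_def emb_def)
  then show ?thesis by auto
qed

lemma coord_cong: "cl q x = cl q y \<Longrightarrow> act q x v = act q y v"
  using act_ideal[of "x - y" v] by (simp add: cl_eq_iff act_simps)

lemma el_inject [simp]: "el q u = el q v \<longleftrightarrow> u = v"
  using coord_cong[of "syn u" "syn v"] coord_syn by (metis coord_def el_def)

lemma carrier_el: "carrier (\<Omega> q) = range (el q)"
  using el_coord by (force simp: carrier_\<Omega> el_def)

end

section \<open>Degrees\<close>

primrec lam_deg :: "lam \<Rightarrow> nat" where
  "lam_deg L0 = 0" | "lam_deg La = 1" | "lam_deg Lb = 1" | "lam_deg Lc = 1" | "lam_deg Ld = 1" |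
  "lam_deg Lab = 2" | "lam_deg Lac = 2" | "lam_deg Lad = 2" | "lam_deg Lbc = 2" | "lam_deg Lbd = 2" | "lam_deg Lcd = 2" |
  "lam_deg Labc = 3" |
  "lam_deg Labd = 3" | "lam_deg Lacd = 3" | "lam_deg Lbcd = 3" |
  "lam_deg Labcd = 4"

definition homog :: "nat \<Rightarrow> vec \<Rightarrow> bool" where
  "homog d v \<longleftrightarrow> (\<forall>S. lam_deg S \<noteq> d \<longrightarrow> v S = 0)"

definition of_degree :: "nat \<Rightarrow> falg \<Rightarrow> bool" where
  "of_degree d x \<longleftrightarrow> (\<forall>w \<in> Poly_Mapping.keys x. form_degree w = d)"

lemma homog_simps:
  "homog d 0" "homog d u \<Longrightarrow> homog d v \<Longrightarrow> homog d (u + v)" "homog d v \<Longrightarrow> homog d (vsmul z v)"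
  by (auto simp: homog_def vsmul_def smul_linear)

lemma homog_sum: "(\<And>w. w \<in> A \<Longrightarrow> homog d (f w)) \<Longrightarrow> homog d (sum f A)"
  by (induction A rule: infinite_finite_induct) (simp_all only: sum.infinite sum.empty sum.insert homog_simps insert_iff simp_thms)

lemma homog_gen_op:
  assumes "homog d v"
  shows "homog (form_degree (Word [g]) + d) (gen_op q g v)"
proof -
  have "gen_op q g v S = 0" if "lam_deg S \<noteq> form_degree (Word [g]) + d" for S
    using assms that by (cases g; cases S) (simp_all add: homog_def form_degree_def op_linear)
  then show ?thesis by (simp add: homog_def)
qed

lemma form_degree_plus: "form_degree (v + w) = form_degree v + form_degree w"
  by (simp add: form_degree_def plus_word_def)

lemma homog_foldr: "homog d v \<Longrightarrow> homog (form_degree (Word gs) + d) (foldr (gen_op q) gs v)"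
proof (induction gs)
  case Nil
  then show ?case by (simp add: form_degree_def)
next
  case (Cons g gs)
  then show ?case
    using homog_gen_op[of "form_degree (Word gs) + d" "foldr (gen_op q) gs v" g q]
      form_degree_plus[of "Word [g]" "Word gs"] by (simp add: plus_word_def add.assoc)
qed

lemma homog_coord: "of_degree d x \<Longrightarrow> homog d (coord q x)"
proof -
  assume x: "of_degree d x"
  have "homog 0 (emb L0 unit0)"
    unfolding homog_def by (intro allI, rename_tac S, case_tac S) (simp_all add: emb_def)
  then have "homog (form_degree w) (foldr (gen_op q) (letters w) (emb L0 unit0))" for w
    using homog_foldr[of 0 "emb L0 unit0" "letters w" q] by simp
  then show ?thesis using x unfolding coord_def act_def of_degree_def
    by (intro homog_sum homog_simps) auto
qed

lemma of_degree_simps: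
  "of_degree 0 1" "of_degree d 0" "of_degree d x \<Longrightarrow> of_degree d y \<Longrightarrow> of_degree d (x + y)"
  "of_degree d x \<Longrightarrow> of_degree d (z \<cdot> x)"
  "of_degree d x \<Longrightarrow> of_degree e y \<Longrightarrow> of_degree (d + e) (x * y)"
  "form_degree (Word [g]) = d \<Longrightarrow> of_degree d (generator g)"
  "of_degree 0 x \<Longrightarrow> of_degree 0 (x ^ n)"
proof -
  show one: "of_degree 0 1" "of_degree d 0" by (auto simp: of_degree_def zero_word_def form_degree_def)
  show "of_degree d x \<Longrightarrow> of_degree d y \<Longrightarrow> of_degree d (x + y)" for x y
    using Poly_Mapping.keys_add[of x y] unfolding of_degree_def by blast
  show mult: "of_degree d x \<Longrightarrow> of_degree e y \<Longrightarrow> of_degree (d + e) (x * y)" for d e x y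
    using keys_mult[of x y] unfolding of_degree_def by (fastforce simp: form_degree_plus)
  have "of_degree 0 (Const z)" by (auto simp: of_degree_def zero_word_def form_degree_def)
  from mult[OF this] show "of_degree d x \<Longrightarrow> of_degree d (z \<cdot> x)" by (simp add: scale_def)
  show "form_degree (Word [g]) = d \<Longrightarrow> of_degree d (generator g)" by (simp add: of_degree_def)
  show "of_degree 0 x \<Longrightarrow> of_degree 0 (x ^ n)"
    using one mult[of 0 x 0] by (induction n) auto
qed

lemma of_degree_alg_sum: "of_degree 0 (alg_sum f)"
proof -
  have "of_degree 0 (\<Sum>i\<leftarrow>is. f i \<cdot> alg_mon i)" for "is"
  proof (induction "is")
    case (Cons i "is")
    have mult: "of_degree 0 x \<Longrightarrow> of_degree 0 y \<Longrightarrow> of_degree 0 (x * y)" for x y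
      using of_degree_simps(5)[of 0 x 0 y] by simp
    have "of_degree 0 (alg_mon i)"
      unfolding alg_mon_def case_prod_beta
      by (intro mult of_degree_simps) (simp_all add: form_degree_def)
    with Cons show ?case by (simp add: of_degree_simps)
  qed (simp add: of_degree_simps)
  then show ?thesis by (simp add: alg_sum_def)
qed

lemma of_degree_lam_mon: "of_degree (lam_deg S) (lam_mon S)"
proof -
  have e: "of_degree 1 e\<^sub>a" "of_degree 1 e\<^sub>b" "of_degree 1 e\<^sub>c" "of_degree 1 e\<^sub>d"
    by (simp_all add: of_degree_simps form_degree_def)
  note 2 = e[THEN of_degree_simps(5)]
  note 3 = 2[OF e(2)] 2[OF e(3)] 2[OF e(4)]
  note 4 = 3[THEN of_degree_simps(5)]
  note 5 = 4[OF e(3)] 4[OF e(4)]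
  note 6 = 5[THEN of_degree_simps(5), OF e(4)]
  show ?thesis
    using e 3 5 6 by (cases S) (simp_all add: numeral_eq_Suc of_degree_simps)
qed

lemma of_degree_syn: "homog d v \<Longrightarrow> of_degree d (syn v)"
proof -
  assume v: "homog d v"
  have "of_degree d (\<Sum>S\<leftarrow>Ss. lam_mon S * alg_sum (v S))" for Ss
  proof (induction Ss)
    case (Cons S Ss)
    have "of_degree d (lam_mon S * alg_sum (v S))"
    proof (cases "lam_deg S = d")
      case True
      then show ?thesis
        using of_degree_simps(5)[OF of_degree_lam_mon of_degree_alg_sum, of S "v S"] by simp
    next
      case False
      then show ?thesis using v by (simp add: homog_def alg_sum_def of_degree_simps scale_simps)
    qed
    with Cons show ?case by (simp add: of_degree_simps)
  qed (simp add: of_degree_simps)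
  then show ?thesis by (simp add: syn_def lam_sum_def)
qed

context cube_root
begin

text \<open>Each generator raises the degree of a coefficient vector by its own form degree, so
  homogeneity survives the passage to normal form.\<close>

lemma Omega_deg_el: "Omega_deg q d = el q ` {v. homog d v}"
proof -
  have "Omega_deg q d = cl q ` {x. of_degree d x}"
    by (simp add: Omega_deg_def of_degree_def)
  also have "\<dots> = el q ` {v. homog d v}"
  proof (intro equalityI subsetI)
    fix y assume "y \<in> cl q ` {x. of_degree d x}"
    then obtain x where "y = cl q x" "of_degree d x" by auto
    then show "y \<in> el q ` {v. homog d v}"
      using homog_coord[of d x q] el_coord[of x] by (metis image_eqI mem_Collect_eq)
  next
    fix y assume "y \<in> el q ` {v. homog d v}"
    then show "y \<in> cl q ` {x. of_degree d x}" using of_degree_syn by (auto simp: el_def)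
  qed
  finally show ?thesis .
qed

lemma homog_0_emb: "homog 0 v \<Longrightarrow> v = emb L0 (v L0)"
  unfolding homog_def emb_def by (intro ext, rename_tac S i, case_tac S) auto

lemma syn_emb_L0: "syn (emb L0 f) = alg_sum f"
proof -
  have "alg_sum 0 = 0" by (rule alg_sum_linear)
  then show ?thesis by (simp add: syn_def lam_sum_def lams_def emb_def)
qed

lemma \<A>_eq: "\<A> q = range (\<lambda>f. cl q (alg_sum f))"
proof -
  have "homog 0 (emb L0 f)" for f
    unfolding homog_def by (intro allI, rename_tac S, case_tac S) (simp_all add: emb_def)
  then have "{v. homog 0 v} = range (emb L0)" using homog_0_emb by blast
  then show ?thesis by (simp add: \<A>_def Omega_deg_el el_def image_image syn_emb_L0)
qed

text \<open>The tables describe left multiplication only; that a right factor from A keeps a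
  coefficient in A is obtained from the degree, without a formula for the product.\<close>

lemma alg_sum_mult: "\<exists>h. cl q (alg_sum f * alg_sum g) = cl q (alg_sum h)"
proof -
  have "of_degree 0 (alg_sum f * alg_sum g)"
    using of_degree_simps(5)[OF of_degree_alg_sum of_degree_alg_sum] by simp
  then have "cl q (alg_sum f * alg_sum g) \<in> \<A> q"
    by (auto simp: \<A>_def Omega_deg_def of_degree_def)
  then show ?thesis by (auto simp: \<A>_eq)
qed

end

section \<open>The Hodge operator\<close>

text \<open>The coefficients are reduced by \<open>1 / (1 + q\<^sup>2) = 1 + q\<close>.\<close>

primrec star :: "complex \<Rightarrow> vec \<Rightarrow> lam \<Rightarrow> alg" where
  "star q v L0 = v Labcd" |
  "star q v La = - (v Labc)" |
  "star q v Lb = - (v Labd)" |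
  "star q v Lc = smul q (v Lacd)" |
  "star q v Ld = smul (- 1 + q) (v Labc) + v Lbcd" |
  "star q v Lab = - (v Lab)" |
  "star q v Lac = v Lac" |
  "star q v Lad = smul (1 + 2 * q) (v Lad) + smul (- 2 * q) (v Lbc)" |
  "star q v Lbc = smul (2 + 2 * q) (v Lad) + smul (- 1 - 2 * q) (v Lbc)" |
  "star q v Lbd = smul (2 - 2 * q) (v Lab) + v Lbd" |
  "star q v Lcd = - (v Lcd)" |
  "star q v Labc = - (v La)" |
  "star q v Labd = - (v Lb)" |
  "star q v Lacd = smul (- 1 - q) (v Lc)" |
  "star q v Lbcd = smul (- 1 + q) (v La) + v Ld" |
  "star q v Labcd = v L0"

context cube_root
begin

lemma el_add: "el q u \<oplus>\<^bsub>\<Omega> q\<^esub> el q v = el q (u + v)"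
  by (simp only: el_def cl_add syn_linear)

lemma star_linear: "star q (u + v) = star q u + star q v"
proof -
  have "star q (u + v) S i = (star q u + star q v) S i" for S i
    by (cases S) (simp_all add: smul_def algebra_simps)
  then show ?thesis by (intro ext)
qed

text \<open>The operator only recombines coefficients with complex scalars, and these commute with a
  factor on the right.\<close>

lemma star_right_linear:
  assumes "\<And>S. cl q (alg_sum (v S) * y) = cl q (alg_sum (h S))"
  shows "cl q (alg_sum (star q v S) * y) = cl q (alg_sum (star q h S))"
  by (cases S; simp only: star.simps alg_sum_linear distrib_right left_diff_distrib
      mult_minus_left scale_simps(8); intro cl_cong assms)

lemma inverse_facts: "1 / (1 + q\<^sup>2) = 1 + q" "q\<^sup>2 / (1 + q\<^sup>2) = - q" "1 / q\<^sup>2 = q"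
proof -
  have 1: "1 + q\<^sup>2 = - q" by (simp add: q_square)
  show "1 / (1 + q\<^sup>2) = 1 + q" "q\<^sup>2 / (1 + q\<^sup>2) = - q"
    unfolding 1 divide_inverse by (simp_all add: inverse_q q_square q_reduce)
  have "q\<^sup>2 * q = 1" using cube by (simp add: power2_eq_square power3_eq_cube)
  then show "1 / q\<^sup>2 = q" by (metis inverse_unique inverse_eq_divide)
qed

lemma star_hodge_table: "\<forall>p \<in> hodge_table q. star q (coord q (fst p)) S i = coord q (snd p) S i"
  unfolding hodge_table_def inverse_facts
  by (cases S; simp add: coord_def act_simps act_mult act_add emb_def vsmul_def op_linear \<mu>_q q_square;
      simp add: smul_def q_reduce)

text \<open>The restriction to the carrier makes the map extensional, as \<open>is_hodge\<close>
  requires; \<open>inv_into\<close> reads off the coordinates because \<open>el q\<close> is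
  injective.\<close>

definition hodge_el :: "falg set \<Rightarrow> falg set" where
  "hodge_el = (\<lambda>\<omega> \<in> carrier (\<Omega> q). el q (star q (inv_into UNIV (el q) \<omega>)))"

lemma el_carrier [simp]: "el q v \<in> carrier (\<Omega> q)"
  by (simp add: carrier_el)

lemma hodge_el: "hodge_el (el q v) = el q (star q v)"
  by (simp add: hodge_el_def inv_f_f inj_def)

lemma el_mult_alg:
  assumes "\<And>S. cl q (alg_sum (v S) * y) = cl q (alg_sum (h S))"
  shows "el q v \<otimes>\<^bsub>\<Omega> q\<^esub> cl q y = el q h"
proof -
  have "syn v * y = lam_sum (\<lambda>S. alg_sum (v S) * y)"
    by (simp add: syn_def lam_sum_def lams_def distrib_right mult.assoc)
  then show ?thesis
    using cl_lam_sum_cong[of "\<lambda>S. alg_sum (v S) * y" "\<lambda>S. alg_sum (h S)"] assms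
    by (simp add: el_def cl_mult syn_def)
qed

lemma is_hodge_hodge_el: "is_hodge q hodge_el"
  unfolding is_hodge_def
proof (intro conjI ballI)
  show "hodge_el \<in> carrier (\<Omega> q) \<rightarrow>\<^sub>E carrier (\<Omega> q)"
    by (auto simp: hodge_el_def)
next
  fix \<omega> \<eta> assume "\<omega> \<in> carrier (\<Omega> q)" "\<eta> \<in> carrier (\<Omega> q)"
  then obtain u v where "\<omega> = el q u" "\<eta> = el q v" by (auto simp: carrier_el)
  then show "hodge_el (\<omega> \<oplus>\<^bsub>\<Omega> q\<^esub> \<eta>) = hodge_el \<omega> \<oplus>\<^bsub>\<Omega> q\<^esub> hodge_el \<eta>"
    by (simp only: el_add hodge_el star_linear)
next
  fix \<omega> f assume "\<omega> \<in> carrier (\<Omega> q)" "f \<in> \<A> q"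
  then obtain v g where v: "\<omega> = el q v" and f: "f = cl q (alg_sum g)" by (auto simp: carrier_el \<A>_eq)
  have "\<exists>h. \<forall>S. cl q (alg_sum (v S) * alg_sum g) = cl q (alg_sum (h S))"
    using alg_sum_mult by (intro choice) blast
  then obtain h where h: "\<And>S. cl q (alg_sum (v S) * alg_sum g) = cl q (alg_sum (h S))" by blast
  show "hodge_el (\<omega> \<otimes>\<^bsub>\<Omega> q\<^esub> f) = hodge_el \<omega> \<otimes>\<^bsub>\<Omega> q\<^esub> f"
    unfolding v f el_mult_alg[OF h] hodge_el el_mult_alg[OF star_right_linear[OF h]] ..
next
  fix p assume "p \<in> hodge_table q"
  then have "star q (coord q (fst p)) S i = coord q (snd p) S i" for S i
    using star_hodge_table by blast
  then have "star q (coord q (fst p)) = coord q (snd p)" by (intro ext)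
  then have "hodge_el (cl q (fst p)) = cl q (snd p)"
    by (simp flip: el_coord add: hodge_el)
  then show "case p of (x, y) \<Rightarrow> hodge_el (cl q x) = cl q y" by (simp add: case_prod_beta)
qed

text \<open>The 16 left entries of the table are the monomials e_S; additivity and right linearity
  extend agreement on them to all sums of e_S f_S.\<close>

lemma is_hodge_unique:
  assumes s: "is_hodge q s" and t: "is_hodge q t"
  shows "s = t"
proof
  fix \<omega>
  show "s \<omega> = t \<omega>"
  proof (cases "\<omega> \<in> carrier (\<Omega> q)")
    case False
    then show ?thesis using s t by (auto simp: is_hodge_def PiE_def extensional_def)
  next
    case True
    then obtain v where v: "\<omega> = el q v" by (auto simp: carrier_el)
    have mult: "r (cl q x \<otimes>\<^bsub>\<Omega> q\<^esub> cl q (alg_sum f)) = r (cl q x) \<otimes>\<^bsub>\<Omega> q\<^esub> cl q (alg_sum f)"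
      if "is_hodge q r" for r x f
      using that by (auto simp: is_hodge_def \<A>_eq)
    have table: "s (cl q (lam_mon S)) = t (cl q (lam_mon S))" for S
      using s t by (cases S) (auto simp: is_hodge_def hodge_table_def)
    have summand: "s (cl q (lam_mon S * alg_sum f)) = t (cl q (lam_mon S * alg_sum f))" for S f
      using mult[OF s] mult[OF t] table by (simp flip: cl_mult)
    have "s (cl q (\<Sum>S\<leftarrow>Ss. lam_mon S * alg_sum (v S))) = t (cl q (\<Sum>S\<leftarrow>Ss. lam_mon S * alg_sum (v S)))" for Ss
    proof (induction Ss)
      case Nil
      \<comment> \<open>The empty sum is read as the summand of \<open>L0\<close> with coefficient
        0, so that \<open>summand\<close> covers it.\<close>
      have "alg_sum 0 = 0" by (rule alg_sum_linear)
      then show ?case using summand[of L0 0] by simp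
    next
      case (Cons S Ss)
      then show ?case using s t summand[of S "v S"] by (simp add: is_hodge_def flip: cl_add)
    qed
    then show ?thesis by (simp add: v el_def syn_def lam_sum_def)
  qed
qed

lemma hodge_el_eq: "hodge q (el q v) = el q (star q v)"
proof -
  have "hodge q = hodge_el"
    unfolding hodge_def using is_hodge_hodge_el is_hodge_unique by blast
  then show ?thesis by (simp add: hodge_el)
qed

end

section \<open>The exterior derivative\<close>

primrec succ3 :: "tri \<Rightarrow> tri" where
  "succ3 T0 = T1" | "succ3 T1 = T2" | "succ3 T2 = T0"

primrec add3 :: "tri \<Rightarrow> tri \<Rightarrow> tri" where
  "add3 T0 n = n" | "add3 T1 n = succ3 n" | "add3 T2 n = pred3 n"

text \<open>The symmetric q-integer [t + 1]: [1] = 1, [2] = q + q^-1 = -1, [3] = 0. Its zero cuts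
  off the cyclic shift \<open>succ3\<close>, since a twisted derivation kills the zeroth
  power.\<close>

primrec tri_sgn :: "tri \<Rightarrow> complex" where
  "tri_sgn T0 = 1" | "tri_sgn T1 = - 1" | "tri_sgn T2 = 0"

text \<open>The operators \<open>D\<^sub>i\<close> on \<open>\<A>\<close> with \<open>f \<theta> = \<Sum>\<^sub>i e\<^sub>i D\<^sub>i f\<close>: \<open>D\<^sub>a\<close> is the automorphism acting by
  \<open>q\<close> on \<open>a, b\<close> and by \<open>q\<^sup>-\<^sup>1\<close> on \<open>c, d\<close>, and \<open>D\<^sub>b, D\<^sub>c\<close> are twisted derivations.\<close>

definition par_a :: "complex \<Rightarrow> alg \<Rightarrow> alg" where
  "par_a q f = (\<lambda>(m, n, k). qpow q (add3 (add3 m n) (add3 k k)) * f (m, n, k))"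

definition par_b :: "complex \<Rightarrow> alg \<Rightarrow> alg" where
  "par_b q f = (\<lambda>(m, n, k). (1 - q) * (qpow q n * (tri_sgn k * f (pred3 m, n, succ3 k))))"

text \<open>This operator replaces a by c and b by d. As d = a^2 (1 + q^-1 bc), replacing b feeds
  both summands; the first has no part at \<open>k = T0\<close> because it raises the power of
  c.\<close>

definition par_c :: "complex \<Rightarrow> alg \<Rightarrow> alg" where
  "par_c q f = (\<lambda>(m, n, k). (1 - q) *
     ((if k = T0 then 0
       else qpow q (add3 (succ3 m) (add3 k k)) * (tri_sgn (add3 m n) * f (succ3 m, n, pred3 k))) +
      qpow q (add3 k k) * (tri_sgn n * f (succ3 m, succ3 n, k))))"

text \<open>Solved from D_a D_d = 1 + q^-1 D_b D_c and D_a^3 = 1, in the same way as d is expressed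
  by a, b, c.\<close>

definition par_d :: "complex \<Rightarrow> alg \<Rightarrow> alg" where
  "par_d q f = par_a q (par_a q (f + smul (- 1 - q) (par_b q (par_c q f))))"

lemma par_linear:
  "par_a q (f + g) = par_a q f + par_a q g" "par_a q (f - g) = par_a q f - par_a q g"
  "par_a q (- f) = - par_a q f" "par_a q (smul z f) = smul z (par_a q f)" "par_a q 0 = 0"
  "par_b q (f + g) = par_b q f + par_b q g" "par_b q (f - g) = par_b q f - par_b q g"
  "par_b q (- f) = - par_b q f" "par_b q (smul z f) = smul z (par_b q f)" "par_b q 0 = 0"
  "par_c q (f + g) = par_c q f + par_c q g" "par_c q (f - g) = par_c q f - par_c q g"
  "par_c q (- f) = - par_c q f" "par_c q (smul z f) = smul z (par_c q f)" "par_c q 0 = 0"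
  by (simp_all add: par_a_def par_b_def par_c_def smul_def fun_eq_iff algebra_simps)

lemma par_d_linear:
  "par_d q (f + g) = par_d q f + par_d q g" "par_d q (f - g) = par_d q f - par_d q g"
  "par_d q (- f) = - par_d q f" "par_d q (smul z f) = smul z (par_d q f)" "par_d q 0 = 0"
  by (simp_all add: par_d_def par_linear smul_linear mult.commute)

definition vec1 :: "alg \<Rightarrow> alg \<Rightarrow> alg \<Rightarrow> alg \<Rightarrow> vec" where
  "vec1 xa xb xc xd = (\<lambda>S. case S of La \<Rightarrow> xa | Lb \<Rightarrow> xb | Lc \<Rightarrow> xc | Ld \<Rightarrow> xd | _ \<Rightarrow> 0)"

definition vec2 :: "alg \<Rightarrow> alg \<Rightarrow> alg \<Rightarrow> alg \<Rightarrow> alg \<Rightarrow> alg \<Rightarrow> vec" where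
  "vec2 xab xac xad xbc xbd xcd = (\<lambda>S. case S of Lab \<Rightarrow> xab | Lac \<Rightarrow> xac | Lad \<Rightarrow> xad
     | Lbc \<Rightarrow> xbc | Lbd \<Rightarrow> xbd | Lcd \<Rightarrow> xcd | _ \<Rightarrow> 0)"

definition vec3 :: "alg \<Rightarrow> alg \<Rightarrow> alg \<Rightarrow> alg \<Rightarrow> vec" where
  "vec3 xabc xabd xacd xbcd =
     (\<lambda>S. case S of Labc \<Rightarrow> xabc | Labd \<Rightarrow> xabd | Lacd \<Rightarrow> xacd | Lbcd \<Rightarrow> xbcd | _ \<Rightarrow> 0)"

lemma homog_1_vec1: "homog 1 v \<longleftrightarrow> (\<exists>xa xb xc xd. v = vec1 xa xb xc xd)"
proof
  assume "homog 1 v"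
  then have "v S = vec1 (v La) (v Lb) (v Lc) (v Ld) S" for S
    by (cases S) (simp_all add: homog_def vec1_def)
  then show "\<exists>xa xb xc xd. v = vec1 xa xb xc xd" by blast
next
  assume "\<exists>xa xb xc xd. v = vec1 xa xb xc xd"
  then show "homog 1 v"
    unfolding homog_def by (intro allI, rename_tac S, case_tac S) (auto simp: vec1_def)
qed

context cube_root
begin

definition theta :: "alg \<Rightarrow> vec" where
  "theta f = vec1 (par_a q f) (par_b q f) (par_c q f) (par_d q f)"

text \<open>Comparison of coefficients in u (f theta) = (u f) theta for u = a, b, c, with the left
  side read off from \<open>row_u\<close> and \<open>row_v\<close>.\<close>

lemma par_rules:
  "par_a q (left_a f) = smul q (left_a (par_a q f))"
  "par_b q (left_a f) = left_a (par_b q f)"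
  "par_c q (left_a f) = smul (1 - q) (left_c q (par_a q f)) + left_a (par_c q f)"
  "par_d q (left_a f) = smul (3 + 3 * q) (left_a (par_a q f)) + smul (1 + 2 * q) (left_c q (par_b q f))
     + smul (- 1 - q) (left_a (par_d q f))"
  "par_a q (left_b q f) = smul q (left_b q (par_a q f))"
  "par_b q (left_b q f) = left_b q (par_b q f)"
  "par_c q (left_b q f) = smul (1 - q) (left_d q (par_a q f)) + left_b q (par_c q f)"
  "par_d q (left_b q f) = smul (3 + 3 * q) (left_b q (par_a q f)) + smul (1 + 2 * q) (left_d q (par_b q f))
     + smul (- 1 - q) (left_b q (par_d q f))"
  "par_a q (left_c q f) = smul (- 1 - q) (left_c q (par_a q f))"
  "par_b q (left_c q f) = smul (1 - q) (left_a (par_a q f)) + left_c q (par_b q f)"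
  "par_c q (left_c q f) = left_c q (par_c q f)"
  "par_d q (left_c q f) = smul (1 + 2 * q) (left_a (par_c q f)) + smul q (left_c q (par_d q f))"
  by (simp_all add: fun_eq_iff tri_all left_a_def left_b_def left_c_def left_d_def smul_def
      par_a_def par_b_def par_c_def par_d_def q_reduce)

lemma act_alg_sum_theta: "act q (alg_sum f) (theta unit0) = theta f"
proof (rule act_alg_sum)
  have "theta (f + g) S i = (theta f + theta g) S i \<and> theta (smul z f) S i = vsmul z (theta f) S i"
    for f g z S i
    by (cases S) (simp_all add: theta_def vec1_def vsmul_def smul_linear par_linear par_d_linear)
  then show "theta (f + g) = theta f + theta g" "theta (smul z f) = vsmul z (theta f)" for f g z
    by (auto simp only: fun_eq_iff)
  have "gen_op q Fun_a (theta f) S i = theta (left_a f) S i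
      \<and> gen_op q Fun_b (theta f) S i = theta (left_b q f) S i
      \<and> gen_op q Fun_c (theta f) S i = theta (left_c q f) S i" for f S i
    by (cases S) (simp_all add: theta_def vec1_def op_linear par_rules)
  then show "gen_op q Fun_a (theta f) = theta (left_a f)"
    "gen_op q Fun_b (theta f) = theta (left_b q f)"
    "gen_op q Fun_c (theta f) = theta (left_c q f)" for f
    by (auto simp only: fun_eq_iff)
qed

lemma coord_theta: "coord q (e\<^sub>a + e\<^sub>d) = theta unit0"
proof -
  have par: "par_a q unit0 = unit0" "par_b q unit0 = 0" "par_c q unit0 = 0" "par_d q unit0 = unit0"
    by (simp_all add: fun_eq_iff tri_all par_a_def par_b_def par_c_def par_d_def unit0_def smul_def)
  have "coord q (e\<^sub>a + e\<^sub>d) S i = theta unit0 S i" for S i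
    by (cases S) (simp_all add: coord_def theta_def vec1_def act_add act_simps emb_def op_linear par)
  then show ?thesis by (intro ext)
qed

definition times_theta :: "vec \<Rightarrow> vec" where
  "times_theta v = (\<Sum>S\<leftarrow>lams. act q (lam_mon S) (theta (v S)))"

definition diff_vec :: "complex \<Rightarrow> vec \<Rightarrow> vec" where
  "diff_vec s v = vsmul s (times_theta v) - (form_a q smul v + form_d q smul v)"

lemma cl_mult_theta: "cl q (syn v * (e\<^sub>a + e\<^sub>d)) = el q (times_theta v)"
proof -
  have "coord q (syn v * (e\<^sub>a + e\<^sub>d)) = act q (syn v) (theta unit0)"
    by (simp only: coord_def act_mult flip: coord_theta)
  also have "\<dots> = times_theta v"
    by (simp only: times_theta_def syn_def act_lam_sum act_alg_sum_theta)
  finally show ?thesis by (metis el_coord)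
qed

lemma ext_d_el: "ext_d q i (el q v) = el q (diff_vec ((- 1) ^ i) v)"
proof -
  \<comment> \<open>The sign is an element of the free algebra here; its action is found by
    splitting on the parity of the degree.\<close>
  have sign: "act q ((- 1) ^ i) w = vsmul ((- 1) ^ i) w" for w
  proof (cases "even i")
    case True
    then show ?thesis by (simp add: act_simps vsmul_simps)
  next
    case False
    then show ?thesis using act_simps(5)[of q 1 w] vsmul_simps(4)[of w]
      by (simp add: act_simps vsmul_def smul_def fun_eq_iff)
  qed
  let ?t = "e\<^sub>a + e\<^sub>d"
  have "ext_d q i (el q v) = cl q (- (?t * syn v - (- 1) ^ i * (syn v * ?t)))"
    by (simp only: ext_d_def Let_def el_def cl_mult cl_diff cl_uminus)
  also have "\<dots> = el q (coord q (- (?t * syn v - (- 1) ^ i * (syn v * ?t))))"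
    by (rule el_coord[symmetric])
  also have "coord q (- (?t * syn v - (- 1) ^ i * (syn v * ?t)))
      = - (act q ?t (coord q (syn v)) - act q ((- 1) ^ i) (coord q (syn v * ?t)))"
    by (simp only: coord_def act_simps act_mult)
  also have "coord q (syn v * ?t) = times_theta v"
    using cl_mult_theta[of v] el_coord[of "syn v * ?t"] by simp
  also have "act q ?t (coord q (syn v)) = form_a q smul v + form_d q smul v"
    by (simp only: act_add act_simps coord_syn gen_op.simps)
  also have "- (form_a q smul v + form_d q smul v - act q ((- 1) ^ i) (times_theta v))
      = diff_vec ((- 1) ^ i) v"
    unfolding diff_vec_def sign by (rule minus_diff_eq)
  finally show ?thesis .
qed

lemma diff_vec1:
  "diff_vec (- 1) (vec1 xa xb xc xd) = vec2
      (- (par_b q xa) - xb + smul q (par_a q xb))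
      (- (par_c q xa) - xc + smul (- 1 - q) (par_a q xc))
      (xa - (par_d q xa) - xd + par_a q xd)
      (smul (- 1 + q) (par_a q xa) - (par_c q xb) + par_b q xc + smul (1 - q) (par_a q xd))
      (xb + smul (- 1 - 2 * q) (par_a q xb) - (par_d q xb) + par_b q xd)
      (xc + smul (1 - q) (par_a q xc) - (par_d q xc) + par_c q xd)" (is "_ = ?v")
proof -
  have zero: "theta 0 = 0"
    by (rule ext, rename_tac S, case_tac S)
      (simp_all add: theta_def vec1_def par_linear par_d_linear)
  have "diff_vec (- 1) (vec1 xa xb xc xd) S i = ?v S i" for S i
    unfolding diff_vec_def times_theta_def lams_def list.map sum_list.Cons sum_list.Nil
    by (cases S; simp add: vec1_def vec2_def zero act_linear act_simps act_mult vsmul_def op_linear;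
        simp add: theta_def vec1_def smul_def q_reduce)
  then show ?thesis by (intro ext)
qed

lemma diff_vec2:
  "diff_vec 1 (vec2 xab xac xad xbc xbd xcd) = vec3
      (par_c q xab - (par_b q xac) + smul (- 1 + q) (par_a q xad) - xbc + par_a q xbc)
      (- xab + smul (1 + 2 * q) (par_a q xab) + par_d q xab - (par_b q xad) - xbd + smul q (par_a q xbd))
      (- xac + smul (- 1 + q) (par_a q xac) + par_d q xac - (par_c q xad) - xcd + smul (- 1 - q) (par_a q xcd))
      (smul (- 1 + q) (par_a q xad) - xbc + par_d q xbc - (par_c q xbd) + par_b q xcd)" (is "_ = ?v")
proof -
  have zero: "theta 0 = 0"
    by (rule ext, rename_tac S, case_tac S)
      (simp_all add: theta_def vec1_def par_linear par_d_linear)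
  have "diff_vec 1 (vec2 xab xac xad xbc xbd xcd) S i = ?v S i" for S i
    unfolding diff_vec_def times_theta_def lams_def list.map sum_list.Cons sum_list.Nil
    by (cases S; simp add: vec2_def vec3_def zero act_linear act_simps act_mult vsmul_def op_linear;
        simp add: theta_def vec1_def smul_def q_reduce)
  then show ?thesis by (intro ext)
qed

lemma star_vec2:
  "star q (vec2 xab xac xad xbc xbd xcd) = vec2
      (- xab)
      xac
      (smul (1 + 2 * q) xad + smul (- 2 * q) xbc)
      (smul (2 + 2 * q) xad + smul (- 1 - 2 * q) xbc)
      (smul (2 - 2 * q) xab + xbd)
      (- xcd)" (is "_ = ?v")
proof -
  have "star q (vec2 xab xac xad xbc xbd xcd) S i = ?v S i" for S i
    by (cases S) (simp_all add: vec2_def smul_linear)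
  then show ?thesis by (intro ext)
qed

lemma star_vec3:
  "star q (vec3 xabc xabd xacd xbcd) = vec1
      (- xabc)
      (- xabd)
      (smul q xacd)
      (smul (- 1 + q) xabc + xbcd)" (is "_ = ?v")
proof -
  have "star q (vec3 xabc xabd xacd xbcd) S i = ?v S i" for S i
    by (cases S) (simp_all add: vec3_def vec1_def smul_linear)
  then show ?thesis by (intro ext)
qed

text \<open>The relations of the reduced enveloping algebra; for instance D_b D_c - q D_c D_b = q (1
  - q) (D_a^2 - 1). They are oriented so that D_a is applied last and D_d first, and no product of
  D_b with D_c remains.\<close>

lemma par_commute:
  "par_b q (par_a q f) = smul q (par_a q (par_b q f))"
  "par_c q (par_a q f) = smul (- 1 - q) (par_a q (par_c q f))"
  "par_b q (par_c q f) = smul q (par_a q (par_d q f)) - smul q f"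
  "par_c q (par_b q f) = par_a q (par_d q f) - smul (1 - q) (par_a q (par_a q f)) - smul q f"
  "par_d q (par_a q f) = par_a q (par_d q f)"
  "par_d q (par_b q f) = par_b q (par_d q f) - smul (1 + 2 * q) (par_a q (par_b q f))"
  "par_d q (par_c q f) = par_c q (par_d q f) + smul (1 - q) (par_a q (par_c q f))"
  by (simp_all add: fun_eq_iff tri_all smul_def par_a_def par_b_def par_c_def par_d_def q_reduce)

section \<open>The Maxwell operator\<close>

text \<open>This and the next three are the rows of the matrix for star d star d, with each entry in
  the normal order that \<open>par_commute\<close> produces.\<close>

definition max_a :: "alg \<Rightarrow> alg \<Rightarrow> alg \<Rightarrow> alg \<Rightarrow> alg" where
  "max_a xa xb xc xd = smul (2 + 4 * q) xa + smul (4 + 4 * q) (par_a q xa)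
     + smul (4 + 2 * q) (par_a q (par_a q xa))
     + smul (- 2 - 2 * q) (par_a q (par_d q xa)) + smul (- 2 - 2 * q) (par_d q xa)
     + smul (2 * q) (par_c q xb) + smul (2 + 2 * q) (par_a q (par_c q xb))
     + smul (- 2 - 2 * q) (par_b q xc) + smul (- 2 * q) (par_a q (par_b q xc))
     + smul (- 2 - 2 * q) xd + smul (- 2 - 2 * q) (par_a q xd)
     + smul (- 2 - 2 * q) (par_a q (par_a q xd))"

definition max_b :: "alg \<Rightarrow> alg \<Rightarrow> alg \<Rightarrow> alg \<Rightarrow> alg" where
  "max_b xa xb xc xd = smul (4 * q) (par_b q xa) + smul (- 2 + 2 * q) (par_a q (par_b q xa))
     + smul (- 2 - 2 * q) (par_b q (par_d q xa)) + smul (2 + 4 * q) xb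
     + smul (2 + 2 * q) (par_a q xb) + smul (- 2) (par_d q xb)
     + smul (- 2) (par_a q (par_d q xb)) + smul (- 2 * q) (par_b q (par_b q xc))
     + smul (- 2 * q) (par_b q xd) + smul 2 (par_a q (par_b q xd))"

definition max_c :: "alg \<Rightarrow> alg \<Rightarrow> alg \<Rightarrow> alg \<Rightarrow> alg" where
  "max_c xa xb xc xd = smul (2 + 2 * q) (par_c q xa) + smul (- 2 - 4 * q) (par_a q (par_c q xa))
     + smul (- 2 - 2 * q) (par_c q (par_d q xa))
     + smul (2 + 2 * q) (par_c q (par_c q xb)) + smul (- 2 + 2 * q) xc
     + smul (4 * q) (par_a q xc) + smul (- 2 * q) (par_d q xc)
     + smul (2 + 4 * q) (par_a q (par_a q xc))
     + smul (- 2 * q) (par_a q (par_d q xc)) + smul (- 2) (par_c q xd)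
     + smul (2 * q) (par_a q (par_c q xd))"

definition max_d :: "alg \<Rightarrow> alg \<Rightarrow> alg \<Rightarrow> alg \<Rightarrow> alg" where
  "max_d xa xb xc xd = smul 2 xa + smul (2 - 2 * q) (par_a q xa) + smul (2 * q) (par_d q xa)
     + smul (4 + 2 * q) (par_a q (par_d q xa))
     + smul (- 2 - 2 * q) (par_d q (par_d q xa)) + smul 2 (par_c q xb)
     + smul (4 + 2 * q) (par_a q (par_c q xb))
     + smul (2 + 2 * q) (par_c q (par_d q xb)) + smul (- 4) (par_b q xc)
     + smul (- 4 - 2 * q) (par_a q (par_b q xc))
     + smul (- 2 * q) (par_b q (par_d q xc)) + smul (- 2 + 2 * q) xd
     + smul (2 * q) (par_a q xd) + smul (- 2 - 2 * q) (par_d q xd)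
     + smul (- 2 - 2 * q) (par_a q (par_d q xd))"

definition max_vec :: "vec \<Rightarrow> vec" where
  "max_vec v = vec1 (max_a (v La) (v Lb) (v Lc) (v Ld)) (max_b (v La) (v Lb) (v Lc) (v Ld))
     (max_c (v La) (v Lb) (v Lc) (v Ld)) (max_d (v La) (v Lb) (v Lc) (v Ld))"

lemma star_diff_star_diff:
  assumes "homog 1 v"
  shows "star q (diff_vec 1 (star q (diff_vec (- 1) v))) = max_vec v"
proof -
  obtain xa xb xc xd where v: "v = vec1 xa xb xc xd" using assms homog_1_vec1 by blast
  have "star q (diff_vec 1 (star q (diff_vec (- 1) v))) S i = max_vec v S i" for S i
    unfolding v diff_vec1 star_vec2 diff_vec2 star_vec3 unfolding max_vec_def vec1_def lam.case
      max_a_def max_b_def max_c_def max_d_def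
    by (cases S; simp add: smul_linear par_linear par_d_linear par_commute;
        simp add: smul_def q_reduce)
  then show ?thesis by (intro ext)
qed

lemma Maxwell_el: "homog 1 v \<Longrightarrow> Maxwell q (el q v) = el q (max_vec v)"
  unfolding Maxwell_def codiff_def by (simp add: ext_d_el hodge_el_eq star_diff_star_diff)

end

section \<open>The image of the Maxwell operator\<close>

text \<open>Gaussian elimination on the Maxwell operator gives the following equations for a form
  \<open>e\<^sub>a t + e\<^sub>z z + e\<^sub>b b + e\<^sub>c c\<close> in its image: \<open>z\<close>, \<open>b\<close> and \<open>c\<close> are recovered from their pivot
  coordinates and \<open>t\<close>.\<close>

fun rel_z :: "complex \<Rightarrow> alg \<Rightarrow> idx \<Rightarrow> complex" where
  "rel_z q z (T0, T0, T0) = z (T0, T0, T0)" |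
  "rel_z q z (T0, T0, T1) = z (T0, T0, T1)" |
  "rel_z q z (T0, T0, T2) = z (T0, T0, T2)" |
  "rel_z q z (T0, T1, T0) = z (T0, T1, T0)" |
  "rel_z q z (T0, T1, T1) = z (T0, T1, T1)" |
  "rel_z q z (T0, T2, T0) = z (T0, T2, T0)" |
  "rel_z q z (T0, T2, T2) = z (T0, T2, T2)" |
  "rel_z q z (T1, T0, T0) = z (T1, T0, T0)" |
  "rel_z q z (T1, T0, T1) = z (T1, T0, T1)" |
  "rel_z q z (T1, T1, T0) = z (T1, T1, T0)" |
  "rel_z q z (T1, T1, T1) = z (T1, T1, T1)" |
  "rel_z q z (T1, T1, T2) = z (T1, T1, T2)" |
  "rel_z q z (T1, T2, T0) = z (T1, T2, T0)" |
  "rel_z q z (T1, T2, T1) = z (T1, T2, T1)" |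
  "rel_z q z (T1, T2, T2) = - q * z (T1, T1, T1)" |
  "rel_z q z (T2, T0, T0) = z (T2, T0, T0)" |
  "rel_z q z (T2, T0, T1) = z (T2, T0, T1)" |
  "rel_z q z (T2, T0, T2) = z (T2, T0, T2)" |
  "rel_z q z (T2, T1, T0) = z (T2, T1, T0)" |
  "rel_z q z (T2, T1, T1) = z (T2, T1, T1)" |
  "rel_z q z (T2, T1, T2) = z (T2, T1, T2)" |
  "rel_z q z (T2, T2, T1) = z (T2, T2, T1)" |
  "rel_z q z _ = 0"

fun rel_b :: "complex \<Rightarrow> alg \<Rightarrow> alg \<Rightarrow> alg \<Rightarrow> idx \<Rightarrow> complex" where
  "rel_b q t z b (T0, T0, T0) = b (T0, T0, T0)" |
  "rel_b q t z b (T0, T0, T1) = - q * z (T2, T0, T2)" |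
  "rel_b q t z b (T0, T0, T2) = b (T0, T0, T2)" |
  "rel_b q t z b (T0, T1, T0) = b (T0, T1, T0)" |
  "rel_b q t z b (T0, T1, T1) = (2 + 2 * q) * t (T2, T0, T1) + (- 1 - q) * z (T2, T0, T1) + (- 1 - q) * z (T2, T1, T2)" |
  "rel_b q t z b (T0, T2, T0) = b (T0, T2, T0)" |
  "rel_b q t z b (T0, T2, T2) = (- 1 - q) * z (T2, T0, T1) - z (T2, T1, T2)" |
  "rel_b q t z b (T1, T0, T0) = b (T1, T0, T0)" |
  "rel_b q t z b (T1, T0, T1) = b (T1, T0, T1)" |
  "rel_b q t z b (T1, T1, T0) = b (T1, T1, T0)" |
  "rel_b q t z b (T1, T1, T1) = b (T1, T1, T1)" |
  "rel_b q t z b (T1, T1, T2) = - 2 * t (T0, T0, T2) - q * z (T0, T0, T2) - q * b (T1, T0, T1)" |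
  "rel_b q t z b (T1, T2, T0) = b (T1, T2, T0)" |
  "rel_b q t z b (T1, T2, T1) = - z (T0, T2, T2)" |
  "rel_b q t z b (T1, T2, T2) = - q * b (T1, T1, T1)" |
  "rel_b q t z b (T2, T0, T0) = b (T2, T0, T0)" |
  "rel_b q t z b (T2, T0, T1) = b (T2, T0, T1)" |
  "rel_b q t z b (T2, T0, T2) = b (T2, T0, T2)" |
  "rel_b q t z b (T2, T1, T0) = b (T2, T1, T0)" |
  "rel_b q t z b (T2, T1, T1) = (1 + q) * z (T1, T1, T2)" |
  "rel_b q t z b (T2, T1, T2) = (- 1 - q) * b (T2, T0, T1)" |
  "rel_b q t z b (T2, T2, T0) = (1 + q) * z (T1, T2, T1)" |
  "rel_b q t z b (T2, T2, T1) = (- 2 - 2 * q) * t (T1, T1, T1) + z (T1, T1, T1)" |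
  "rel_b q t z b _ = 0"

fun rel_c :: "complex \<Rightarrow> alg \<Rightarrow> alg \<Rightarrow> alg \<Rightarrow> alg \<Rightarrow> idx \<Rightarrow> complex" where
  "rel_c q t z b c (T0, T0, T0) = c (T0, T0, T0)" |
  "rel_c q t z b c (T0, T0, T1) = q * t (T1, T0, T0) + (1 + 2 * q) * t (T1, T1, T1) - q * b (T2, T1, T0) - q * z (T1, T0, T0) + (- 2 - q) * z (T1, T1, T1)" |
  "rel_c q t z b c (T0, T0, T2) = (- 2 - q) * t (T1, T0, T1) + (1 - q) * z (T1, T0, T1) - z (T1, T1, T2) + (1 + q) * b (T2, T0, T0)" |
  "rel_c q t z b c (T0, T1, T0) = (- 1 - q) * z (T1, T2, T0)" |
  "rel_c q t z b c (T0, T1, T1) = - q * t (T1, T1, T0) + z (T1, T1, T0) - q * z (T1, T2, T1)" |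
  "rel_c q t z b c (T0, T2, T0) = c (T0, T2, T0)" |
  "rel_c q t z b c (T0, T2, T2) = z (T1, T2, T1)" |
  "rel_c q t z b c (T1, T0, T0) = (1 + q) * z (T2, T1, T0) + (1 - q) * t (T2, T1, T0) + (- 1 - q) * z (T2, T2, T1) + (1 + q) * b (T0, T2, T0)" |
  "rel_c q t z b c (T1, T0, T1) = (1 + q) * t (T2, T0, T0) + (1 - q) * t (T2, T1, T1) + q * z (T2, T0, T0) + (1 + 2 * q) * z (T2, T1, T1) - q * b (T0, T1, T0)" |
  "rel_c q t z b c (T1, T0, T2) = - z (T2, T0, T1) + q * z (T2, T1, T2)" |
  "rel_c q t z b c (T1, T1, T0) = c (T1, T1, T0)" |
  "rel_c q t z b c (T1, T1, T1) = (- 1 - 2 * q) * t (T2, T1, T0) + (- 1 + q) * z (T2, T2, T1) + b (T0, T2, T0)" |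
  "rel_c q t z b c (T1, T1, T2) = (- 1 - q) * t (T2, T1, T1) + (1 + q) * z (T2, T1, T1) + (- 1 - q) * b (T0, T1, T0)" |
  "rel_c q t z b c (T1, T2, T0) = c (T1, T2, T0)" |
  "rel_c q t z b c (T1, T2, T2) = (- 2 - q) * t (T2, T1, T0) + (1 + 2 * q) * z (T2, T2, T1) - q * b (T0, T2, T0)" |
  "rel_c q t z b c (T2, T0, T0) = c (T2, T0, T0)" |
  "rel_c q t z b c (T2, T0, T1) = (- 2 - q) * t (T0, T1, T1) + (1 - q) * z (T0, T1, T1) - q * b (T1, T1, T0)" |
  "rel_c q t z b c (T2, T0, T2) = t (T0, T0, T1) - z (T0, T0, T1) + q * b (T1, T0, T0) + b (T1, T1, T1)" |
  "rel_c q t z b c (T2, T1, T0) = c (T2, T1, T0)" |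
  "rel_c q t z b c (T2, T1, T1) = t (T0, T1, T0) + b (T1, T2, T0) - z (T0, T1, T0)" |
  "rel_c q t z b c (T2, T1, T2) = (1 + 2 * q) * t (T0, T1, T1) + (- 2 - q) * z (T0, T1, T1) - b (T1, T1, T0) + z (T0, T2, T2)" |
  "rel_c q t z b c (T2, T2, T1) = - t (T0, T2, T0) + (- 1 - q) * z (T0, T2, T0)" |
  "rel_c q t z b c _ = 0"

text \<open>A solution \<open>A\<close> of \<open>\<delta> d A = 6 \<omega>\<close> for the form \<open>\<omega>\<close> in the image that has \<open>t = 0\<close> and the pivot
  coordinates of \<open>z\<close>, \<open>b\<close>, \<open>c\<close>.\<close>

fun pre_a :: "complex \<Rightarrow> alg \<Rightarrow> alg \<Rightarrow> idx \<Rightarrow> complex" where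
  "pre_a q z b (T0, T1, T1) = - q * z (T0, T1, T1) + (- 1 - q) * b (T1, T1, T0) + z (T0, T2, T2)" |
  "pre_a q z b (T0, T2, T2) = z (T0, T2, T2)" |
  "pre_a q z b (T1, T0, T1) = - q * z (T1, T0, T1) + b (T2, T0, T0)" |
  "pre_a q z b (T2, T2, T1) = - q * z (T2, T2, T1) + q * b (T0, T2, T0)" |
  "pre_a q z b _ = 0"

fun pre_b :: "complex \<Rightarrow> alg \<Rightarrow> alg \<Rightarrow> idx \<Rightarrow> complex" where
  "pre_b q z b (T0, T0, T2) = (- 1 - q) * b (T0, T0, T2)" |
  "pre_b q z b (T0, T1, T1) = q * z (T2, T0, T1)" |
  "pre_b q z b (T0, T2, T1) = z (T2, T1, T1) + (- 1 - q) * b (T0, T1, T0)" |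
  "pre_b q z b (T0, T2, T2) = q * z (T2, T0, T1) + (1 + q) * z (T2, T1, T2)" |
  "pre_b q z b (T1, T0, T1) = - z (T0, T0, T2) + (- 1 - q) * b (T1, T0, T1)" |
  "pre_b q z b (T1, T1, T1) = - z (T0, T0, T1) - b (T1, T0, T0)" |
  "pre_b q z b (T1, T1, T2) = - z (T0, T0, T2) - b (T1, T0, T1)" |
  "pre_b q z b (T1, T2, T0) = - z (T0, T1, T0)" |
  "pre_b q z b (T1, T2, T2) = - b (T1, T1, T1)" |
  "pre_b q z b (T2, T0, T2) = (- 1 - q) * b (T2, T0, T2)" |
  "pre_b q z b (T2, T1, T0) = z (T1, T0, T0)" |
  "pre_b q z b (T2, T1, T2) = q * b (T2, T0, T1)" |
  "pre_b q z b (T2, T2, T1) = - q * z (T1, T1, T1)" |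
  "pre_b q z b _ = 0"

fun pre_c :: "complex \<Rightarrow> alg \<Rightarrow> alg \<Rightarrow> alg \<Rightarrow> idx \<Rightarrow> complex" where
  "pre_c q z b c (T0, T0, T2) = (- 3 - q) * z (T1, T0, T1) + 2 * z (T1, T1, T2) + (- 3 * q) * b (T2, T0, T0)" |
  "pre_c q z b c (T0, T1, T1) = - z (T1, T1, T0)" |
  "pre_c q z b c (T0, T1, T2) = - b (T2, T1, T0) + q * z (T1, T0, T0) + (1 + q) * z (T1, T1, T1)" |
  "pre_c q z b c (T0, T2, T0) = (- 1 - q) * c (T0, T2, T0)" |
  "pre_c q z b c (T0, T2, T2) = (- 1 - q) * z (T1, T2, T1)" |
  "pre_c q z b c (T1, T0, T1) = - q * z (T2, T0, T0)" |
  "pre_c q z b c (T1, T1, T0) = (- 1 - q) * c (T1, T1, T0)" |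
  "pre_c q z b c (T1, T1, T2) = z (T2, T1, T1)" |
  "pre_c q z b c (T1, T2, T0) = (- 1 - q) * c (T1, T2, T0)" |
  "pre_c q z b c (T1, T2, T2) = (1 - 2 * q) * z (T2, T2, T1) - 3 * b (T0, T2, T0)" |
  "pre_c q z b c (T2, T0, T0) = (- 1 - q) * c (T2, T0, T0) + (1 + q) * z (T0, T1, T0)" |
  "pre_c q z b c (T2, T0, T2) = q * z (T0, T0, T1)" |
  "pre_c q z b c (T2, T1, T0) = (- 1 - q) * c (T2, T1, T0) + q * z (T0, T2, T0)" |
  "pre_c q z b c (T2, T1, T2) = (2 + 3 * q) * z (T0, T1, T1) + (3 + 3 * q) * b (T1, T1, T0) - 2 * z (T0, T2, T2)" |
  "pre_c q z b c (T2, T2, T1) = (1 + q) * z (T0, T2, T0)" |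
  "pre_c q z b c (T2, T2, T2) = - q * b (T1, T2, T0) + (1 + q) * z (T0, T1, T0)" |
  "pre_c q z b c _ = 0"

fun pre_d :: "complex \<Rightarrow> alg \<Rightarrow> alg \<Rightarrow> alg \<Rightarrow> idx \<Rightarrow> complex" where
  "pre_d q z b c (T0, T0, T0) = (- 1 - q) * z (T0, T0, T0) - 2 * z (T0, T1, T1) + (2 * q) * b (T1, T1, T0) + (- 2 - 2 * q) * z (T0, T2, T2)" |
  "pre_d q z b c (T0, T0, T2) = (- 1 - 2 * q) * z (T0, T0, T2)" |
  "pre_d q z b c (T0, T1, T1) = (- 2 - 3 * q) * z (T0, T1, T1) + (- 4 - 3 * q) * b (T1, T1, T0) + (1 - 2 * q) * z (T0, T2, T2)" |
  "pre_d q z b c (T0, T1, T2) = (- 1 - 2 * q) * z (T0, T0, T1) + (- 1 - 2 * q) * b (T1, T0, T0) + (- 1 + q) * b (T1, T1, T1)" |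
  "pre_d q z b c (T0, T2, T0) = (- 2 - q) * z (T0, T2, T0)" |
  "pre_d q z b c (T0, T2, T1) = (- 1 + q) * b (T1, T2, T0) + (- 1 - 2 * q) * z (T0, T1, T0)" |
  "pre_d q z b c (T0, T2, T2) = - q * z (T0, T2, T2)" |
  "pre_d q z b c (T1, T0, T1) = (- 2 - 3 * q) * z (T1, T0, T1) + 2 * z (T1, T1, T2) + (3 - q) * b (T2, T0, T0)" |
  "pre_d q z b c (T1, T1, T0) = (- 1 - q) * c (T0, T0, T0) + (- 2 - 2 * q) * z (T1, T1, T0)" |
  "pre_d q z b c (T1, T1, T1) = (- 1 - 2 * q) * b (T2, T1, T0) + (- 2 - q) * z (T1, T0, T0) + (- 2 - q) * z (T1, T1, T1)" |
  "pre_d q z b c (T1, T1, T2) = (- 1 - q) * z (T1, T1, T2)" |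
  "pre_d q z b c (T1, T2, T0) = (- 1 - q) * z (T1, T2, T0)" |
  "pre_d q z b c (T1, T2, T1) = - c (T0, T0, T0) + (- 1 - q) * z (T1, T1, T0) + (- 2 - q) * z (T1, T2, T1)" |
  "pre_d q z b c (T1, T2, T2) = (- 2 - q) * z (T1, T1, T1)" |
  "pre_d q z b c (T2, T0, T0) = (- 2 - q) * z (T2, T0, T0) + (1 + 2 * q) * z (T2, T1, T1) + (- 1 - 2 * q) * b (T0, T1, T0)" |
  "pre_d q z b c (T2, T0, T1) = (1 + q) * b (T0, T0, T0) + (- 2 - 2 * q) * z (T2, T0, T1)" |
  "pre_d q z b c (T2, T0, T2) = (- 1 - q) * z (T2, T0, T2)" |
  "pre_d q z b c (T2, T1, T0) = (- 1 - q) * z (T2, T1, T0) + (2 * q) * z (T2, T2, T1) + (- 2 * q) * b (T0, T2, T0)" |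
  "pre_d q z b c (T2, T1, T2) = (- 1 - 2 * q) * z (T2, T1, T2)" |
  "pre_d q z b c (T2, T2, T1) = (- 2 - 3 * q) * z (T2, T2, T1) + (1 + 4 * q) * b (T0, T2, T0)" |
  "pre_d q z b c (T2, T2, T2) = (1 - q) * z (T2, T1, T1) + (- 2 - q) * b (T0, T1, T0)" |
  "pre_d q z b c _ = 0"

section \<open>Checking the equations and the preimages\<close>

context cube_root
begin

text \<open>Tabulating the operators turns the later checks at the 27 indices into linear identities
  with coefficients in Z[q].\<close>

lemma par_at:
  "par_a q f (T0, T0, T0) = f (T0, T0, T0)"
  "par_a q f (T0, T0, T1) = (- 1 - q) * f (T0, T0, T1)"
  "par_a q f (T0, T0, T2) = q * f (T0, T0, T2)"
  "par_a q f (T0, T1, T0) = q * f (T0, T1, T0)"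
  "par_a q f (T0, T1, T1) = f (T0, T1, T1)"
  "par_a q f (T0, T1, T2) = (- 1 - q) * f (T0, T1, T2)"
  "par_a q f (T0, T2, T0) = (- 1 - q) * f (T0, T2, T0)"
  "par_a q f (T0, T2, T1) = q * f (T0, T2, T1)"
  "par_a q f (T0, T2, T2) = f (T0, T2, T2)"
  "par_a q f (T1, T0, T0) = q * f (T1, T0, T0)"
  "par_a q f (T1, T0, T1) = f (T1, T0, T1)"
  "par_a q f (T1, T0, T2) = (- 1 - q) * f (T1, T0, T2)"
  "par_a q f (T1, T1, T0) = (- 1 - q) * f (T1, T1, T0)"
  "par_a q f (T1, T1, T1) = q * f (T1, T1, T1)"
  "par_a q f (T1, T1, T2) = f (T1, T1, T2)"
  "par_a q f (T1, T2, T0) = f (T1, T2, T0)"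
  "par_a q f (T1, T2, T1) = (- 1 - q) * f (T1, T2, T1)"
  "par_a q f (T1, T2, T2) = q * f (T1, T2, T2)"
  "par_a q f (T2, T0, T0) = (- 1 - q) * f (T2, T0, T0)"
  "par_a q f (T2, T0, T1) = q * f (T2, T0, T1)"
  "par_a q f (T2, T0, T2) = f (T2, T0, T2)"
  "par_a q f (T2, T1, T0) = f (T2, T1, T0)"
  "par_a q f (T2, T1, T1) = (- 1 - q) * f (T2, T1, T1)"
  "par_a q f (T2, T1, T2) = q * f (T2, T1, T2)"
  "par_a q f (T2, T2, T0) = q * f (T2, T2, T0)"
  "par_a q f (T2, T2, T1) = f (T2, T2, T1)"
  "par_a q f (T2, T2, T2) = (- 1 - q) * f (T2, T2, T2)"
  "par_b q f (T0, T0, T0) = (1 - q) * f (T2, T0, T1)"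
  "par_b q f (T0, T0, T1) = (- 1 + q) * f (T2, T0, T2)"
  "par_b q f (T0, T0, T2) = 0"
  "par_b q f (T0, T1, T0) = (1 + 2 * q) * f (T2, T1, T1)"
  "par_b q f (T0, T1, T1) = (- 1 - 2 * q) * f (T2, T1, T2)"
  "par_b q f (T0, T1, T2) = 0"
  "par_b q f (T0, T2, T0) = (- 2 - q) * f (T2, T2, T1)"
  "par_b q f (T0, T2, T1) = (2 + q) * f (T2, T2, T2)"
  "par_b q f (T0, T2, T2) = 0"
  "par_b q f (T1, T0, T0) = (1 - q) * f (T0, T0, T1)"
  "par_b q f (T1, T0, T1) = (- 1 + q) * f (T0, T0, T2)"
  "par_b q f (T1, T0, T2) = 0"
  "par_b q f (T1, T1, T0) = (1 + 2 * q) * f (T0, T1, T1)"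
  "par_b q f (T1, T1, T1) = (- 1 - 2 * q) * f (T0, T1, T2)"
  "par_b q f (T1, T1, T2) = 0"
  "par_b q f (T1, T2, T0) = (- 2 - q) * f (T0, T2, T1)"
  "par_b q f (T1, T2, T1) = (2 + q) * f (T0, T2, T2)"
  "par_b q f (T1, T2, T2) = 0"
  "par_b q f (T2, T0, T0) = (1 - q) * f (T1, T0, T1)"
  "par_b q f (T2, T0, T1) = (- 1 + q) * f (T1, T0, T2)"
  "par_b q f (T2, T0, T2) = 0"
  "par_b q f (T2, T1, T0) = (1 + 2 * q) * f (T1, T1, T1)"
  "par_b q f (T2, T1, T1) = (- 1 - 2 * q) * f (T1, T1, T2)"
  "par_b q f (T2, T1, T2) = 0"
  "par_b q f (T2, T2, T0) = (- 2 - q) * f (T1, T2, T1)"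
  "par_b q f (T2, T2, T1) = (2 + q) * f (T1, T2, T2)"
  "par_b q f (T2, T2, T2) = 0"
  "par_c q f (T0, T0, T0) = (1 - q) * f (T1, T1, T0)"
  "par_c q f (T0, T0, T1) = (1 - q) * f (T1, T0, T0) + (- 2 - q) * f (T1, T1, T1)"
  "par_c q f (T0, T0, T2) = (- 2 - q) * f (T1, T0, T1) + (1 + 2 * q) * f (T1, T1, T2)"
  "par_c q f (T0, T1, T0) = (- 1 + q) * f (T1, T2, T0)"
  "par_c q f (T0, T1, T1) = (- 1 + q) * f (T1, T1, T0) + (2 + q) * f (T1, T2, T1)"
  "par_c q f (T0, T1, T2) = (2 + q) * f (T1, T1, T1) + (- 1 - 2 * q) * f (T1, T2, T2)"
  "par_c q f (T0, T2, T0) = 0"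
  "par_c q f (T0, T2, T1) = 0"
  "par_c q f (T0, T2, T2) = 0"
  "par_c q f (T1, T0, T0) = (1 - q) * f (T2, T1, T0)"
  "par_c q f (T1, T0, T1) = (- 1 - 2 * q) * f (T2, T0, T0) + (- 2 - q) * f (T2, T1, T1)"
  "par_c q f (T1, T0, T2) = (- 1 + q) * f (T2, T0, T1) + (1 + 2 * q) * f (T2, T1, T2)"
  "par_c q f (T1, T1, T0) = (- 1 + q) * f (T2, T2, T0)"
  "par_c q f (T1, T1, T1) = (2 + q) * f (T2, T2, T1)"
  "par_c q f (T1, T1, T2) = (- 1 - 2 * q) * f (T2, T2, T2)"
  "par_c q f (T1, T2, T0) = 0"
  "par_c q f (T1, T2, T1) = (1 + 2 * q) * f (T2, T2, T0)"
  "par_c q f (T1, T2, T2) = (1 - q) * f (T2, T2, T1)"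
  "par_c q f (T2, T0, T0) = (1 - q) * f (T0, T1, T0)"
  "par_c q f (T2, T0, T1) = (- 2 - q) * f (T0, T1, T1)"
  "par_c q f (T2, T0, T2) = (1 + 2 * q) * f (T0, T1, T2)"
  "par_c q f (T2, T1, T0) = (- 1 + q) * f (T0, T2, T0)"
  "par_c q f (T2, T1, T1) = (- 2 - q) * f (T0, T1, T0) + (2 + q) * f (T0, T2, T1)"
  "par_c q f (T2, T1, T2) = (1 + 2 * q) * f (T0, T1, T1) + (- 1 - 2 * q) * f (T0, T2, T2)"
  "par_c q f (T2, T2, T0) = 0"
  "par_c q f (T2, T2, T1) = (2 + q) * f (T0, T2, T0)"
  "par_c q f (T2, T2, T2) = (- 1 - 2 * q) * f (T0, T2, T1)"
  "par_d q f (T0, T0, T0) = f (T0, T0, T0) + (3 + 3 * q) * f (T0, T1, T1)"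
  "par_d q f (T0, T0, T1) = q * f (T0, T0, T1) + (- 3 - 3 * q) * f (T0, T1, T2)"
  "par_d q f (T0, T0, T2) = (- 1 - q) * f (T0, T0, T2)"
  "par_d q f (T0, T1, T0) = (2 + 2 * q) * f (T0, T1, T0) + (- 3 - 3 * q) * f (T0, T2, T1)"
  "par_d q f (T0, T1, T1) = (- 2 - 3 * q) * f (T0, T1, T1) + (3 + 3 * q) * f (T0, T2, T2)"
  "par_d q f (T0, T1, T2) = q * f (T0, T1, T2)"
  "par_d q f (T0, T2, T0) = (- 3 - 2 * q) * f (T0, T2, T0)"
  "par_d q f (T0, T2, T1) = (2 + 2 * q) * f (T0, T2, T1)"
  "par_d q f (T0, T2, T2) = f (T0, T2, T2)"
  "par_d q f (T1, T0, T0) = (2 + 2 * q) * f (T1, T0, T0) + (- 3 * q) * f (T1, T1, T1)"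
  "par_d q f (T1, T0, T1) = (- 2 - 3 * q) * f (T1, T0, T1) + (3 * q) * f (T1, T1, T2)"
  "par_d q f (T1, T0, T2) = q * f (T1, T0, T2)"
  "par_d q f (T1, T1, T0) = (- 3 - 2 * q) * f (T1, T1, T0) + (3 * q) * f (T1, T2, T1)"
  "par_d q f (T1, T1, T1) = (2 + 2 * q) * f (T1, T1, T1) + (- 3 * q) * f (T1, T2, T2)"
  "par_d q f (T1, T1, T2) = f (T1, T1, T2)"
  "par_d q f (T1, T2, T0) = f (T1, T2, T0)"
  "par_d q f (T1, T2, T1) = q * f (T1, T2, T1)"
  "par_d q f (T1, T2, T2) = (- 1 - q) * f (T1, T2, T2)"
  "par_d q f (T2, T0, T0) = (- 3 - 2 * q) * f (T2, T0, T0) - 3 * f (T2, T1, T1)"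
  "par_d q f (T2, T0, T1) = (2 + 2 * q) * f (T2, T0, T1) + 3 * f (T2, T1, T2)"
  "par_d q f (T2, T0, T2) = f (T2, T0, T2)"
  "par_d q f (T2, T1, T0) = f (T2, T1, T0) + 3 * f (T2, T2, T1)"
  "par_d q f (T2, T1, T1) = q * f (T2, T1, T1) - 3 * f (T2, T2, T2)"
  "par_d q f (T2, T1, T2) = (- 1 - q) * f (T2, T1, T2)"
  "par_d q f (T2, T2, T0) = (2 + 2 * q) * f (T2, T2, T0)"
  "par_d q f (T2, T2, T1) = (- 2 - 3 * q) * f (T2, T2, T1)"
  "par_d q f (T2, T2, T2) = q * f (T2, T2, T2)"
  by (simp_all add: par_a_def par_b_def par_c_def par_d_def smul_def q_reduce)

lemmas max_defs = max_a_def max_b_def max_c_def max_d_def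

text \<open>Writing e_a x + e_d y as e_a t + e_z z gives y = - q^-1 z, so z = - q y, and t = x - q z
  = x + q^2 y with q^2 = - 1 - q. These are the arguments of the equations here and in the next two
  lemmas.\<close>

lemma rel_z_max:
  "rel_z q (smul (- q) (max_d xa xb xc xd)) i = smul (- q) (max_d xa xb xc xd) i"
  by (cases i, rename_tac m n k, case_tac m; case_tac n; case_tac k;
      simp add: max_defs par_at smul_def; simp add: q_reduce)

lemma rel_b_max:
  "rel_b q (max_a xa xb xc xd + smul (- 1 - q) (max_d xa xb xc xd))
     (smul (- q) (max_d xa xb xc xd)) (max_b xa xb xc xd) i = max_b xa xb xc xd i"
  by (cases i, rename_tac m n k, case_tac m; case_tac n; case_tac k;
      simp add: max_defs par_at smul_def; simp add: q_reduce)

lemma rel_c_max: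
  "rel_c q (max_a xa xb xc xd + smul (- 1 - q) (max_d xa xb xc xd))
     (smul (- q) (max_d xa xb xc xd)) (max_b xa xb xc xd) (max_c xa xb xc xd) i
   = max_c xa xb xc xd i"
  by (cases i, rename_tac m n k, case_tac m; case_tac n; case_tac k;
      simp add: max_defs par_at smul_def; simp add: q_reduce)


definition pre_vec :: "alg \<Rightarrow> alg \<Rightarrow> alg \<Rightarrow> vec" where
  "pre_vec z b c = vec1 (pre_a q z b) (pre_b q z b) (pre_c q z b c) (pre_d q z b c)"

text \<open>The factors q and 1 + q = - q^-1 are the e_a and e_d components of e_z; the common
  factor 6 keeps the tabulated preimages free of fractions.\<close>

lemma max_pre:
  "max_a (pre_a q z b) (pre_b q z b) (pre_c q z b c) (pre_d q z b c) i = 6 * q * rel_z q z i"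
  "max_b (pre_a q z b) (pre_b q z b) (pre_c q z b c) (pre_d q z b c) i = 6 * rel_b q 0 z b i"
  "max_c (pre_a q z b) (pre_b q z b) (pre_c q z b c) (pre_d q z b c) i = 6 * rel_c q 0 z b c i"
  "max_d (pre_a q z b) (pre_b q z b) (pre_c q z b c) (pre_d q z b c) i = 6 * (1 + q) * rel_z q z i"
  by (cases i, rename_tac m n k, case_tac m; case_tac n; case_tac k;
      simp add: max_defs par_at smul_def; simp add: q_reduce)+
lemma vec1_simps [simp]:
  "vec1 xa xb xc xd L0 = 0" "vec1 xa xb xc xd La = xa" "vec1 xa xb xc xd Lb = xb"
  "vec1 xa xb xc xd Lc = xc" "vec1 xa xb xc xd Ld = xd" "vec1 xa xb xc xd Lab = 0"
  "vec1 xa xb xc xd Lac = 0" "vec1 xa xb xc xd Lad = 0" "vec1 xa xb xc xd Lbc = 0"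
  "vec1 xa xb xc xd Lbd = 0" "vec1 xa xb xc xd Lcd = 0" "vec1 xa xb xc xd Labc = 0"
  "vec1 xa xb xc xd Labd = 0" "vec1 xa xb xc xd Lacd = 0" "vec1 xa xb xc xd Lbcd = 0"
  "vec1 xa xb xc xd Labcd = 0"
  by (simp_all add: vec1_def)

lemma vec1_inject: "vec1 xa xb xc xd = vec1 ya yb yc yd \<longleftrightarrow> xa = ya \<and> xb = yb \<and> xc = yc \<and> xd = yd"
  by (metis vec1_simps(2-5))

lemma vec1_linear:
  "vec1 xa xb xc xd + vec1 ya yb yc yd = vec1 (xa + ya) (xb + yb) (xc + yc) (xd + yd)"
  "vsmul z (vec1 xa xb xc xd) = vec1 (smul z xa) (smul z xb) (smul z xc) (smul z xd)"
  by (rule ext, rename_tac S, case_tac S; simp add: vsmul_def smul_linear)+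

text \<open>\<open>- q\<^sup>-\<^sup>1 = 1 + q\<close>, so this is the form \<open>e\<^sub>z z + e\<^sub>b b + e\<^sub>c c\<close>.\<close>

definition form1 :: "alg \<Rightarrow> alg \<Rightarrow> alg \<Rightarrow> vec" where
  "form1 z b c = vec1 (smul q z) b c (smul (1 + q) z)"

text \<open>The projection of 1-forms onto the part of the image inside \<open>e\<^sub>z \<A> \<oplus> e\<^sub>b \<A> \<oplus> e\<^sub>c \<A>\<close>; the pivots
  of \<open>z\<close> are read off from the \<open>e\<^sub>a\<close>-component \<open>q z\<close>.\<close>

definition clos :: "vec \<Rightarrow> vec" where
  "clos u = (let z = smul (- 1 - q) (u La) in
     form1 (rel_z q z) (rel_b q 0 z (u Lb)) (rel_c q 0 z (u Lb) (u Lc)))"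

lemma rel_linear:
  "rel_z q (y + z) = rel_z q y + rel_z q z"
  "rel_z q (smul x z) = smul x (rel_z q z)"
  "rel_b q 0 (y + z) (b + b') = rel_b q 0 y b + rel_b q 0 z b'"
  "rel_b q 0 (smul x z) (smul x b) = smul x (rel_b q 0 z b)"
  "rel_c q 0 (y + z) (b + b') (c + c') = rel_c q 0 y b c + rel_c q 0 z b' c'"
  "rel_c q 0 (smul x z) (smul x b) (smul x c) = smul x (rel_c q 0 z b c)"
  by (rule ext, rename_tac i, case_tac i, rename_tac m n k, case_tac m; case_tac n; case_tac k;
      simp add: smul_def algebra_simps)+

lemma form1_linear:
  "form1 (y + z) (b + b') (c + c') = form1 y b c + form1 z b' c'"
  "form1 (smul x z) (smul x b) (smul x c) = vsmul x (form1 z b c)"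
  unfolding form1_def vec1_linear by (simp_all only: smul_linear mult.commute)

lemma linear_op_clos: "linear_op clos"
proof -
  have "clos (u + v) = clos u + clos v" for u v
    unfolding clos_def Let_def plus_fun_apply smul_linear(1) rel_linear(1,3,5) form1_linear(1) ..
  moreover have "clos (vsmul x u) = vsmul x (clos u)" for x u
  proof -
    have "smul (- 1 - q) (smul x f) = smul x (smul (- 1 - q) f)" for f :: alg
      unfolding smul_linear by (simp only: mult.commute)
    then have "clos (vsmul x u) = (let z = smul x (smul (- 1 - q) (u La)) in form1 (rel_z q z)
        (rel_b q 0 z (smul x (u Lb))) (rel_c q 0 z (smul x (u Lb)) (smul x (u Lc))))"
      by (simp only: clos_def vsmul_def)
    then show ?thesis
      unfolding clos_def Let_def rel_linear(2,4,6) form1_linear(2) .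
  qed
  ultimately show ?thesis by (simp only: linear_op_def simp_thms)
qed

text \<open>A form over e_z, e_b, e_c has t = 0, and for t = 0 the three equations say exactly that
  \<open>clos\<close> fixes the form.\<close>

lemma clos_max:
  assumes "max_vec x = form1 z b c"
  shows "clos (form1 z b c) = form1 z b c"
proof -
  let ?a = "max_a (x La) (x Lb) (x Lc) (x Ld)" and ?d = "max_d (x La) (x Lb) (x Lc) (x Ld)"
  have max: "?a = smul q z" "max_b (x La) (x Lb) (x Lc) (x Ld) = b"
    "max_c (x La) (x Lb) (x Lc) (x Ld) = c" "?d = smul (1 + q) z"
    using assms by (simp_all add: max_vec_def form1_def vec1_inject)
  have z: "smul (- q) ?d = z" and t: "?a + smul (- 1 - q) ?d = 0"
    unfolding max by (simp_all add: smul_def fun_eq_iff q_reduce)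
  have "rel_z q z i = z i" for i
    using rel_z_max[of "x La" "x Lb" "x Lc" "x Ld" i] unfolding z .
  moreover have "rel_b q 0 z b i = b i" for i
    using rel_b_max[of "x La" "x Lb" "x Lc" "x Ld" i] unfolding z t unfolding max .
  moreover have "rel_c q 0 z b c i = c i" for i
    using rel_c_max[of "x La" "x Lb" "x Lc" "x Ld" i] unfolding z t unfolding max .
  ultimately have "rel_z q z = z" "rel_b q 0 z b = b" "rel_c q 0 z b c = c"
    by (simp_all only: fun_eq_iff simp_thms)
  moreover have "smul (- 1 - q) (form1 z b c La) = z"
    by (simp add: form1_def smul_def fun_eq_iff q_reduce)
  ultimately show ?thesis by (simp add: clos_def form1_def Let_def)
qed

text \<open>Since \<open>max_pre\<close> carries a factor 6, the preimage is taken at one sixth of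
  the data. Together with \<open>clos_max\<close> this identifies the range of \<open>clos\<close>
  with the part of the image over e_z, e_b, e_c.\<close>

lemma clos_in_image: "\<exists>x. homog 1 x \<and> max_vec x = clos u"
proof (intro exI conjI)
  let ?s = "smul (1 / 6)" and ?z = "smul (- 1 - q) (u La)"
  let ?x = "pre_vec (?s ?z) (?s (u Lb)) (?s (u Lc))"
  show "homog 1 ?x" unfolding homog_1_vec1 pre_vec_def by blast
  have "max_vec ?x S i = clos u S i" for S i
    by (cases S) (simp_all add: max_vec_def pre_vec_def clos_def form1_def Let_def max_pre rel_linear(2,4,6) smul_def[of _ "rel_z q _"],
      simp_all add: smul_def)
  then show "max_vec ?x = clos u" by (intro ext)
qed

text \<open>The coordinates that the equations copy unchanged: 21 of z, seen through the e_a
  component q z, then 13 of b and 6 of c. Their number is the dimension.\<close>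

definition pivots :: "(lam \<times> idx) list" where
  "pivots =
    [(La, (T0, T0, T0)), (La, (T0, T0, T1)), (La, (T0, T0, T2)), (La, (T0, T1, T0)),
     (La, (T0, T1, T1)), (La, (T0, T2, T0)), (La, (T0, T2, T2)), (La, (T1, T0, T0)),
     (La, (T1, T0, T1)), (La, (T1, T1, T0)), (La, (T1, T1, T1)), (La, (T1, T1, T2)),
     (La, (T1, T2, T0)), (La, (T1, T2, T1)), (La, (T2, T0, T0)), (La, (T2, T0, T1)),
     (La, (T2, T0, T2)), (La, (T2, T1, T0)), (La, (T2, T1, T1)), (La, (T2, T1, T2)),
     (La, (T2, T2, T1)), (Lb, (T0, T0, T0)), (Lb, (T0, T0, T2)), (Lb, (T0, T1, T0)),
     (Lb, (T0, T2, T0)), (Lb, (T1, T0, T0)), (Lb, (T1, T0, T1)), (Lb, (T1, T1, T0)),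
     (Lb, (T1, T1, T1)), (Lb, (T1, T2, T0)), (Lb, (T2, T0, T0)), (Lb, (T2, T0, T1)),
     (Lb, (T2, T0, T2)), (Lb, (T2, T1, T0)), (Lc, (T0, T0, T0)), (Lc, (T0, T2, T0)),
     (Lc, (T1, T1, T0)), (Lc, (T1, T2, T0)), (Lc, (T2, T0, T0)), (Lc, (T2, T1, T0))]"

lemma clos_pivots: "p \<in> set pivots \<Longrightarrow> clos u (fst p) (snd p) = u (fst p) (snd p)"
proof -
  have "\<forall>p \<in> set pivots. clos u (fst p) (snd p) = u (fst p) (snd p)"
    by (simp add: pivots_def clos_def form1_def smul_def Let_def; simp add: q_reduce)
  then show "p \<in> set pivots \<Longrightarrow> clos u (fst p) (snd p) = u (fst p) (snd p)" by blast
qed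

lemma clos_cong:
  assumes "\<And>p. p \<in> set pivots \<Longrightarrow> u (fst p) (snd p) = v (fst p) (snd p)"
  shows "clos u = clos v"
proof -
  have *: "\<forall>p \<in> set pivots. u (fst p) (snd p) = v (fst p) (snd p)" using assms by blast
  note eqs = *[unfolded pivots_def, simplified]
  have "rel_z q (smul (- 1 - q) (u La)) i = rel_z q (smul (- 1 - q) (v La)) i" 
    "rel_b q 0 (smul (- 1 - q) (u La)) (u Lb) i = rel_b q 0 (smul (- 1 - q) (v La)) (v Lb) i"
    "rel_c q 0 (smul (- 1 - q) (u La)) (u Lb) (u Lc) i = rel_c q 0 (smul (- 1 - q) (v La)) (v Lb) (v Lc) i"
    for i
    by (cases i, rename_tac m n k, case_tac m; case_tac n; case_tac k; simp add: smul_def eqs)+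
  then have "rel_z q (smul (- 1 - q) (u La)) = rel_z q (smul (- 1 - q) (v La))" 
    "rel_b q 0 (smul (- 1 - q) (u La)) (u Lb) = rel_b q 0 (smul (- 1 - q) (v La)) (v Lb)"
    "rel_c q 0 (smul (- 1 - q) (u La)) (u Lb) (u Lc) = rel_c q 0 (smul (- 1 - q) (v La)) (v Lb) (v Lc)"
    by (intro ext, simp only:)+
  then show ?thesis by (simp add: clos_def Let_def)
qed

end

section \<open>Bases\<close>

context cube_root
begin

lemma scalar_mult_el: "cl q (z \<cdot> 1) \<otimes>\<^bsub>\<Omega> q\<^esub> el q v = el q (vsmul z v)"
  by (simp only: el_def cl_mult syn_linear scale_simps mult_1)

lemma Span_el:
  assumes "distinct ps"
  shows "ring.Span (\<Omega> q) (scalars q) (map (\<lambda>p. el q (w p)) ps)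
    = el q ` {v. \<exists>c. v = (\<Sum>p\<leftarrow>ps. vsmul (c p) (w p))}"
proof -
  interpret ring "\<Omega> q" by (rule ring_\<Omega>)
  show ?thesis using assms
  proof (induction ps)
    case Nil
    have "el q 0 \<oplus>\<^bsub>\<Omega> q\<^esub> el q 0 = el q 0" unfolding el_add by simp
    then have "\<zero>\<^bsub>\<Omega> q\<^esub> = el q 0" using add.r_cancel_one'[of "el q 0" "el q 0"] by simp
    then show ?case by (simp add: zero_fun_def)
  next
    case (Cons p ps)
    \<comment> \<open>As p does not occur in the tail, redefining the coefficient at p leaves the
      tail sum unchanged; one coefficient function then serves the whole list.\<close>
    have sum: "(\<Sum>p'\<leftarrow>ps. vsmul ((c(p := z)) p') (w p')) = (\<Sum>p\<leftarrow>ps. vsmul (c p) (w p))" for c z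
      using Cons.prems by (intro arg_cong[of _ _ sum_list] map_cong) auto
    show ?case (is "_ = el q ` ?V")
    proof (intro equalityI subsetI)
      fix x assume "x \<in> ring.Span (\<Omega> q) (scalars q) (map (\<lambda>p. el q (w p)) (p # ps))"
      then obtain z c where x: "x = cl q (z \<cdot> 1) \<otimes>\<^bsub>\<Omega> q\<^esub> el q (w p)
          \<oplus>\<^bsub>\<Omega> q\<^esub> el q (\<Sum>p\<leftarrow>ps. vsmul (c p) (w p))"
        using Cons by (auto simp: line_extension_def set_add_def' r_coset_def scalars_def)
      have "x = el q (\<Sum>p'\<leftarrow>p # ps. vsmul ((c(p := z)) p') (w p'))"
        unfolding x scalar_mult_el el_add list.map sum_list.Cons sum by simp
      then show "x \<in> el q ` ?V" by blast
    next
      fix x assume "x \<in> el q ` ?V"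
      then obtain v c where "x = el q v" and "v = (\<Sum>p\<leftarrow>p # ps. vsmul (c p) (w p))"
        by (elim imageE CollectE exE)
      then have "x = el q (\<Sum>p\<leftarrow>p # ps. vsmul (c p) (w p))" by (simp only:)
      then have "x = cl q (c p \<cdot> 1) \<otimes>\<^bsub>\<Omega> q\<^esub> el q (w p)
          \<oplus>\<^bsub>\<Omega> q\<^esub> el q (\<Sum>p\<leftarrow>ps. vsmul (c p) (w p))"
        unfolding scalar_mult_el el_add list.map sum_list.Cons .
      then show "x \<in> ring.Span (\<Omega> q) (scalars q) (map (\<lambda>p. el q (w p)) (p # ps))"
        using Cons by (auto simp: line_extension_def set_add_def' r_coset_def scalars_def)
    qed
  qed
qed

text \<open>Dual functionals: \<open>ev p\<close> is 1 on \<open>w p\<close> and vanishes on the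
  span of the other members.\<close>

lemma independent_el:
  assumes "distinct ps"
    and add: "\<And>p u v. p \<in> set ps \<Longrightarrow> ev p (u + v) = ev p u + ev p v"
    and scale: "\<And>p z v. p \<in> set ps \<Longrightarrow> ev p (vsmul z v) = z * ev p v"
    and dual: "\<And>p p'. p \<in> set ps \<Longrightarrow> p' \<in> set ps \<Longrightarrow> ev p (w p') = (if p = p' then 1 else (0::complex))"
  shows "ring.independent (\<Omega> q) (scalars q) (map (\<lambda>p. el q (w p)) ps)"
proof -
  interpret ring "\<Omega> q" by (rule ring_\<Omega>)
  have zero: "ev p 0 = 0" if "p \<in> set ps" for p
    using add[OF that, of 0 0] by simp
  have ev_sum: "ev p (\<Sum>p\<leftarrow>qs. vsmul (c p) (w p)) = 0"
    if "p \<in> set ps" "set qs \<subseteq> set ps" "p \<notin> set qs" for p qs c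
    using that
  proof (induction qs)
    case Nil
    then show ?case using zero by (simp only: list.map sum_list.Nil)
  next
    case (Cons p' qs)
    then show ?case by (auto simp only: list.map sum_list.Cons add scale) (auto simp: dual)
  qed
  have "distinct qs \<Longrightarrow> set qs \<subseteq> set ps \<Longrightarrow> independent (scalars q) (map (\<lambda>p. el q (w p)) qs)" for qs
  proof (induction qs)
    case Nil
    then show ?case by simp
  next
    case (Cons p qs)
    have "el q (w p) \<notin> Span (scalars q) (map (\<lambda>p. el q (w p)) qs)"
    proof
      assume "el q (w p) \<in> Span (scalars q) (map (\<lambda>p. el q (w p)) qs)"
      moreover have "distinct qs" using Cons.prems by simp
      ultimately obtain v c where "el q (w p) = el q v" and "v = (\<Sum>p\<leftarrow>qs. vsmul (c p) (w p))"
        unfolding Span_el[OF \<open>distinct qs\<close>] by (elim imageE CollectE exE)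
      then have "ev p (w p) = 0" using ev_sum[of p qs c] Cons.prems by simp
      then show False using dual[of p p] Cons.prems by simp
    qed
    then show ?case using Cons by (simp add: li_Cons)
  qed
  then show ?thesis using \<open>distinct ps\<close> by simp
qed

definition single_vec :: "lam \<times> idx \<Rightarrow> vec" where
  "single_vec p = emb (fst p) (\<lambda>i. if i = snd p then 1 else 0)"

text \<open>A linear map that fixes the pivot coordinates and depends on nothing else has a basis of its
  range indexed by the pivots.\<close>

lemma pivot_basis:
  assumes lin: "linear_op C" and "distinct ps"
    and fixed: "\<And>p u. p \<in> set ps \<Longrightarrow> C u (fst p) (snd p) = u (fst p) (snd p)"
    and cong: "\<And>u v. (\<And>p. p \<in> set ps \<Longrightarrow> u (fst p) (snd p) = v (fst p) (snd p)) \<Longrightarrow> C u = C v"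
  shows "is_basis q (map (\<lambda>p. el q (C (single_vec p))) ps) (el q ` range C)"
proof -
  have single: "single_vec p (fst p') (snd p') = (if p' = p then 1 else 0)" for p p'
    by (cases p; cases p') (auto simp: single_vec_def emb_def)
  have ind: "ring.independent (\<Omega> q) (scalars q) (map (\<lambda>p. el q (C (single_vec p))) ps)"
    by (rule independent_el[where ev = "\<lambda>p v. v (fst p) (snd p)"])
      (simp_all add: assms(2) vsmul_def smul_def fixed single)
  let ?s = "\<lambda>ps c. \<Sum>p\<leftarrow>ps. vsmul (c p) (single_vec p)"
  have C_sum: "C (?s qs c) = (\<Sum>p\<leftarrow>qs. vsmul (c p) (C (single_vec p)))" for qs c
    by (induction qs) (simp_all only: list.map sum_list.Cons sum_list.Nil linear_opD[OF lin])
  \<comment> \<open>A vector and its pivot part agree at the pivots, so \<open>cong\<close> gives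
    them the same image.\<close>
  have C_expand: "C u = C (?s ps (\<lambda>p. u (fst p) (snd p)))" for u
  proof (rule cong)
    fix p assume p: "p \<in> set ps"
    have "distinct qs \<Longrightarrow> ?s qs (\<lambda>p. u (fst p) (snd p)) (fst p) (snd p)
        = (if p \<in> set qs then u (fst p) (snd p) else 0)" for qs
      by (induction qs) (auto simp: vsmul_def smul_def single)
    then show "u (fst p) (snd p) = ?s ps (\<lambda>p. u (fst p) (snd p)) (fst p) (snd p)"
      using p \<open>distinct ps\<close> by simp
  qed
  have "{v. \<exists>c. v = (\<Sum>p\<leftarrow>ps. vsmul (c p) (C (single_vec p)))} = range C"
    unfolding C_sum[symmetric]
  proof (intro equalityI subsetI)
    fix v assume "v \<in> range C"
    then obtain u where "v = C u" by (elim rangeE)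
    then have "v = C (?s ps (\<lambda>p. u (fst p) (snd p)))" using C_expand[of u] by (simp only:)
    then show "v \<in> {v. \<exists>c. v = C (?s ps c)}" by (intro CollectI exI)
  qed (elim CollectE exE, simp only: rangeI)
  with ind show ?thesis
    unfolding is_basis_def Span_el[OF \<open>distinct ps\<close>] by (simp only: simp_thms)
qed

lemma basis_dimension:
  assumes "is_basis q us W" shows "ring.dimension (\<Omega> q) (length us) (scalars q) W"
proof -
  interpret ring "\<Omega> q" by (rule ring_\<Omega>)
  show ?thesis using assms dimension_independent unfolding is_basis_def by blast
qed

end

text \<open>The equations for \<open>z = c = t = 0\<close> and for \<open>z = b = t = 0\<close>.\<close>

fun fix_b :: "complex \<Rightarrow> alg \<Rightarrow> idx \<Rightarrow> complex" where
  "fix_b q b (T0, T0, T0) = b (T0, T0, T0)" |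
  "fix_b q b (T0, T0, T2) = b (T0, T0, T2)" |
  "fix_b q b (T1, T0, T0) = b (T1, T0, T0)" |
  "fix_b q b (T1, T1, T1) = - q * b (T1, T0, T0)" |
  "fix_b q b (T1, T2, T2) = (- 1 - q) * b (T1, T0, T0)" |
  "fix_b q b (T1, T0, T1) = b (T1, T0, T1)" |
  "fix_b q b (T1, T1, T2) = - q * b (T1, T0, T1)" |
  "fix_b q b (T2, T0, T1) = b (T2, T0, T1)" |
  "fix_b q b (T2, T1, T2) = (- 1 - q) * b (T2, T0, T1)" |
  "fix_b q b (T2, T0, T2) = b (T2, T0, T2)" |
  "fix_b q b _ = 0"

fun fix_c :: "alg \<Rightarrow> idx \<Rightarrow> complex" where
  "fix_c c (T0, T0, T0) = c (T0, T0, T0)" |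
  "fix_c c (T2, T0, T0) = c (T2, T0, T0)" |
  "fix_c c (T0, T2, T0) = c (T0, T2, T0)" |
  "fix_c c (T1, T1, T0) = c (T1, T1, T0)" |
  "fix_c c (T1, T2, T0) = c (T1, T2, T0)" |
  "fix_c c (T2, T1, T0) = c (T2, T1, T0)" |
  "fix_c c _ = 0"

section \<open>The equations restricted to a single component\<close>

context cube_root
begin

lemma q_units [simp]: "1 + q \<noteq> 0" "- 1 - q \<noteq> 0" "1 - q \<noteq> 0" "- 1 + q \<noteq> 0" "q \<noteq> 1"
  "- 1 \<noteq> q" "q \<noteq> - 1"
proof -
  show "- 1 - q \<noteq> 0" by (simp flip: inverse_q)
  then show "1 + q \<noteq> 0" "- 1 \<noteq> q" "q \<noteq> - 1" by (auto simp: add_eq_0_iff)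
  show "1 - q \<noteq> 0" "- 1 + q \<noteq> 0" "q \<noteq> 1" using nontriv by (auto simp: algebra_simps)
qed

lemma clos_form1:
  "clos (form1 z b c) = form1 (rel_z q z) (rel_b q 0 z b) (rel_c q 0 z b c)"
proof -
  have "smul (- 1 - q) (smul q z) = z" by (simp add: smul_def fun_eq_iff q_reduce)
  then show ?thesis by (simp add: clos_def form1_def Let_def)
qed

lemma form1_inject: "form1 z b c = form1 z' b' c' \<longleftrightarrow> z = z' \<and> b = b' \<and> c = c'"
proof -
  have "smul q z = smul q z' \<longleftrightarrow> z = z'" by (simp add: smul_def fun_eq_iff)
  then show ?thesis unfolding form1_def vec1_inject by blast
qed

text \<open>With z and c zero, the equations for c become conditions on b: six of its 13 pivots
  vanish, and the index (T2, T0, T2) ties a seventh to another, which leaves six.\<close>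

lemma rel_fix_b:
  assumes "rel_b q 0 0 b = b" "rel_c q 0 0 b 0 = 0"
  shows "fix_b q b = b"
proof
  fix i
  have b: "rel_b q 0 0 b i = b i" and c: "rel_c q 0 0 b 0 i = 0" for i
    by (simp_all add: assms)
  have "b (T0, T1, T0) = 0" using c[of "(T1, T0, T1)"] by simp
  moreover have "b (T0, T2, T0) = 0" using c[of "(T1, T1, T1)"] by simp
  moreover have "b (T1, T1, T0) = 0" using c[of "(T2, T0, T1)"] by simp
  moreover have "b (T1, T2, T0) = 0" using c[of "(T2, T1, T1)"] by simp
  moreover have "b (T2, T0, T0) = 0" using c[of "(T0, T0, T2)"] by simp
  moreover have "b (T2, T1, T0) = 0" using c[of "(T0, T0, T1)"] by simp
  moreover have "b (T1, T1, T1) = - q * b (T1, T0, T0)"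
    using c[of "(T2, T0, T2)"] by (simp add: eq_neg_iff_add_eq_0 add.commute)
  ultimately have "rel_b q 0 0 b i = fix_b q b i"
    by (cases i, rename_tac m n k, case_tac m; case_tac n; case_tac k) (simp_all add: q_reduce)
  then show "fix_b q b i = b i" by (simp add: b)
qed

lemma fix_b_rel: "rel_b q 0 0 (fix_b q b) = fix_b q b" "rel_c q 0 0 (fix_b q b) 0 = 0"
  by (rule ext, rename_tac i, case_tac i, rename_tac m n k, case_tac m; case_tac n; case_tac k;
      simp add: q_reduce)+

lemma rel_fix_c: "rel_c q 0 0 0 c = fix_c c"
  by (rule ext, rename_tac i, case_tac i, rename_tac m n k, case_tac m; case_tac n; case_tac k;
      simp)

lemma fix_c_fix_c: "fix_c (fix_c c) = fix_c c"
  by (rule ext, rename_tac i, case_tac i, rename_tac m n k, case_tac m; case_tac n; case_tac k;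
      simp)

lemma rel_zero: "rel_z q 0 = 0" "rel_b q 0 0 0 = 0"
  by (rule ext, rename_tac i, case_tac i, rename_tac m n k, case_tac m; case_tac n; case_tac k;
      simp)+

text \<open>With b and c zero, their equations form an almost triangular system for the pivots of z;
  the order of the steps is that of back substitution.\<close>

lemma rel_fix_z:
  assumes "rel_z q z = z" "rel_b q 0 z 0 = 0" "rel_c q 0 z 0 0 = 0"
  shows "z = smul (z (T0, T0, T0)) unit0"
proof
  fix i
  have z: "rel_z q z i = z i" and b: "rel_b q 0 z 0 i = 0" and c: "rel_c q 0 z 0 0 i = 0" for i
    by (simp_all add: assms)
  have "z (T0, T0, T1) = 0" using c[of "(T2, T0, T2)"] by simp
  moreover have "z (T0, T0, T2) = 0" using b[of "(T1, T1, T2)"] by simp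
  moreover have "z (T0, T1, T0) = 0" using c[of "(T2, T1, T1)"] by simp
  moreover have "z (T0, T1, T1) = 0" using c[of "(T2, T0, T1)"] by simp
  moreover have "z (T0, T2, T0) = 0" using c[of "(T2, T2, T1)"] by simp
  moreover have "z (T0, T2, T2) = 0" using b[of "(T1, T2, T1)"] by simp
  moreover have z111: "z (T1, T1, T1) = 0" using b[of "(T2, T2, T1)"] by simp
  moreover have "z (T1, T0, T0) = 0" using c[of "(T0, T0, T1)"] z111 by simp
  moreover have z112: "z (T1, T1, T2) = 0" using b[of "(T2, T1, T1)"] by simp
  moreover have "z (T1, T0, T1) = 0" using c[of "(T0, T0, T2)"] z112 by simp
  moreover have z121: "z (T1, T2, T1) = 0" using b[of "(T2, T2, T0)"] by simp
  moreover have "z (T1, T1, T0) = 0" using c[of "(T0, T1, T1)"] z121 by simp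
  moreover have "z (T1, T2, T0) = 0" using c[of "(T0, T1, T0)"] by simp
  moreover have z211: "z (T2, T1, T1) = 0" using c[of "(T1, T1, T2)"] by simp
  moreover have "z (T2, T0, T0) = 0" using c[of "(T1, T0, T1)"] z211 by simp
  moreover have "z (T2, T0, T2) = 0" using b[of "(T0, T0, T1)"] by simp
  moreover have z221: "z (T2, T2, T1) = 0" using c[of "(T1, T1, T1)"] by simp
  moreover have "z (T2, T1, T0) = 0" using c[of "(T1, T0, T0)"] z221 by simp
  \<comment> \<open>This coordinate and the one at (T2, T0, T1) occur together in two equations;
    subtracting these isolates it with the invertible factor q, up to sign.\<close>
  moreover have z212: "z (T2, T1, T2) = 0"
  proof -
    have "q * z (T2, T1, T2) = 0"
      using b[of "(T0, T1, T1)"] b[of "(T0, T2, T2)"] by (simp add: algebra_simps)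
    then show ?thesis by simp
  qed
  moreover have "z (T2, T0, T1) = 0" using b[of "(T0, T2, T2)"] z212 by simp
  ultimately have "rel_z q z i = smul (z (T0, T0, T0)) unit0 i"
    by (cases i, rename_tac m n k, case_tac m; case_tac n; case_tac k)
      (simp_all add: smul_def unit0_def)
  then show "z i = smul (z (T0, T0, T0)) unit0 i" by (simp add: z)
qed

lemma rel_unit0: "rel_z q unit0 = unit0" "rel_b q 0 unit0 0 = 0" "rel_c q 0 unit0 0 0 = 0"
  by (rule ext, rename_tac i, case_tac i, rename_tac m n k, case_tac m; case_tac n; case_tac k;
      simp add: unit0_def)+

section \<open>Intersections with the image\<close>

lemma Maxwell_image: "Maxwell q ` Omega_deg q 1 = el q ` max_vec ` {v. homog 1 v}"
  unfolding Omega_deg_el image_image by (intro image_cong refl) (simp add: Maxwell_el)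

text \<open>Membership in the image becomes a fixed point condition, which the bases below evaluate
  one component at a time.\<close>

lemma el_form1_in_image:
  "el q (form1 z b c) \<in> Maxwell q ` Omega_deg q 1 \<longleftrightarrow> clos (form1 z b c) = form1 z b c"
  unfolding Maxwell_image
proof
  assume "el q (form1 z b c) \<in> el q ` max_vec ` {v. homog 1 v}"
  then obtain x where "form1 z b c = max_vec x" by auto
  then show "clos (form1 z b c) = form1 z b c" using clos_max by metis
next
  assume "clos (form1 z b c) = form1 z b c"
  then show "el q (form1 z b c) \<in> el q ` max_vec ` {v. homog 1 v}"
    using clos_in_image[of "form1 z b c"] by force
qed

lemma coord_mult_alg_sum: "coord q (x * alg_sum f) = act q x (emb L0 f)"
  by (simp only: coord_def act_mult act_alg_sum_emb)

lemma act_emb_forms: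
  "act q (e\<^sub>z q) (emb L0 f) = form1 f 0 0" "act q e\<^sub>b (emb L0 f) = form1 0 f 0"
  "act q e\<^sub>c (emb L0 f) = form1 0 0 f"
proof -
  have "act q (e\<^sub>z q) (emb L0 f) S i = form1 f 0 0 S i \<and> act q e\<^sub>b (emb L0 f) S i = form1 0 f 0 S i
      \<and> act q e\<^sub>c (emb L0 f) S i = form1 0 0 f S i" for S i
    by (cases S) (simp_all add: e\<^sub>z_def act_simps emb_def form1_def vsmul_def op_linear inverse_q,
      simp_all add: smul_def q_reduce)
  then show "act q (e\<^sub>z q) (emb L0 f) = form1 f 0 0" "act q e\<^sub>b (emb L0 f) = form1 0 f 0"
    "act q e\<^sub>c (emb L0 f) = form1 0 0 f"
    by (simp_all only: fun_eq_iff simp_thms)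
qed

lemma times_\<A>_el: "times_\<A> q x = range (\<lambda>f. el q (act q x (emb L0 f)))"
proof -
  have "cl q x \<otimes>\<^bsub>\<Omega> q\<^esub> cl q (alg_sum f) = el q (act q x (emb L0 f))" for f
    by (simp only: cl_mult el_coord flip: coord_mult_alg_sum)
  then show ?thesis by (auto simp: times_\<A>_def \<A>_eq)
qed

lemma sum_form1:
  "{x \<oplus>\<^bsub>\<Omega> q\<^esub> y \<oplus>\<^bsub>\<Omega> q\<^esub> z | x y z.
     x \<in> times_\<A> q (e\<^sub>z q) \<and> y \<in> times_\<A> q e\<^sub>b \<and> z \<in> times_\<A> q e\<^sub>c}
   = el q ` {form1 z b c | z b c. True}"
proof -
  have sum: "el q (form1 z 0 0) \<oplus>\<^bsub>\<Omega> q\<^esub> el q (form1 0 b 0) \<oplus>\<^bsub>\<Omega> q\<^esub> el q (form1 0 0 c) = el q (form1 z b c)"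
    for z b c
    by (simp only: el_add add_0_left add_0_right flip: form1_linear)
  show ?thesis
    unfolding times_\<A>_el act_emb_forms
  proof (intro equalityI subsetI)
    fix w assume "w \<in> el q ` {form1 z b c | z b c. True}"
    then obtain z b c where "w = el q (form1 z b c)" by blast
    then have "w = el q (form1 z 0 0) \<oplus>\<^bsub>\<Omega> q\<^esub> el q (form1 0 b 0) \<oplus>\<^bsub>\<Omega> q\<^esub> el q (form1 0 0 c)"
      by (simp only: sum)
    then show "w \<in> {x \<oplus>\<^bsub>\<Omega> q\<^esub> y \<oplus>\<^bsub>\<Omega> q\<^esub> z | x y z. x \<in> range (\<lambda>f. el q (form1 f 0 0))
        \<and> y \<in> range (\<lambda>f. el q (form1 0 f 0)) \<and> z \<in> range (\<lambda>f. el q (form1 0 0 f))}"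
      by (intro CollectI exI conjI) (assumption, (rule rangeI)+)
  next
    fix w assume "w \<in> {x \<oplus>\<^bsub>\<Omega> q\<^esub> y \<oplus>\<^bsub>\<Omega> q\<^esub> z | x y z. x \<in> range (\<lambda>f. el q (form1 f 0 0))
        \<and> y \<in> range (\<lambda>f. el q (form1 0 f 0)) \<and> z \<in> range (\<lambda>f. el q (form1 0 0 f))}"
    then obtain z b c where "w = el q (form1 z b c)"
      by (elim CollectE exE conjE rangeE) (simp only: sum)
    then show "w \<in> el q ` {form1 z b c | z b c. True}" by blast
  qed
qed

lemma image_inter_forms:
  "Maxwell q ` Omega_deg q 1 \<inter> el q ` {form1 z b c | z b c. True} = el q ` range clos"
proof (intro equalityI subsetI)
  fix x assume x: "x \<in> Maxwell q ` Omega_deg q 1 \<inter> el q ` {form1 z b c | z b c. True}"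
  then obtain z b c where "x = el q (form1 z b c)" by auto
  with x have "x = el q (clos (form1 z b c))" using el_form1_in_image by auto
  then show "x \<in> el q ` range clos" by blast
next
  fix x assume "x \<in> el q ` range clos"
  then obtain u where u: "x = el q (clos u)" by auto
  obtain v where "homog 1 v" "max_vec v = clos u" using clos_in_image by blast
  then have "x \<in> Maxwell q ` Omega_deg q 1" unfolding u Maxwell_image by (metis image_eqI mem_Collect_eq)
  moreover have "clos u \<in> {form1 z b c | z b c. True}" unfolding clos_def Let_def by blast
  ultimately show "x \<in> Maxwell q ` Omega_deg q 1 \<inter> el q ` {form1 z b c | z b c. True}"
    unfolding u by blast
qed

lemma distinct_pivots: "distinct pivots" and length_pivots: "length pivots = 40"
  by (simp_all add: pivots_def)

lemma dimension_image_inter_forms: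
  "ring.dimension (\<Omega> q) 40 (scalars q)
     (Maxwell q ` Omega_deg q 1 \<inter> el q ` {form1 z b c | z b c. True})"
proof -
  have "is_basis q (map (\<lambda>p. el q (clos (single_vec p))) pivots) (el q ` range clos)"
    by (rule pivot_basis[OF linear_op_clos distinct_pivots clos_pivots clos_cong])
  from basis_dimension[OF this] show ?thesis
    unfolding image_inter_forms length_map length_pivots .
qed


section \<open>Bases of the intersections with the three summands\<close>

lemma gen_op_emb:
  "gen_op q Fun_a (emb L0 f) = emb L0 (left_a f)" "gen_op q Fun_b (emb L0 f) = emb L0 (left_b q f)"
  "gen_op q Fun_c (emb L0 f) = emb L0 (left_c q f)" "gen_op q Fun_d (emb L0 f) = emb L0 (left_d q f)"
  by (rule ext, rename_tac S, case_tac S; simp add: emb_def op_linear)+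

lemmas coord_word = coord_def act_mult act_simps(2-4) gen_op_emb power2_eq_square mult_1_right
  act_emb_forms(1) act_emb_forms(2,3)[unfolded act_simps(3)]

text \<open>Once a projection onto the intersection is known, it only remains to match the
  coordinates of the proposed basis with the images of the pivot vectors.\<close>

lemma image_inter_basis:
  assumes lin: "linear_op C" "distinct ps"
    and pivots: "\<And>p u. p \<in> set ps \<Longrightarrow> C u (fst p) (snd p) = u (fst p) (snd p)"
    and cong: "\<And>u v. (\<And>p. p \<in> set ps \<Longrightarrow> u (fst p) (snd p) = v (fst p) (snd p)) \<Longrightarrow> C u = C v"
    and range: "Maxwell q ` Omega_deg q 1 \<inter> times_\<A> q x = el q ` range C"
    and list: "map (\<lambda>f. coord q (x * f)) fs = map (\<lambda>p. C (single_vec p)) ps"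
  shows "is_basis q (map (\<lambda>f. cl q (x * f)) fs) (Maxwell q ` Omega_deg q 1 \<inter> times_\<A> q x)"
proof -
  have "map (\<lambda>f. cl q (x * f)) fs = map (el q) (map (\<lambda>f. coord q (x * f)) fs)"
    by (simp add: el_coord)
  also have "\<dots> = map (\<lambda>p. el q (C (single_vec p))) ps" unfolding list by simp
  finally show ?thesis
    using pivot_basis[OF lin pivots cong] unfolding range by simp
qed

lemma single_vec_apply: "single_vec (S, i) T j = (if T = S \<and> j = i then 1 else 0)"
  by (simp add: single_vec_def emb_def)

lemma linear_op_component:
  assumes add: "\<And>f g. F (f + g) = F f + F g" and scale: "\<And>z f. F (smul z f) = smul z (F f)"
  shows "linear_op (\<lambda>u. form1 0 (F (u S)) 0)" "linear_op (\<lambda>u. form1 0 0 (F (u S)))"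
proof -
  have form1: "form1 0 (f + g) 0 = form1 0 f 0 + form1 0 g 0"
    "form1 0 0 (f + g) = form1 0 0 f + form1 0 0 g"
    "form1 0 (smul z f) 0 = vsmul z (form1 0 f 0)" "form1 0 0 (smul z f) = vsmul z (form1 0 0 f)"
    for f g z
    by (simp_all only: smul_linear add_0_left flip: form1_linear)
  have "vsmul z v S = smul z (v S)" for z v by (simp add: vsmul_def)
  then show "linear_op (\<lambda>u. form1 0 (F (u S)) 0)" "linear_op (\<lambda>u. form1 0 0 (F (u S)))"
    unfolding linear_op_def by (simp_all only: plus_fun_apply add scale form1 simp_thms)
qed

lemma basis_b:
  "is_basis q (map (\<lambda>f. cl q (e\<^sub>b * f)) [1, \<^bold>c\<^sup>2, \<^bold>d\<^sup>2, \<^bold>d * \<^bold>c, \<^bold>d * \<^bold>c\<^sup>2, \<^bold>d\<^sup>2 * \<^bold>c])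
     (Maxwell q ` Omega_deg q 1 \<inter> times_\<A> q e\<^sub>b)"
proof (rule image_inter_basis)
  let ?C = "\<lambda>u. form1 0 (fix_b q (u Lb)) 0"
  \<comment> \<open>The leading monomials of the listed words in c and d: as d = a^2 (1 + q^-1 bc),
    d leads with a^2 and d^2 with a. The lower terms of d^2 are the dependent entries of
    \<open>fix_b\<close>.\<close>
  let ?ps = "[(Lb, (T0, T0, T0)), (Lb, (T0, T0, T2)), (Lb, (T1, T0, T0)), (Lb, (T2, T0, T1)),
    (Lb, (T2, T0, T2)), (Lb, (T1, T0, T1))]"
  have "fix_b q (f + g) = fix_b q f + fix_b q g" "fix_b q (smul z f) = smul z (fix_b q f)" for f g z
    by (rule ext, rename_tac i, case_tac i, rename_tac m n k, case_tac m; case_tac n; case_tac k;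
        simp add: smul_def algebra_simps)+
  then show "linear_op ?C"
    by (rule linear_op_component)
  show "distinct ?ps" by simp
  show "?C u (fst p) (snd p) = u (fst p) (snd p)" if "p \<in> set ?ps" for p u
    using that by (auto simp: form1_def)
  show "?C u = ?C v" if "\<And>p. p \<in> set ?ps \<Longrightarrow> u (fst p) (snd p) = v (fst p) (snd p)" for u v
  proof -
    have "\<forall>p \<in> set ?ps. u (fst p) (snd p) = v (fst p) (snd p)" using that by blast
    note eqs = this[simplified]
    have "fix_b q (u Lb) = fix_b q (v Lb)"
      by (rule ext, rename_tac i, case_tac i, rename_tac m n k, case_tac m; case_tac n; case_tac k;
          simp add: eqs)
    then show ?thesis by simp
  qed
  show "Maxwell q ` Omega_deg q 1 \<inter> times_\<A> q e\<^sub>b = el q ` range ?C"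
  proof (intro equalityI subsetI)
    fix x assume x: "x \<in> Maxwell q ` Omega_deg q 1 \<inter> times_\<A> q e\<^sub>b"
    then obtain b where b: "x = el q (form1 0 b 0)" by (auto simp: times_\<A>_el act_emb_forms)
    with x have "clos (form1 0 b 0) = form1 0 b 0" using el_form1_in_image by auto
    then have "fix_b q b = b"
      by (intro rel_fix_b) (simp_all only: clos_form1 form1_inject rel_zero)
    then have "x = el q (?C (form1 0 b 0))" by (simp add: b form1_def)
    then show "x \<in> el q ` range ?C" by blast
  next
    fix x assume "x \<in> el q ` range ?C"
    then obtain u :: vec where u: "x = el q (?C u)" by blast
    have "clos (?C u) = ?C u" by (simp only: clos_form1 rel_zero fix_b_rel)
    then show "x \<in> Maxwell q ` Omega_deg q 1 \<inter> times_\<A> q e\<^sub>b"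
      unfolding u times_\<A>_el act_emb_forms Int_iff el_form1_in_image by blast
  qed
  show "map (\<lambda>f. coord q (e\<^sub>b * f)) [1, \<^bold>c\<^sup>2, \<^bold>d\<^sup>2, \<^bold>d * \<^bold>c, \<^bold>d * \<^bold>c\<^sup>2, \<^bold>d\<^sup>2 * \<^bold>c]
      = map (\<lambda>p. ?C (single_vec p)) ?ps"
    unfolding list.map coord_word list.inject form1_inject
    by (intro conjI refl TrueI; simp add: fun_eq_iff tri_all single_vec_apply unit0_def left_a_def left_b_def left_c_def left_d_def smul_def;
        simp add: q_reduce)
qed

lemma basis_c:
  "is_basis q (map (\<lambda>f. cl q (e\<^sub>c * f)) [1, \<^bold>a\<^sup>2, \<^bold>b\<^sup>2, \<^bold>a * \<^bold>b, \<^bold>a * \<^bold>b\<^sup>2, \<^bold>a\<^sup>2 * \<^bold>b])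
     (Maxwell q ` Omega_deg q 1 \<inter> times_\<A> q e\<^sub>c)"
proof (rule image_inter_basis)
  let ?C = "\<lambda>u. form1 0 0 (fix_c (u Lc))"
  \<comment> \<open>Words in a and b alone are already monomials of the basis of A, so each pivot is
    just the triple of exponents.\<close>
  let ?ps = "[(Lc, (T0, T0, T0)), (Lc, (T2, T0, T0)), (Lc, (T0, T2, T0)), (Lc, (T1, T1, T0)),
    (Lc, (T1, T2, T0)), (Lc, (T2, T1, T0))]"
  have "fix_c (f + g) = fix_c f + fix_c g" "fix_c (smul z f) = smul z (fix_c f)" for f g z
    by (rule ext, rename_tac i, case_tac i, rename_tac m n k, case_tac m; case_tac n; case_tac k;
        simp add: smul_def algebra_simps)+
  then show "linear_op ?C"
    by (rule linear_op_component)
  show "distinct ?ps" by simp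
  show "?C u (fst p) (snd p) = u (fst p) (snd p)" if "p \<in> set ?ps" for p u
    using that by (auto simp: form1_def)
  show "?C u = ?C v" if "\<And>p. p \<in> set ?ps \<Longrightarrow> u (fst p) (snd p) = v (fst p) (snd p)" for u v
  proof -
    have "\<forall>p \<in> set ?ps. u (fst p) (snd p) = v (fst p) (snd p)" using that by blast
    note eqs = this[simplified]
    have "fix_c (u Lc) = fix_c (v Lc)"
      by (rule ext, rename_tac i, case_tac i, rename_tac m n k, case_tac m; case_tac n; case_tac k;
          simp add: eqs)
    then show ?thesis by simp
  qed
  show "Maxwell q ` Omega_deg q 1 \<inter> times_\<A> q e\<^sub>c = el q ` range ?C"
  proof (intro equalityI subsetI)
    fix x assume x: "x \<in> Maxwell q ` Omega_deg q 1 \<inter> times_\<A> q e\<^sub>c"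
    then obtain c where c: "x = el q (form1 0 0 c)" by (auto simp: times_\<A>_el act_emb_forms)
    with x have "clos (form1 0 0 c) = form1 0 0 c" using el_form1_in_image by auto
    then have "fix_c c = c"
      by (simp only: clos_form1 form1_inject rel_fix_c)
    then have "x = el q (?C (form1 0 0 c))" by (simp add: c form1_def)
    then show "x \<in> el q ` range ?C" by blast
  next
    fix x assume "x \<in> el q ` range ?C"
    then obtain u :: vec where u: "x = el q (?C u)" by blast
    have "clos (?C u) = ?C u" by (simp only: clos_form1 rel_zero rel_fix_c fix_c_fix_c)
    then show "x \<in> Maxwell q ` Omega_deg q 1 \<inter> times_\<A> q e\<^sub>c"
      unfolding u times_\<A>_el act_emb_forms Int_iff el_form1_in_image by blast
  qed
  show "map (\<lambda>f. coord q (e\<^sub>c * f)) [1, \<^bold>a\<^sup>2, \<^bold>b\<^sup>2, \<^bold>a * \<^bold>b, \<^bold>a * \<^bold>b\<^sup>2, \<^bold>a\<^sup>2 * \<^bold>b]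
      = map (\<lambda>p. ?C (single_vec p)) ?ps"
    unfolding list.map coord_word list.inject form1_inject
    by (intro conjI refl TrueI; simp add: fun_eq_iff tri_all single_vec_apply unit0_def left_a_def left_b_def smul_def)
qed

lemma basis_z: "is_basis q [cl q (e\<^sub>z q)] (Maxwell q ` Omega_deg q 1 \<inter> times_\<A> q (e\<^sub>z q))"
proof -
  \<comment> \<open>The e_a component of e_z is q, and - 1 - q = q^-1 normalises the functional to 1
    on e_z. The index list \<open>[()]\<close> below makes e_z a family with one member.\<close>
  let ?e = "form1 unit0 0 0" and ?ev = "\<lambda>v :: vec. (- 1 - q) * v La (T0, T0, T0)"
  have e: "cl q (e\<^sub>z q) = el q ?e"
    unfolding el_coord[symmetric] coord_word ..
  have "ring.independent (\<Omega> q) (scalars q) (map (\<lambda>p. el q ?e) [()])"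
    by (rule independent_el[where ev = "\<lambda>_. ?ev"])
      (simp_all add: vsmul_def smul_def form1_def unit0_def q_reduce)
  moreover have "ring.Span (\<Omega> q) (scalars q) (map (\<lambda>p. el q ?e) [()])
      = Maxwell q ` Omega_deg q 1 \<inter> times_\<A> q (e\<^sub>z q)"
  proof -
    have smul_e: "vsmul z ?e = form1 (smul z unit0) 0 0" for z
      by (simp only: smul_linear flip: form1_linear)
    have "ring.Span (\<Omega> q) (scalars q) (map (\<lambda>p. el q ?e) [()])
        = el q ` {v. \<exists>c. v = (\<Sum>p\<leftarrow>[()]. vsmul (c p) ?e)}"
      by (rule Span_el) simp
    also have "\<dots> = el q ` range (\<lambda>z. form1 (smul z unit0) 0 0)"
    proof (intro arg_cong[of _ _ "(`) (el q)"] equalityI subsetI)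
      fix v assume "v \<in> {v. \<exists>c. v = (\<Sum>p\<leftarrow>[()]. vsmul (c p) ?e)}"
      then show "v \<in> range (\<lambda>z. form1 (smul z unit0) 0 0)" by (auto simp: smul_e)
    next
      fix v assume "v \<in> range (\<lambda>z. form1 (smul z unit0) 0 0)"
      then obtain z where "v = form1 (smul z unit0) 0 0" by blast
      then have "v = (\<Sum>p\<leftarrow>[()]. vsmul ((\<lambda>_. z) p) ?e)" by (simp add: smul_e)
      then show "v \<in> {v. \<exists>c. v = (\<Sum>p\<leftarrow>[()]. vsmul (c p) ?e)}" by (intro CollectI exI)
    qed
    also have "\<dots> = Maxwell q ` Omega_deg q 1 \<inter> times_\<A> q (e\<^sub>z q)"
    proof (intro equalityI subsetI)
      fix x assume "x \<in> el q ` range (\<lambda>z. form1 (smul z unit0) 0 0)"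
      then obtain z where z: "x = el q (form1 (smul z unit0) 0 0)" by blast
      have "clos ?e = ?e" by (simp only: clos_form1 rel_unit0)
      then have "clos (vsmul z ?e) = vsmul z ?e" by (simp only: linear_opD[OF linear_op_clos])
      then show "x \<in> Maxwell q ` Omega_deg q 1 \<inter> times_\<A> q (e\<^sub>z q)"
        unfolding z times_\<A>_el act_emb_forms smul_e Int_iff el_form1_in_image by blast
    next
      fix x assume x: "x \<in> Maxwell q ` Omega_deg q 1 \<inter> times_\<A> q (e\<^sub>z q)"
      then obtain z where z: "x = el q (form1 z 0 0)" by (auto simp: times_\<A>_el act_emb_forms)
      with x have "clos (form1 z 0 0) = form1 z 0 0" using el_form1_in_image by auto
      then have unit: "z = smul (z (T0, T0, T0)) unit0"
        by (intro rel_fix_z) (simp_all only: clos_form1 form1_inject)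
      have "x = el q (form1 (smul (z (T0, T0, T0)) unit0) 0 0)"
        by (subst unit[symmetric]) (rule z)
      then show "x \<in> el q ` range (\<lambda>z. form1 (smul z unit0) 0 0)" by blast
    qed
    finally show ?thesis .
  qed
  ultimately show ?thesis by (simp add: is_basis_def e)
qed


section \<open>The explicit potentials and their curvatures\<close>

lemma coord_potentials:
  "coord q ((q\<^sup>2 / 6) \<cdot> e\<^sub>z q) = form1 (smul (q\<^sup>2 / 6) unit0) 0 0"
  "coord q ((q\<^sup>2 / 6) \<cdot> e\<^sub>b) = form1 0 (smul (q\<^sup>2 / 6) unit0) 0"
  "coord q ((- 1 / 6) \<cdot> e\<^sub>b * (\<^bold>d * \<^bold>b\<^sup>2))
    = form1 0 (smul (- 1 / 6) (left_d q (left_b q (left_b q unit0)))) 0"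
proof -
  have "vsmul z (form1 f 0 0) = form1 (smul z f) 0 0" "vsmul z (form1 0 f 0) = form1 0 (smul z f) 0"
    for z f by (simp_all only: smul_linear flip: form1_linear)
  then show "coord q ((q\<^sup>2 / 6) \<cdot> e\<^sub>z q) = form1 (smul (q\<^sup>2 / 6) unit0) 0 0"
    "coord q ((q\<^sup>2 / 6) \<cdot> e\<^sub>b) = form1 0 (smul (q\<^sup>2 / 6) unit0) 0"
    "coord q ((- 1 / 6) \<cdot> e\<^sub>b * (\<^bold>d * \<^bold>b\<^sup>2))
      = form1 0 (smul (- 1 / 6) (left_d q (left_b q (left_b q unit0)))) 0"
    by (simp_all only: coord_word)
qed

lemma form1_homog: "homog 1 (form1 z b c)"
  unfolding homog_1_vec1 form1_def by blast

lemma diff_potentials: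
  "diff_vec (- 1) (form1 (smul (q\<^sup>2 / 6) unit0) 0 0) = coord q ((q\<^sup>2 * \<mu> q / 6) \<cdot> e\<^sub>b * e\<^sub>c)"
  "diff_vec (- 1) (form1 0 (smul (q\<^sup>2 / 6) unit0) 0)
    = coord q ((- \<mu> q / 6) \<cdot> (q\<^sup>2 \<cdot> e\<^sub>a * e\<^sub>b + e\<^sub>b * e\<^sub>d))"
  "diff_vec (- 1) (form1 0 (smul (- 1 / 6) (left_d q (left_b q (left_b q unit0)))) 0)
    = coord q ((- \<mu> q / 6) \<cdot> (e\<^sub>b * e\<^sub>c * (\<^bold>d\<^sup>2 * \<^bold>b) + (q\<^sup>2 \<cdot> e\<^sub>a * e\<^sub>b + e\<^sub>b * e\<^sub>d) * (\<^bold>d * \<^bold>b\<^sup>2)))"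
proof -
  have pair: "act q (e\<^sub>b * e\<^sub>c) (emb L0 f) = emb Lbc f" "act q (e\<^sub>a * e\<^sub>b) (emb L0 f) = emb Lab f"
    "act q (e\<^sub>b * e\<^sub>d) (emb L0 f) = emb Lbd f" for f
    using act_lam_mon[of Lbc f] act_lam_mon[of Lab f] act_lam_mon[of Lbd f] by simp_all
  have alg: "act q (\<^bold>d\<^sup>2 * \<^bold>b) (emb L0 f) = emb L0 (left_d q (left_d q (left_b q f)))"
    "act q (\<^bold>d * \<^bold>b\<^sup>2) (emb L0 f) = emb L0 (left_d q (left_b q (left_b q f)))" for f
    by (simp_all only: coord_word)
  have 1: "coord q ((q\<^sup>2 * \<mu> q / 6) \<cdot> e\<^sub>b * e\<^sub>c) = vsmul (q\<^sup>2 * \<mu> q / 6) (emb Lbc unit0)"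
    by (simp only: coord_def scale_simps(8) act_simps(4) pair)
  have 2: "coord q ((- \<mu> q / 6) \<cdot> (q\<^sup>2 \<cdot> e\<^sub>a * e\<^sub>b + e\<^sub>b * e\<^sub>d))
      = vsmul (- \<mu> q / 6) (vsmul (q\<^sup>2) (emb Lab unit0) + emb Lbd unit0)"
    by (simp only: coord_def scale_simps(8) act_simps(4) act_add pair)
  have 3: "coord q ((- \<mu> q / 6) \<cdot> (e\<^sub>b * e\<^sub>c * (\<^bold>d\<^sup>2 * \<^bold>b) + (q\<^sup>2 \<cdot> e\<^sub>a * e\<^sub>b + e\<^sub>b * e\<^sub>d) * (\<^bold>d * \<^bold>b\<^sup>2)))
      = vsmul (- \<mu> q / 6) (emb Lbc (left_d q (left_d q (left_b q unit0)))
        + (vsmul (q\<^sup>2) (emb Lab (left_d q (left_b q (left_b q unit0))))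
          + emb Lbd (left_d q (left_b q (left_b q unit0)))))"
    by (simp only: coord_def scale_simps(8) act_simps(4) act_add act_mult[of q "e\<^sub>b * e\<^sub>c"]
        act_mult[of q "_ + _"] pair alg)
  have eval: "vec2 xab xac xad xbc xbd xcd = w"
    if "w L0 = 0" "w La = 0" "w Lb = 0" "w Lc = 0" "w Ld = 0" "w Labc = 0" "w Labd = 0" "w Lacd = 0"
      "w Lbcd = 0" "w Labcd = 0" "w Lab = xab" "w Lac = xac" "w Lad = xad" "w Lbc = xbc" "w Lbd = xbd"
      "w Lcd = xcd" for w xab xac xad xbc xbd xcd
    by (rule ext, rename_tac S, case_tac S) (simp_all add: vec2_def that)
  show "diff_vec (- 1) (form1 (smul (q\<^sup>2 / 6) unit0) 0 0) = coord q ((q\<^sup>2 * \<mu> q / 6) \<cdot> e\<^sub>b * e\<^sub>c)"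
    "diff_vec (- 1) (form1 0 (smul (q\<^sup>2 / 6) unit0) 0)
      = coord q ((- \<mu> q / 6) \<cdot> (q\<^sup>2 \<cdot> e\<^sub>a * e\<^sub>b + e\<^sub>b * e\<^sub>d))"
    "diff_vec (- 1) (form1 0 (smul (- 1 / 6) (left_d q (left_b q (left_b q unit0)))) 0)
      = coord q ((- \<mu> q / 6) \<cdot> (e\<^sub>b * e\<^sub>c * (\<^bold>d\<^sup>2 * \<^bold>b) + (q\<^sup>2 \<cdot> e\<^sub>a * e\<^sub>b + e\<^sub>b * e\<^sub>d) * (\<^bold>d * \<^bold>b\<^sup>2)))"
    unfolding 1 2 3 form1_def diff_vec1 unfolding \<mu>_q q_square
    by (intro eval; simp add: fun_eq_iff tri_all vsmul_def emb_def smul_def par_at unit0_def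
        left_a_def left_b_def left_c_def left_d_def; simp add: field_simps q_sum q_sum_left)+
qed

text \<open>Origin of the constants: e_z and e_b are eigenvectors with eigenvalue 6 q, and 1 / (6 q)
  = q^2 / 6, while e_b a^2 b^2 is sent to - 6 e_c.\<close>

lemma max_multiples:
  "max_vec (form1 (smul z unit0) 0 0) = form1 (smul (6 * q * z) unit0) 0 0"
  "max_vec (form1 0 (smul z unit0) 0) = form1 0 (smul (6 * q * z) unit0) 0"
  "max_vec (form1 0 (smul z (\<lambda>i. if i = (T2, T2, T0) then 1 else 0)) 0)
    = form1 0 0 (smul (- 6 * z) unit0)"
  unfolding max_vec_def form1_def vec1_inject vec1_simps
  by (intro conjI; simp add: fun_eq_iff tri_all max_defs smul_def par_at unit0_def;
      simp add: q_reduce)+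

lemma max_potentials:
  "max_vec (form1 (smul (q\<^sup>2 / 6) unit0) 0 0) = form1 unit0 0 0"
  "max_vec (form1 0 (smul (q\<^sup>2 / 6) unit0) 0) = form1 0 unit0 0"
  "max_vec (form1 0 (smul (- 1 / 6) (left_d q (left_b q (left_b q unit0)))) 0) = form1 0 0 unit0"
proof -
  have cube': "6 * q * (q\<^sup>2 / 6) = 1"
    using cube by (simp add: power2_eq_square power3_eq_cube mult.assoc)
  \<comment> \<open>In d b^2 = a^2 (1 + q^-1 bc) b^2 the second term vanishes because b^3 =
    0.\<close>
  have "left_d q (left_b q (left_b q unit0)) = (\<lambda>i. if i = (T2, T2, T0) then 1 else 0)"
    by (simp add: fun_eq_iff tri_all left_a_def left_b_def left_c_def left_d_def unit0_def smul_def)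
  then show "max_vec (form1 (smul (q\<^sup>2 / 6) unit0) 0 0) = form1 unit0 0 0"
    "max_vec (form1 0 (smul (q\<^sup>2 / 6) unit0) 0) = form1 0 unit0 0"
    "max_vec (form1 0 (smul (- 1 / 6) (left_d q (left_b q (left_b q unit0)))) 0) = form1 0 0 unit0"
    by (simp_all only: max_multiples cube' smul_linear) (simp add: smul_linear)
qed

text \<open>As F is dA, its codifferential is the Maxwell operator at A, so the matrix computed for
  1-forms covers the 2-forms as well.\<close>

lemma potential:
  assumes "coord q A = form1 z b c" and "diff_vec (- 1) (form1 z b c) = coord q F"
    and "max_vec (form1 z b c) = coord q J"
  shows "cl q A \<in> Omega_deg q 1" "ext_d q 1 (cl q A) = cl q F" "codiff q 2 (cl q F) = cl q J"
proof -
  have A: "cl q A = el q (form1 z b c)" using el_coord[of A] assms(1) by simp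
  then show "cl q A \<in> Omega_deg q 1"
    unfolding A Omega_deg_el using form1_homog by blast
  show F: "ext_d q 1 (cl q A) = cl q F"
    unfolding A ext_d_el power_one_right assms(2) el_coord ..
  have "codiff q 2 (cl q F) = Maxwell q (cl q A)" by (simp only: Maxwell_def F)
  also have "\<dots> = cl q J" unfolding A Maxwell_el[OF form1_homog] assms(3) el_coord ..
  finally show "codiff q 2 (cl q F) = cl q J" .
qed

lemma coord_forms:
  "coord q (e\<^sub>z q) = form1 unit0 0 0" "coord q e\<^sub>b = form1 0 unit0 0" "coord q e\<^sub>c = form1 0 0 unit0"
  by (simp_all only: coord_word)

lemmas potential_1 = potential[OF coord_potentials(1) diff_potentials(1)
    max_potentials(1)[folded coord_forms]]
lemmas potential_2 = potential[OF coord_potentials(2) diff_potentials(2)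
    max_potentials(2)[folded coord_forms]]
lemmas potential_3 = potential[OF coord_potentials(3) diff_potentials(3)
    max_potentials(3)[folded coord_forms]]

end

theorem proposition4p10:
  fixes q :: complex
  assumes "q ^ 3 = 1" and "q \<noteq> 1"
  shows "let im = Maxwell q ` Omega_deg q 1;
             A\<^sub>1 = cl q ((q\<^sup>2 / 6) \<cdot> e\<^sub>z q);
             F\<^sub>1 = cl q ((q\<^sup>2 * \<mu> q / 6) \<cdot> e\<^sub>b * e\<^sub>c);
             A\<^sub>2 = cl q ((q\<^sup>2 / 6) \<cdot> e\<^sub>b);
             F\<^sub>2 = cl q ((- \<mu> q / 6) \<cdot> (q\<^sup>2 \<cdot> e\<^sub>a * e\<^sub>b + e\<^sub>b * e\<^sub>d));
             A\<^sub>3 = cl q ((- 1 / 6) \<cdot> e\<^sub>b * (\<^bold>d * \<^bold>b\<^sup>2));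
             F\<^sub>3 = cl q ((- \<mu> q / 6) \<cdot>
                 (e\<^sub>b * e\<^sub>c * (\<^bold>d\<^sup>2 * \<^bold>b) + (q\<^sup>2 \<cdot> e\<^sub>a * e\<^sub>b + e\<^sub>b * e\<^sub>d) * (\<^bold>d * \<^bold>b\<^sup>2)))
         in
         ring.dimension (\<Omega> q) 40 (scalars q)
           (im \<inter> {x \<oplus>\<^bsub>\<Omega> q\<^esub> y \<oplus>\<^bsub>\<Omega> q\<^esub> z | x y z.
                  x \<in> times_\<A> q (e\<^sub>z q) \<and> y \<in> times_\<A> q e\<^sub>b \<and> z \<in> times_\<A> q e\<^sub>c}) \<and>
         is_basis q [cl q (e\<^sub>z q)] (im \<inter> times_\<A> q (e\<^sub>z q)) \<and>
         is_basis q
           (map (\<lambda>f. cl q (e\<^sub>b * f))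
             [1, \<^bold>c\<^sup>2, \<^bold>d\<^sup>2, \<^bold>d * \<^bold>c, \<^bold>d * \<^bold>c\<^sup>2, \<^bold>d\<^sup>2 * \<^bold>c])
           (im \<inter> times_\<A> q e\<^sub>b) \<and>
         is_basis q
           (map (\<lambda>f. cl q (e\<^sub>c * f))
             [1, \<^bold>a\<^sup>2, \<^bold>b\<^sup>2, \<^bold>a * \<^bold>b, \<^bold>a * \<^bold>b\<^sup>2, \<^bold>a\<^sup>2 * \<^bold>b])
           (im \<inter> times_\<A> q e\<^sub>c) \<and>
         {A\<^sub>1, A\<^sub>2, A\<^sub>3} \<subseteq> Omega_deg q 1 \<and>
         ext_d q 1 A\<^sub>1 = F\<^sub>1 \<and> ext_d q 1 A\<^sub>2 = F\<^sub>2 \<and> ext_d q 1 A\<^sub>3 = F\<^sub>3 \<and>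
         codiff q 2 F\<^sub>1 = cl q (e\<^sub>z q) \<and> codiff q 2 F\<^sub>2 = cl q e\<^sub>b \<and> codiff q 2 F\<^sub>3 = cl q e\<^sub>c"
proof -
  interpret cube_root q using assms by unfold_locales
  show ?thesis
    unfolding Let_def sum_form1 insert_subset
    by (intro conjI dimension_image_inter_forms basis_z basis_b basis_c potential_1 potential_2
        potential_3 empty_subsetI)
qed

end
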